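(* (Master formula) Let $m\ge2$, $c>-1$, $s>0$, and let $\omega>0$ be determined by $2s=\sinh\omega$. Then for $x,z\in\mathbb{R}^m\setminus\{0\}$ $$\int_{\mathbb{R}^m}K\left(y,x;i\tfrac{\pi}{2}\right)K\left(z,y;-i\tfrac{\pi}{2}\right)e^{-s|y|^2}h(|y|)\,dy=\sigma_m\,e^{-\frac{\omega\delta}{2}}\,K(z,x;\omega)\,e^{-\frac{|x|^2+|z|^2}{2}\,\frac{1-\cosh\omega}{\sinh\omega}} .$$
   Context: $\mathcal{C}l_m$ is the real associative Clifford algebra generated by $e_1,\dots,e_m$ with $e_ie_j+e_je_i=0$ ($i\ne j$), $e_i^2=-1$; kernels take values in $\mathbb{C}\otimes\mathcal{C}l_m$ and are multiplied in the written order. For $x,y\in\mathbb{R}^m$: $\underline{x}=\sum_i e_ix_i$, $\underline{x}\wedge\underline{y}=\sum_{j<k}e_je_k(x_jy_k-x_ky_j)$. Constants: $\lambda=\frac{m-2}{2}$, $\sigma_m=2\pi^{m/2}/\Gamma(m/2)$, $\delta=1+\frac{m-1}{1+c}$, $\gamma_k=\frac{2}{1+c}\left(k+\frac{m-2}{2}\right)+\frac{c+2}{1+c}$; $h(r)=r^{1-\frac{1+mc}{1+c}}$; $\widetilde{J}_\nu(t)=(t/2)^{-\nu}J_\nu(t)$ with $J_\nu$ the Bessel function; $C_k^\lambda$ Gegenbauer polynomials. For nonzero $x,y\in\mathbb{R}^m$ put $\zeta=|x||y|$, $w=\langle x,y\rangle/\zeta$. For $\omega>0$, $$K(x,y;\omega)=e^{-\frac{\coth\omega}{2}(|x|^2+|y|^2)}\left(A_\omega(\zeta,w)+(\underline{x}\wedge\underline{y})B_\omega(\zeta,w)\right),$$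 $$A_\omega=\sum_{k\ge0}\left(\alpha_k\tfrac{k+2\lambda}{2\lambda}\zeta^{\frac{k}{1+c}}\widetilde{J}_{\frac{\gamma_k}{2}-1}\left(\tfrac{i\zeta}{\sinh\omega}\right)+\tfrac{\alpha_{k-1}}{4\sinh\omega}\tfrac{k}{\lambda}\zeta^{\frac{k+c}{1+c}}\widetilde{J}_{\frac{\gamma_{k-1}}{2}}\left(\tfrac{i\zeta}{\sinh\omega}\right)\right)C_k^\lambda(w),$$ $$B_\omega=\sum_{k\ge1}\left(-\alpha_k\zeta^{\frac{k}{1+c}-1}\widetilde{J}_{\frac{\gamma_k}{2}-1}\left(\tfrac{i\zeta}{\sinh\omega}\right)+\tfrac{\alpha_{k-1}}{2\sinh\omega}\zeta^{\frac{k+c}{1+c}-1}\widetilde{J}_{\frac{\gamma_{k-1}}{2}}\left(\tfrac{i\zeta}{\sinh\omega}\right)\right)C_{k-1}^{\lambda+1}(w),$$ with $\alpha_{-1}=0$ and $\alpha_k=2e^{\frac{\omega\delta}{2}}(2\sinh\omega)^{-\gamma_k/2}$. Moreover $K(x,y;i\frac{\pi}{2})=A(\zeta,w)+(\underline{x}\wedge\underline{y})B(\zeta,w)$ with $$A=\sum_{k\ge0}\zeta^{-\frac{\delta-2}{2}}\left(a_k\tfrac{k+2\lambda}{2\lambda}J_{\frac{\gamma_k}{2}-1}(\zeta)-i\,a_{k-1}\tfrac{k}{2\lambda}J_{\frac{\gamma_{k-1}}{2}}(\zeta)\right)C_k^\lambda(w),$$ $$B=\sum_{k\ge1}\zeta^{-\frac{\delta}{2}}\left(-a_kJ_{\frac{\gamma_k}{2}-1}(\zeta)-i\,a_{k-1}J_{\frac{\gamma_{k-1}}{2}}(\zeta)\right)C_{k-1}^{\lambda+1}(w),\qquad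 a_{-1}=0,\ a_k=e^{-\frac{i\pi k}{2(1+c)}},$$ and $K(x,y;-i\frac{\pi}{2})$ is obtained from $K(x,y;i\frac{\pi}{2})$ by complex conjugation of the complex coefficients (leaving the $e_i$ unchanged). For $m=2$ ($\lambda=0$) the expressions with $\lambda$ in the denominator are limits $\lambda\to0$, using $\lim_{\lambda\to0}\lambda^{-1}C_k^\lambda(\cos\theta)=\frac{2}{k}\cos k\theta$ for $k\ge1$ (and $\frac{k+2\lambda}{2\lambda}C_k^\lambda=1$, $\frac{k}{\lambda}C_k^{\lambda}=0$ for $k=0$). *)

theory Defs
  imports "HOL-Analysis.Analysis"
begin

section \<open>The complexified Clifford algebra\<close>

text \<open>
  The algebra \<open>\<complex> \<otimes> Cl\<^sub>m\<close> is realised on its standard basis: \<open>'n\<close> is the (linearly ordered)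
  index type of the generators, \<open>m = CARD('n)\<close>, and the coordinate \<open>A \<subseteq> UNIV\<close> of an element is the
  coefficient of \<open>e\<^sub>A = e\<^sub>i\<^sub>1 \<cdots> e\<^sub>i\<^sub>k\<close> where \<open>A = {i\<^sub>1 < \<dots> < i\<^sub>k}\<close>. The pointwise product \<open>(*)\<close> that
  the vector type already carries is \<^emph>\<open>not\<close> the Clifford product.
\<close>

type_synonym 'n cclifford = "(complex, 'n set) vec"

text \<open>
  \<open>e\<^sub>A e\<^sub>B = cl_sign A B \<cdot> e\<^sub>C\<close> with \<open>C\<close> the symmetric difference of \<open>A\<close> and \<open>B\<close>: a pair \<open>j < i\<close>
  contributes a sign from anticommuting \<open>e\<^sub>i\<close> past \<open>e\<^sub>j\<close>, a pair \<open>j = i\<close> from \<open>e\<^sub>i\<^sup>2 = -1\<close>.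
\<close>

definition cl_sign :: "'n::{finite,linorder} set \<Rightarrow> 'n set \<Rightarrow> complex" where
  "cl_sign A B = (\<Prod>i\<in>A. \<Prod>j\<in>B. if j \<le> i then - 1 else 1)"

definition cl_mult :: "'n::{finite,linorder} cclifford \<Rightarrow> 'n cclifford \<Rightarrow> 'n cclifford"
    (infixl "\<star>" 70) where
  "u \<star> v = (\<Sum>A\<in>UNIV. \<Sum>B\<in>UNIV. (cl_sign A B * u $ A * v $ B) *s axis (sym_diff A B) 1)"

definition cl_one :: "'n::{finite,linorder} cclifford" where
  "cl_one = axis {} 1"

definition cl_gen :: "'n::{finite,linorder} \<Rightarrow> 'n cclifford" where
  "cl_gen i = axis {i} 1"

definition cl_cnj :: "'n::{finite,linorder} cclifford \<Rightarrow> 'n cclifford" where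
  "cl_cnj u = (\<chi> A. cnj (u $ A))"

definition cl_wedge :: "(real, 'n::{finite,linorder}) vec \<Rightarrow> (real, 'n) vec \<Rightarrow> 'n cclifford" where
  "cl_wedge x y = (\<Sum>(j, k)\<in>{(j, k). j < k}.
     complex_of_real (x $ j * y $ k - x $ k * y $ j) *s (cl_gen j \<star> cl_gen k))"

subsection \<open>The algebra laws\<close>

lemma cl_mult_nth:
  "(u \<star> v) $ C = (\<Sum>A\<in>UNIV. cl_sign A (sym_diff A C) * u $ A * v $ (sym_diff A C))"
proof -
  have inner: "(\<Sum>B\<in>UNIV. cl_sign A B * u $ A * v $ B * (axis (sym_diff A B) (1::complex) $ C))
      = cl_sign A (sym_diff A C) * u $ A * v $ (sym_diff A C)" for A
  proof -
    have eq: "sym_diff A B = C \<longleftrightarrow> B = sym_diff A C" for B :: "'a set"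
      by auto
    have "(\<Sum>B\<in>UNIV. cl_sign A B * u $ A * v $ B * (axis (sym_diff A B) (1::complex) $ C))
       = (\<Sum>B\<in>UNIV. if B = sym_diff A C then cl_sign A B * u $ A * v $ B else 0)"
      by (rule sum.cong) (simp_all add: axis_def eq[symmetric] eq_commute[of C])
    then show ?thesis by simp
  qed
  show ?thesis
    unfolding cl_mult_def by (simp add: inner)
qed

lemma prod_sym_diff:
  fixes f :: "'a::finite \<Rightarrow> complex"
  assumes "\<And>i. f i * f i = 1"
  shows "prod f (sym_diff A B) = prod f A * prod f B"
proof -
  have sq: "prod f (A \<inter> B) * prod f (A \<inter> B) = 1"
    by (simp add: prod.distrib[symmetric] assms)
  have A: "prod f A = prod f (A - B) * prod f (A \<inter> B)"
    by (subst prod.union_disjoint[symmetric]) (auto intro: prod.cong simp: Un_Diff_Int)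
  have B: "prod f B = prod f (B - A) * prod f (A \<inter> B)"
    by (subst prod.union_disjoint[symmetric]) (auto intro!: arg_cong[of _ _ "prod f"])
  have "prod f (sym_diff A B) = prod f (A - B) * prod f (B - A)"
    by (subst prod.union_disjoint) auto
  then show ?thesis
    using sq A B by (metis (no_types, lifting) mult.assoc mult.commute mult.right_neutral)
qed

lemma cl_sign_sym_diff_left: "cl_sign (sym_diff A B) C = cl_sign A C * cl_sign B C"
  unfolding cl_sign_def
  by (rule prod_sym_diff) (simp add: prod.distrib[symmetric] if_distrib cong: if_cong)

lemma cl_sign_sym_diff_right: "cl_sign A (sym_diff B C) = cl_sign A B * cl_sign A C"
  unfolding cl_sign_def by (subst prod_sym_diff) (auto simp: prod.distrib)

lemma cl_mult_axis:
  "axis A a \<star> axis B b = axis (sym_diff A B) (cl_sign A B * a * b)"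
proof -
  have "(axis A a \<star> axis B b) $ C = axis (sym_diff A B) (cl_sign A B * a * b) $ C" for C
  proof -
    have "(axis A a \<star> axis B b) $ C
        = (\<Sum>D\<in>UNIV. if D = A then cl_sign A (sym_diff A C) * a * (axis B b $ (sym_diff A C)) else 0)"
      unfolding cl_mult_nth by (rule sum.cong) (auto simp: axis_def)
    also have "\<dots> = cl_sign A (sym_diff A C) * a * (axis B b $ (sym_diff A C))"
      by simp
    also have "\<dots> = axis (sym_diff A B) (cl_sign A B * a * b) $ C"
    proof (cases "C = sym_diff A B")
      case True
      then have "sym_diff A C = B" by auto
      with True show ?thesis by (simp add: axis_def)
    next
      case False
      then have "sym_diff A C \<noteq> B" by auto
      with False show ?thesis by (simp add: axis_def)
    qed
    finally show ?thesis .
  qed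
  then show ?thesis by (simp add: vec_eq_iff)
qed

lemma cl_mult_add_left: "(u + v) \<star> w = u \<star> w + v \<star> w"
  and cl_mult_add_right: "w \<star> (u + v) = w \<star> u + w \<star> v"
  and cl_mult_smult_left: "(a *s u) \<star> w = a *s (u \<star> w)"
  and cl_mult_smult_right: "w \<star> (a *s u) = a *s (w \<star> u)"
  by (simp_all add: vec_eq_iff cl_mult_nth sum.distrib[symmetric] sum_distrib_left algebra_simps)

lemma cl_mult_sum_left: "(\<Sum>i\<in>I. f i) \<star> w = (\<Sum>i\<in>I. f i \<star> w)"
  and cl_mult_sum_right: "w \<star> (\<Sum>i\<in>I. f i) = (\<Sum>i\<in>I. w \<star> f i)"
proof -
  have z: "0 \<star> w = 0" "w \<star> 0 = 0"
    by (simp_all add: vec_eq_iff cl_mult_nth)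
  show "(\<Sum>i\<in>I. f i) \<star> w = (\<Sum>i\<in>I. f i \<star> w)"
    by (induction I rule: infinite_finite_induct) (simp_all add: z cl_mult_add_left)
  show "w \<star> (\<Sum>i\<in>I. f i) = (\<Sum>i\<in>I. w \<star> f i)"
    by (induction I rule: infinite_finite_induct) (simp_all add: z cl_mult_add_right)
qed

lemma cl_expand: "u = (\<Sum>A\<in>UNIV. axis A (u $ A))" for u :: "'n::{finite,linorder} cclifford"
proof -
  have "(\<Sum>A\<in>UNIV. axis A (u $ A)) $ C = u $ C" for C
  proof -
    have "(\<Sum>A\<in>UNIV. axis A (u $ A)) $ C = (\<Sum>A\<in>UNIV. if A = C then u $ C else 0)"
      unfolding sum_component by (rule sum.cong) (auto simp: axis_def)
    then show ?thesis by simp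
  qed
  then show ?thesis by (simp add: vec_eq_iff)
qed

lemma cl_mult_assoc: "(u \<star> v) \<star> w = u \<star> (v \<star> w)"
proof -
  have ax: "(axis A a \<star> axis B b) \<star> axis C c = axis A a \<star> (axis B b \<star> axis C c)"
    for A B C :: "'a set" and a b c
  proof -
    have "sym_diff (sym_diff A B) C = sym_diff A (sym_diff B C)" by auto
    then show ?thesis
      by (simp add: cl_mult_axis cl_sign_sym_diff_left cl_sign_sym_diff_right algebra_simps)
  qed
  show ?thesis
    apply (subst (1 2) cl_expand[of u], subst (1 2) cl_expand[of v], subst (1 2) cl_expand[of w])
    apply (simp only: cl_mult_sum_left cl_mult_sum_right ax)
    done
qed

lemma cl_one_left: "cl_one \<star> u = u"
  and cl_one_right: "u \<star> cl_one = u"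
proof -
  have s: "cl_sign {} A = 1" "cl_sign A {} = 1" for A :: "'a set"
    by (simp_all add: cl_sign_def)
  show "cl_one \<star> u = u"
    by (subst (1 2) cl_expand[of u]) (simp add: cl_one_def cl_mult_sum_right cl_mult_axis s)
  show "u \<star> cl_one = u"
    by (subst (1 2) cl_expand[of u]) (simp add: cl_one_def cl_mult_sum_left cl_mult_axis s)
qed

lemma cl_gen_square: "cl_gen i \<star> cl_gen i = - cl_one"
  by (simp add: cl_gen_def cl_one_def cl_mult_axis cl_sign_def) (simp add: vec_eq_iff axis_def)

lemma cl_gen_anticommute:
  assumes "i \<noteq> j"
  shows "cl_gen i \<star> cl_gen j + cl_gen j \<star> cl_gen i = 0"
proof -
  have "sym_diff {i} {j} = {i, j}" "sym_diff {j} {i} = {i, j}"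
    using assms by auto
  moreover have "cl_sign {i} {j} = - cl_sign {j} {i}"
    using assms by (auto simp: cl_sign_def)
  ultimately show ?thesis
    unfolding cl_gen_def cl_mult_axis by (simp only:) (simp add: vec_eq_iff axis_def)
qed

lemma cl_blade_insert:
  assumes "\<And>j. j \<in> A \<Longrightarrow> j < i"
  shows "axis A 1 \<star> cl_gen i = axis (insert i A) 1"
proof -
  have "i \<notin> A" using assms by auto
  moreover have "cl_sign A {i} = 1"
    unfolding cl_sign_def by (rule prod.neutral) (use assms in \<open>auto simp: not_le\<close>)
  ultimately show ?thesis by (simp add: cl_gen_def cl_mult_axis)
qed

section \<open>Special functions\<close>

text \<open>
  Bessel function of the first kind, on the principal branch of \<open>t \<mapsto> (t/2)\<^sup>\<nu>\<close>. Because \<open>0 powr a = 0\<close>,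
  neither function takes its limit value at \<open>t = 0\<close> in general; the kernels use them at \<open>t \<noteq> 0\<close> only.
\<close>

definition bessel_J :: "real \<Rightarrow> complex \<Rightarrow> complex" where
  "bessel_J \<nu> t = (t / 2) powr complex_of_real \<nu> *
     (\<Sum>n. (- 1) ^ n / fact n * rGamma (complex_of_real \<nu> + of_nat n + 1) * (t / 2) ^ (2 * n))"

definition bessel_Jt :: "real \<Rightarrow> complex \<Rightarrow> complex" where
  "bessel_Jt \<nu> t = (t / 2) powr (- complex_of_real \<nu>) * bessel_J \<nu> t"

text \<open>Gegenbauer polynomials \<open>C\<^sub>k\<^sup>\<mu>(w)\<close> by the standard three-term recurrence.\<close>

fun gegenbauer :: "nat \<Rightarrow> real \<Rightarrow> real \<Rightarrow> real" where
  "gegenbauer 0 \<mu> w = 1"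
| "gegenbauer (Suc 0) \<mu> w = 2 * \<mu> * w"
| "gegenbauer (Suc (Suc n)) \<mu> w =
     (2 * (real n + 1 + \<mu>) * w * gegenbauer (Suc n) \<mu> w - (real n + 2 * \<mu>) * gegenbauer n \<mu> w)
       / (real n + 2)"

text \<open>
  The expressions \<open>(k + 2\<lambda>) / (2\<lambda>) C\<^sub>k\<^sup>\<lambda>(w)\<close> and \<open>k / \<lambda> C\<^sub>k\<^sup>\<lambda>(w)\<close>, with the limit \<open>\<lambda> \<rightarrow> 0\<close> taken
  when \<open>\<lambda> = 0\<close>.
\<close>

definition value_or_limit :: "(real \<Rightarrow> real) \<Rightarrow> real \<Rightarrow> real" where
  "value_or_limit f \<mu> = (if \<mu> = 0 then Lim (at 0) f else f \<mu>)"

definition gegP :: "nat \<Rightarrow> real \<Rightarrow> real \<Rightarrow> real" where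
  "gegP k lam w = value_or_limit (\<lambda>\<mu>. (real k + 2 * \<mu>) / (2 * \<mu>) * gegenbauer k \<mu> w) lam"

definition gegQ :: "nat \<Rightarrow> real \<Rightarrow> real \<Rightarrow> real" where
  "gegQ k lam w = value_or_limit (\<lambda>\<mu>. real k / \<mu> * gegenbauer k \<mu> w) lam"

lemma gegenbauer_limit:
  "((\<lambda>\<mu>. gegenbauer (Suc n) \<mu> (cos \<theta>) / \<mu>)
      \<longlongrightarrow> 2 / real (Suc n) * cos (real (Suc n) * \<theta>)) (at 0)"
proof (induction n rule: less_induct)
  case (less n)
  consider "n = 0" | "n = 1" | l where "n = Suc (Suc l)"
    by (metis One_nat_def not0_implies_Suc)
  then show ?case
  proof cases
    case 1
    have "((\<lambda>\<mu>. gegenbauer (Suc 0) \<mu> (cos \<theta>) / \<mu>) \<longlongrightarrow> 2 * cos \<theta>) (at 0)"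
      by (rule Lim_transform_eventually[of "\<lambda>_. 2 * cos \<theta>"]) (auto simp: eventually_at_filter)
    then show ?thesis
      using 1 by simp
  next
    case 2
    have "((\<lambda>\<mu>::real. (2 * (1 + \<mu>) * cos \<theta> * (2 * cos \<theta>) - 2) / 2)
        \<longlongrightarrow> (2 * (1 + 0) * cos \<theta> * (2 * cos \<theta>) - 2) / 2) (at 0)"
      by (intro tendsto_intros) auto
    also have "(2 * (1 + 0) * cos \<theta> * (2 * cos \<theta>) - 2) / 2 = cos (2 * \<theta>)"
      by (simp add: cos_double_cos power2_eq_square)
    finally have lim: "((\<lambda>\<mu>::real. (2 * (1 + \<mu>) * cos \<theta> * (2 * cos \<theta>) - 2) / 2)
        \<longlongrightarrow> cos (2 * \<theta>)) (at 0)" .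
    have "\<forall>\<^sub>F \<mu> in at 0. (2 * (1 + \<mu>) * cos \<theta> * (2 * cos \<theta>) - 2) / 2
        = gegenbauer (Suc (Suc 0)) \<mu> (cos \<theta>) / \<mu>"
      by (auto simp: eventually_at_filter field_simps)
    from Lim_transform_eventually[OF lim this] show ?thesis
      using 2 by simp
  next
    case (3 l)
    define a b where "a = real (Suc (Suc l))" and "b = real (Suc l)"
    have ab: "a > 0" "b > 0" "a = b + 1"
      by (simp_all add: a_def b_def)
    have lim: "((\<lambda>\<mu>. (2 * (a + \<mu>) * cos \<theta> * (gegenbauer (Suc (Suc l)) \<mu> (cos \<theta>) / \<mu>)
          - (b + 2 * \<mu>) * (gegenbauer (Suc l) \<mu> (cos \<theta>) / \<mu>)) / (a + 1))
        \<longlongrightarrow> (2 * (a + 0) * cos \<theta> * (2 / a * cos (a * \<theta>)) - (b + 2 * 0) * (2 / b * cos (b * \<theta>))) / (a + 1))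
        (at 0)"
      using less.IH[of "Suc l"] less.IH[of l] 3 ab
      unfolding a_def b_def by (intro tendsto_intros) auto
    have "(2 * (a + 0) * cos \<theta> * (2 / a * cos (a * \<theta>)) - (b + 2 * 0) * (2 / b * cos (b * \<theta>))) / (a + 1)
        = 2 / (a + 1) * (2 * cos \<theta> * cos (a * \<theta>) - cos (b * \<theta>))"
    proof -
      have "2 * (a + 0) * cos \<theta> * (2 / a * cos (a * \<theta>)) = 2 * (2 * cos \<theta> * cos (a * \<theta>))"
        and "(b + 2 * 0) * (2 / b * cos (b * \<theta>)) = 2 * cos (b * \<theta>)"
        using ab(1,2) by simp_all
      then show ?thesis
        by (simp only: right_diff_distrib diff_divide_distrib) simp
    qed
    also have "2 * cos \<theta> * cos (a * \<theta>) - cos (b * \<theta>) = cos ((a + 1) * \<theta>)"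
      using cos_add[of "a * \<theta>" \<theta>] cos_diff[of "a * \<theta>" \<theta>] ab by (simp add: algebra_simps)
    finally have val: "(2 * (a + 0) * cos \<theta> * (2 / a * cos (a * \<theta>)) - (b + 2 * 0) * (2 / b * cos (b * \<theta>))) / (a + 1)
        = 2 / (a + 1) * cos ((a + 1) * \<theta>)" .
    have "\<forall>\<^sub>F \<mu> in at 0. (2 * (a + \<mu>) * cos \<theta> * (gegenbauer (Suc (Suc l)) \<mu> (cos \<theta>) / \<mu>)
          - (b + 2 * \<mu>) * (gegenbauer (Suc l) \<mu> (cos \<theta>) / \<mu>)) / (a + 1)
        = gegenbauer (Suc n) \<mu> (cos \<theta>) / \<mu>"
    proof (rule always_eventually, rule allI)
      fix \<mu> :: real
      have calc: "(2 * (a + \<mu>) * v * (p / \<mu>) - (b + 2 * \<mu>) * (q / \<mu>)) / (a + 1)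
          = (2 * (a + \<mu>) * v * p - (b + 2 * \<mu>) * q) / (a + 1) / \<mu>" for v p q :: real
        by (simp add: diff_divide_distrib mult.commute[of \<mu>])
      have ab': "b + 1 = a" "b + 2 = a + 1"
        using ab by simp_all
      show "(2 * (a + \<mu>) * cos \<theta> * (gegenbauer (Suc (Suc l)) \<mu> (cos \<theta>) / \<mu>)
          - (b + 2 * \<mu>) * (gegenbauer (Suc l) \<mu> (cos \<theta>) / \<mu>)) / (a + 1)
        = gegenbauer (Suc n) \<mu> (cos \<theta>) / \<mu>"
        unfolding calc 3 gegenbauer.simps(3)[of "Suc l"] b_def[symmetric] ab' ..
    qed
    from Lim_transform_eventually[OF lim[unfolded val] this] show ?thesis
      using 3 by (simp add: a_def add_ac)
  qed
qed

lemma gegP_0: "gegP k 0 (cos \<theta>) = cos (real k * \<theta>)"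
proof (cases k)
  case 0
  have "((\<lambda>\<mu>::real. 2 * \<mu> / (2 * \<mu>)) \<longlongrightarrow> 1) (at 0)"
    by (rule Lim_transform_eventually[of "\<lambda>_. 1"]) (auto simp: eventually_at_filter)
  with 0 show ?thesis
    unfolding gegP_def value_or_limit_def by (simp add: tendsto_Lim)
next
  case (Suc n)
  have "((\<lambda>\<mu>. (real k + 2 * \<mu>) / 2 * (gegenbauer k \<mu> (cos \<theta>) / \<mu>))
      \<longlongrightarrow> (real k + 2 * 0) / 2 * (2 / real k * cos (real k * \<theta>))) (at 0)"
    unfolding Suc by (intro tendsto_intros gegenbauer_limit) auto
  then have "((\<lambda>\<mu>. (real k + 2 * \<mu>) / (2 * \<mu>) * gegenbauer k \<mu> (cos \<theta>)) \<longlongrightarrow> cos (real k * \<theta>)) (at 0)"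
    using Suc by (simp add: mult_ac)
  then show ?thesis
    unfolding gegP_def value_or_limit_def by (simp add: tendsto_Lim)
qed

lemma gegQ_0: "gegQ k 0 (cos \<theta>) = (if k = 0 then 0 else 2 * cos (real k * \<theta>))"
proof (cases k)
  case 0
  have "((\<lambda>\<mu>::real. 0 / \<mu>) \<longlongrightarrow> (0::real)) (at 0)"
    by simp
  with 0 show ?thesis
    unfolding gegQ_def value_or_limit_def by (simp add: tendsto_Lim)
next
  case (Suc n)
  have "((\<lambda>\<mu>. real k * (gegenbauer k \<mu> (cos \<theta>) / \<mu>))
      \<longlongrightarrow> real k * (2 / real k * cos (real k * \<theta>))) (at 0)"
    unfolding Suc by (intro tendsto_intros gegenbauer_limit)
  then have "((\<lambda>\<mu>. real k / \<mu> * gegenbauer k \<mu> (cos \<theta>)) \<longlongrightarrow> 2 * cos (real k * \<theta>)) (at 0)"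
    using Suc by (simp add: mult_ac)
  with Suc show ?thesis
    unfolding gegQ_def value_or_limit_def by (simp add: tendsto_Lim)
qed

section \<open>Parameters\<close>

definition param_lambda :: "nat \<Rightarrow> real" where
  "param_lambda m = (real m - 2) / 2"

definition sphere_area :: "nat \<Rightarrow> real" where
  "sphere_area m = 2 * pi powr (real m / 2) / Gamma (real m / 2)"

definition param_delta :: "nat \<Rightarrow> real \<Rightarrow> real" where
  "param_delta m c = 1 + (real m - 1) / (1 + c)"

definition param_gamma :: "nat \<Rightarrow> real \<Rightarrow> int \<Rightarrow> real" where
  "param_gamma m c k = 2 / (1 + c) * (real_of_int k + (real m - 2) / 2) + (c + 2) / (1 + c)"

definition weight_h :: "nat \<Rightarrow> real \<Rightarrow> real \<Rightarrow> real" where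
  "weight_h m c r = r powr (1 - (1 + real m * c) / (1 + c))"

text \<open>The coefficients are only used for \<open>k \<ge> -1\<close>, where the value at \<open>-1\<close> is \<open>0\<close>.\<close>

definition alpha_coeff :: "nat \<Rightarrow> real \<Rightarrow> real \<Rightarrow> int \<Rightarrow> real" where
  "alpha_coeff m c \<omega> k = (if k = - 1 then 0
     else 2 * exp (\<omega> * param_delta m c / 2) * (2 * sinh \<omega>) powr (- param_gamma m c k / 2))"

definition a_coeff :: "real \<Rightarrow> int \<Rightarrow> complex" where
  "a_coeff c k = (if k = - 1 then 0
     else exp (- (\<i> * of_real pi * of_int k / (2 * (1 + of_real c)))))"

section \<open>The kernels\<close>

definition A_omega :: "nat \<Rightarrow> real \<Rightarrow> real \<Rightarrow> real \<Rightarrow> real \<Rightarrow> complex" where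
  "A_omega m c \<omega> \<zeta> w = (\<Sum>k.
     of_real (alpha_coeff m c \<omega> (int k)) * of_real (\<zeta> powr (real k / (1 + c)))
       * bessel_Jt (param_gamma m c (int k) / 2 - 1) (\<i> * of_real \<zeta> / of_real (sinh \<omega>))
       * of_real (gegP k (param_lambda m) w)
     + of_real (alpha_coeff m c \<omega> (int k - 1) / (4 * sinh \<omega>)) * of_real (\<zeta> powr ((real k + c) / (1 + c)))
       * bessel_Jt (param_gamma m c (int k - 1) / 2) (\<i> * of_real \<zeta> / of_real (sinh \<omega>))
       * of_real (gegQ k (param_lambda m) w))"

text \<open>The series for the bivector parts start at \<open>k = 1\<close>; here \<open>k = Suc l\<close>.\<close>

definition B_omega :: "nat \<Rightarrow> real \<Rightarrow> real \<Rightarrow> real \<Rightarrow> real \<Rightarrow> complex" where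
  "B_omega m c \<omega> \<zeta> w = (\<Sum>l. let k = Suc l in
     (- of_real (alpha_coeff m c \<omega> (int k)) * of_real (\<zeta> powr (real k / (1 + c) - 1))
        * bessel_Jt (param_gamma m c (int k) / 2 - 1) (\<i> * of_real \<zeta> / of_real (sinh \<omega>))
      + of_real (alpha_coeff m c \<omega> (int k - 1) / (2 * sinh \<omega>)) * of_real (\<zeta> powr ((real k + c) / (1 + c) - 1))
        * bessel_Jt (param_gamma m c (int k - 1) / 2) (\<i> * of_real \<zeta> / of_real (sinh \<omega>)))
     * of_real (gegenbauer (k - 1) (param_lambda m + 1) w))"

definition K_omega ::
    "real \<Rightarrow> real \<Rightarrow> (real, 'n::{finite,linorder}) vec \<Rightarrow> (real, 'n) vec \<Rightarrow> 'n cclifford" where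
  "K_omega c \<omega> x y =
     (let m = CARD('n); \<zeta> = norm x * norm y; w = inner x y / \<zeta>
      in exp (- (cosh \<omega> / sinh \<omega>) / 2 * ((norm x)\<^sup>2 + (norm y)\<^sup>2)) *\<^sub>R
           (A_omega m c \<omega> \<zeta> w *s cl_one + B_omega m c \<omega> \<zeta> w *s cl_wedge x y))"

definition A_ipi2 :: "nat \<Rightarrow> real \<Rightarrow> real \<Rightarrow> real \<Rightarrow> complex" where
  "A_ipi2 m c \<zeta> w = (\<Sum>k. of_real (\<zeta> powr (- (param_delta m c - 2) / 2)) *
     (a_coeff c (int k) * bessel_J (param_gamma m c (int k) / 2 - 1) (of_real \<zeta>)
        * of_real (gegP k (param_lambda m) w)
      - \<i> * a_coeff c (int k - 1) * bessel_J (param_gamma m c (int k - 1) / 2) (of_real \<zeta>)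
        * of_real (gegQ k (param_lambda m) w / 2)))"

definition B_ipi2 :: "nat \<Rightarrow> real \<Rightarrow> real \<Rightarrow> real \<Rightarrow> complex" where
  "B_ipi2 m c \<zeta> w = (\<Sum>l. let k = Suc l in
     of_real (\<zeta> powr (- param_delta m c / 2)) *
     (- a_coeff c (int k) * bessel_J (param_gamma m c (int k) / 2 - 1) (of_real \<zeta>)
      - \<i> * a_coeff c (int k - 1) * bessel_J (param_gamma m c (int k - 1) / 2) (of_real \<zeta>))
     * of_real (gegenbauer (k - 1) (param_lambda m + 1) w))"

text \<open>The kernels at \<open>\<omega> = i\<pi>/2\<close> (\<open>K_plus\<close>) and \<open>\<omega> = -i\<pi>/2\<close> (\<open>K_minus\<close>).\<close>

definition K_plus ::
    "real \<Rightarrow> (real, 'n::{finite,linorder}) vec \<Rightarrow> (real, 'n) vec \<Rightarrow> 'n cclifford" where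
  "K_plus c x y =
     (let m = CARD('n); \<zeta> = norm x * norm y; w = inner x y / \<zeta>
      in A_ipi2 m c \<zeta> w *s cl_one + B_ipi2 m c \<zeta> w *s cl_wedge x y)"

definition K_minus ::
    "real \<Rightarrow> (real, 'n::{finite,linorder}) vec \<Rightarrow> (real, 'n) vec \<Rightarrow> 'n cclifford" where
  "K_minus c x y = cl_cnj (K_plus c x y)"

end

theory Submission
  imports Defs
begin

text \<open>
  Grouped by spherical degree, each kernel is a series \<open>\<Sum>\<^sub>n p\<^sub>n(|x||y|) Z\<^sub>n\<close> over \<open>n \<in> \<int>\<close>, where the
  \<open>Z\<^sub>n\<close> are the reproducing kernels of the spherical monogenics (\<open>n \<ge> 0\<close>) and of their complements in
  the spherical harmonics (\<open>n < 0\<close>). In polar coordinates the angular integral of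
  \<open>Z\<^sub>n(y, x) Z\<^sub>l(z, y)\<close> vanishes for \<open>n \<noteq> l\<close> and reproduces \<open>\<sigma>\<^sub>m Z\<^sub>n(z, x)\<close> for \<open>n = l\<close>; the phases
  then cancel, and what is left is a radial integral of two Bessel functions of the same order against
  a Gaussian, which Weber's second exponential integral evaluates. The two limits are exchanged by dominated
  convergence of the symmetric partial sums.

  With \<open>U\<^sub>k\<close> the Gegenbauer polynomials of index \<open>m/2\<close> one has \<open>Z\<^sub>k(x, y) = U\<^sub>k + y x U\<^sub>k\<^sub>-\<^sub>1\<close> and
  \<open>Z\<^sub>-\<^sub>k(x, y) = - (U\<^sub>k\<^sub>-\<^sub>2 + y x U\<^sub>k\<^sub>-\<^sub>1)\<close> for unit vectors. The angular integrals thereby reduce to the scalar averages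
  of \<open>U\<^sub>i U\<^sub>j\<close> and the vector averages of \<open>y U\<^sub>i U\<^sub>j\<close>, which the divergence theorem on the sphere determines by
  induction on \<open>i + j\<close>; there the case \<open>\<lambda> = 0\<close> needs no special treatment.
\<close>


section \<open>Polar coordinates\<close>

text \<open>Two obstacles shape the argument. The factors (k + 2\<lambda>)/(2\<lambda>) and
  k/\<lambda> are singular for m = 2. Contiguity relations rewrite both combinations in polynomials
  of index \<lambda> + 1 = m/2, which depend continuously on \<lambda>. These polynomials are not
  orthogonal on the sphere; orthogonality of the Z_n comes from cancellation between the terms of a
  Clifford product, whose inner factor y y = -|y|^2 collapses. The exchange of limits needs a
  majorant uniform in the number of terms. The Z_n grow at most geometrically in |n|, while their
  coefficients contain 1/Gamma at a linearly growing argument and beat every geometric rate, at the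
  price of a factor e^(L|y|) that the Gaussian absorbs. Crude bounds therefore suffice. Indexing by
  integers merges two Bessel families: the n-th order is \<nu> + \<beta>_n with \<nu> = (\<delta> -
  2)/2 and \<beta>_n >= 0. The weight h is the one with r^(m-1) h(r) = r^(2\<nu>+1); the powers r^(2
  \<beta>_n) left over from the Bessel functions complete it to the weight in Weber's
  integral.\<close>

lemma borel_measurable_sgn_euclidean [measurable]:
  "(sgn :: 'a::euclidean_space \<Rightarrow> 'a) \<in> borel_measurable borel"
  unfolding sgn_div_norm by measurable

text \<open>Surface measure as a cone measure: the area of \<open>B\<close> is m times the volume of
  the cone over \<open>B\<close> in the unit ball, since this volume scales like r^m, with
  derivative m at r = 1. As a measure on the whole space it takes integrands without restricting
  them to the sphere.\<close>

definition sphere_measure :: "'a::euclidean_space measure" where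
  "sphere_measure =
     distr (density lborel (\<lambda>y. ennreal (real DIM('a)) * indicator (cball 0 1) y)) borel sgn"

definition radial_measure :: "nat \<Rightarrow> real measure" where
  "radial_measure n = density lborel (\<lambda>r. ennreal (r ^ (n - 1)) * indicator {0<..} r)"

lemma sets_sphere_measure [simp, measurable_cong]: "sets sphere_measure = sets borel"
  by (simp add: sphere_measure_def)

lemma space_sphere_measure [simp]: "space sphere_measure = UNIV"
  by (simp add: sphere_measure_def)

lemma space_radial_measure [simp]: "space (radial_measure n) = UNIV"
  by (simp add: radial_measure_def)

lemma sets_radial_measure [simp, measurable_cong]: "sets (radial_measure n) = sets borel"
  by (simp add: radial_measure_def)

lemma emeasure_sphere_measure:
  assumes "B \<in> sets borel"
  shows "emeasure (sphere_measure :: 'a::euclidean_space measure) B =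
    ennreal (real DIM('a)) * emeasure lborel {y::'a. norm y \<le> 1 \<and> sgn y \<in> B}"
proof -
  have [measurable]: "B \<in> sets borel" by fact
  have [measurable]: "cball (0::'a) 1 \<in> sets borel" by simp
  have [measurable]: "sgn -` B \<in> sets (borel :: 'a measure)"
    by (rule measurable_sets_borel[of _ borel]) measurable
  have "emeasure (sphere_measure :: 'a measure) B =
     (\<integral>\<^sup>+y. ennreal (real DIM('a)) * indicator (cball 0 1) y * indicator (sgn -` B) y \<partial>lborel)"
    unfolding sphere_measure_def
    by (subst emeasure_distr, measurable, subst emeasure_density) (simp_all, measurable)
  also have "\<dots> = (\<integral>\<^sup>+y. ennreal (real DIM('a)) * indicator {y::'a. norm y \<le> 1 \<and> sgn y \<in> B} y \<partial>lborel)"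
    by (intro nn_integral_cong) (auto simp: indicator_def)
  also have "\<dots> = ennreal (real DIM('a)) * emeasure lborel {y::'a. norm y \<le> 1 \<and> sgn y \<in> B}"
    by (subst nn_integral_cmult_indicator) auto
  finally show ?thesis .
qed

lemma emeasure_radial_atMost:
  assumes "0 < n"
  shows "emeasure (radial_measure n) {..r} = ennreal (max 0 r ^ n / n)"
proof (cases "0 < r")
  case True
  have "emeasure (radial_measure n) {..r} = (\<integral>\<^sup>+x. ennreal (x ^ (n - 1)) * indicator {0<..} x * indicator {..r} x \<partial>lborel)"
    unfolding radial_measure_def by (subst emeasure_density) auto
  also have "\<dots> = (\<integral>\<^sup>+x. ennreal (x ^ (n - 1)) * indicator {0..r} x \<partial>lborel)"
  proof (rule nn_integral_cong_AE)
    have "AE x in lborel. x \<noteq> (0::real)" by (rule AE_lborel_singleton)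
    then show "AE x in lborel. ennreal (x ^ (n - 1)) * indicator {0<..} x * indicator {..r} x
      = ennreal (x ^ (n - 1)) * indicator {0..r} x"
      by eventually_elim (auto simp: indicator_def)
  qed
  also have "\<dots> = ennreal (r ^ n / n - 0 ^ n / n)"
  proof (rule nn_integral_FTC_Icc)
    show "((\<lambda>x. x ^ n / real n) has_real_derivative x ^ (n - 1)) (at x)" for x
      using assms by (auto intro!: derivative_eq_intros)
  qed (use True in auto)
  finally show ?thesis using True assms by (simp add: zero_power)
next
  case False
  have "emeasure (radial_measure n) {..r} = (\<integral>\<^sup>+x. ennreal (x ^ (n - 1)) * indicator {0<..} x * indicator {..r} x \<partial>lborel)"
    unfolding radial_measure_def by (subst emeasure_density) auto
  also have "\<dots> = (\<integral>\<^sup>+x. 0 \<partial>(lborel :: real measure))"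
    using False by (intro nn_integral_cong) (auto simp: indicator_def)
  finally show ?thesis using False assms by simp
qed

text \<open>\<open>sgn\<close> is invariant under positive dilations, so the left-hand set is a
  dilate of the unit cone. This homogeneity is the geometric input to polar coordinates.\<close>

lemma emeasure_lborel_scaled_cone:
  fixes B :: "'a::euclidean_space set"
  assumes [measurable]: "B \<in> sets borel" and "0 < r"
  shows "emeasure lborel {y. norm y \<le> r \<and> sgn y \<in> B}
     = ennreal (r ^ DIM('a)) * emeasure lborel {y. norm y \<le> 1 \<and> sgn y \<in> B}"
proof -
  have "emeasure lborel {y. norm y \<le> r \<and> sgn y \<in> B}
     = emeasure (density (distr lborel borel (\<lambda>x. 0 + r *\<^sub>R x)) (\<lambda>_. ennreal (\<bar>r\<bar> ^ DIM('a)))) {y. norm y \<le> r \<and> sgn y \<in> B}"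
    by (subst lborel_affine[of r 0]) (use assms in auto)
  also have "\<dots> = ennreal (r ^ DIM('a)) * emeasure (distr lborel borel (\<lambda>x. 0 + r *\<^sub>R x)) {y. norm y \<le> r \<and> sgn y \<in> B}"
    using assms by (subst emeasure_density_const) auto
  also have "emeasure (distr lborel borel (\<lambda>x. 0 + r *\<^sub>R x)) {y. norm y \<le> r \<and> sgn y \<in> B}
     = emeasure lborel {y. norm y \<le> 1 \<and> sgn y \<in> B}"
    using assms(2) by (subst emeasure_distr) (auto simp: sgn_scaleR intro!: arg_cong[of _ _ "emeasure lborel"])
  finally show ?thesis .
qed

lemma finite_sphere_measure: "emeasure (sphere_measure :: 'a::euclidean_space measure) B < \<infinity>"
proof -
  have "emeasure (sphere_measure :: 'a measure) B \<le> emeasure (sphere_measure :: 'a measure) UNIV"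
    by (metis emeasure_space space_sphere_measure)
  also have "\<dots> = ennreal (real DIM('a)) * emeasure lborel (cball (0::'a) 1)"
    by (subst emeasure_sphere_measure) (auto simp: cball_def)
  also have "\<dots> < \<infinity>"
    using emeasure_lborel_cball_finite[of "0::'a" 1] by (simp add: ennreal_mult_less_top)
  finally show ?thesis .
qed

lemma finite_measure_sphere_measure: "finite_measure (sphere_measure :: 'a::euclidean_space measure)"
  by (rule finite_measureI) (use finite_sphere_measure[of "UNIV :: 'a set"] in \<open>auto simp: less_top\<close>)

lemma sigma_finite_radial_measure:
  assumes "0 < n"
  shows "sigma_finite_measure (radial_measure n)"
proof (rule sigma_finite_measure.intro, intro exI conjI ballI)
  show "countable (range (\<lambda>i::nat. {..real i}))" by simp
  show "\<Union> (range (\<lambda>i::nat. {..real i})) = space (radial_measure n)"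
    using real_arch_simple by auto
qed (use assms in \<open>auto simp: emeasure_radial_atMost\<close>)

text \<open>For fixed \<open>B\<close> both sides are measures in \<open>A\<close>. They agree on
  the half-lines \<open>{..r}\<close> by the scaling of cones, and the half-lines form an
  intersection-stable generator of the Borel sets.\<close>

theorem polar_coordinates_emeasure:
  fixes B :: "'a::euclidean_space set"
  assumes [measurable]: "A \<in> sets borel" "B \<in> sets borel"
  shows "emeasure lborel {y. norm y \<in> A \<and> sgn y \<in> B}
    = emeasure (radial_measure DIM('a)) A * emeasure sphere_measure B"
proof -
  define M where "M = distr (density lborel (indicator {y::'a. sgn y \<in> B})) borel norm"
  define N where "N = density (radial_measure DIM('a)) (\<lambda>_. emeasure (sphere_measure :: 'a measure) B)"
  have M: "emeasure M X = emeasure lborel {y. norm y \<in> X \<and> sgn y \<in> B}" if [measurable]: "X \<in> sets borel" for X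
  proof -
    have [measurable]: "norm -` X \<in> sets (borel :: 'a measure)"
      by (rule measurable_sets_borel[of _ borel]) (use that in measurable)
    show ?thesis
      unfolding M_def
      by (subst emeasure_distr)
        (auto simp: emeasure_density indicator_inter_arith[symmetric] Int_def nn_integral_indicator
          intro!: arg_cong[of _ _ "emeasure lborel"])
  qed
  have N: "emeasure N X = emeasure (radial_measure DIM('a)) X * emeasure (sphere_measure :: 'a measure) B" if [measurable]: "X \<in> sets borel" for X
    unfolding N_def by (subst emeasure_density_const) (use that in \<open>auto simp: mult.commute\<close>)
  have "M = N"
  proof (rule measure_eqI_generator_eq)
    show "Int_stable (range (\<lambda>a::real. {..a}))"
      by (auto simp: Int_stable_def)
    show "range (\<lambda>a::real. {..a}) \<subseteq> Pow UNIV" by simp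
    have "sets borel = sigma_sets UNIV (range (\<lambda>a::real. {..a}))"
      by (subst borel_eq_atMost) simp
    then show "sets M = sigma_sets UNIV (range (\<lambda>a::real. {..a}))" "sets N = sigma_sets UNIV (range (\<lambda>a::real. {..a}))"
      by (auto simp: M_def N_def)
    show eq: "emeasure M X = emeasure N X" if "X \<in> range (\<lambda>a::real. {..a})" for X
    proof -
      from that obtain r where X: "X = {..r}" by auto
      show ?thesis
      proof (cases "0 < r")
        case True
        have e: "ennreal (r ^ DIM('a) / DIM('a)) * ennreal DIM('a) = ennreal (r ^ DIM('a))"
          using True by (subst ennreal_mult[symmetric]) auto
        show ?thesis
          using emeasure_lborel_scaled_cone[OF assms(2) True] True
          by (simp add: X M N emeasure_radial_atMost emeasure_sphere_measure e mult.assoc[symmetric])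
      next
        \<comment> \<open>For \<open>r\<close> not positive, only the origin can belong to the set,
          and it is a null set.\<close>
        case False
        have "emeasure lborel {y::'a. norm y \<in> X \<and> sgn y \<in> B} \<le> emeasure lborel {0::'a}"
          by (rule emeasure_mono)
              (use False X in \<open>auto intro: order_antisym order_trans simp flip: norm_le_zero_iff\<close>)
        then have "emeasure lborel {y::'a. norm y \<in> X \<and> sgn y \<in> B} = 0" by simp
        then show ?thesis
          using False by (simp add: X M N emeasure_radial_atMost)
      qed
    qed
    show "range (\<lambda>i. {..real i}) \<subseteq> range (\<lambda>a::real. {..a})" by auto
    show "(\<Union>i. {..real i}) = UNIV" using real_arch_simple by auto
    show "emeasure M {..real i} \<noteq> \<infinity>" for i
      using finite_sphere_measure[of B]
      by (subst eq) (auto simp: N emeasure_radial_atMost ennreal_mult_eq_top_iff)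
  qed
  then show ?thesis using M[of A] N[of A] by simp
qed

theorem polar_coordinates:
  "distr lborel (borel \<Otimes>\<^sub>M borel) (\<lambda>y::'a::euclidean_space. (norm y, sgn y))
     = radial_measure DIM('a) \<Otimes>\<^sub>M sphere_measure"
proof (rule pair_measure_eqI[symmetric])
  show "sigma_finite_measure (radial_measure DIM('a))"
    by (rule sigma_finite_radial_measure) simp
  show "sigma_finite_measure (sphere_measure :: 'a measure)"
    using finite_measure_sphere_measure finite_measure.axioms by blast
  show "sets (radial_measure DIM('a) \<Otimes>\<^sub>M (sphere_measure :: 'a measure))
      = sets (distr lborel (borel \<Otimes>\<^sub>M borel) (\<lambda>y::'a. (norm y, sgn y)))"
    by (simp cong: sets_pair_measure_cong)
  fix A and B :: "'a set"
  assume "A \<in> sets (radial_measure DIM('a))" "B \<in> sets sphere_measure"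
  then have [measurable]: "A \<in> sets borel" "B \<in> sets borel" by auto
  show "emeasure (radial_measure DIM('a)) A * emeasure sphere_measure B
     = emeasure (distr lborel (borel \<Otimes>\<^sub>M borel) (\<lambda>y::'a. (norm y, sgn y))) (A \<times> B)"
    by (subst emeasure_distr)
      (auto simp: polar_coordinates_emeasure[symmetric] intro!: arg_cong[of _ _ "emeasure lborel"])
qed

text \<open>Separated integrands are all that occurs, and for them Fubini's theorem gives a product
  of two integrals. The angular factor may be vector valued because Clifford-valued functions are
  integrated later.\<close>

lemma has_bochner_integral_polar:
  fixes f :: "real \<Rightarrow> real" and g :: "'a::euclidean_space \<Rightarrow> 'b::{banach, second_countable_topology}"
  assumes f: "has_bochner_integral lborel (\<lambda>r. indicator {0<..} r * (r ^ (DIM('a) - 1) * f r)) I"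
    and [measurable]: "f \<in> borel_measurable borel"
    and g: "has_bochner_integral sphere_measure g J"
  shows "has_bochner_integral lborel (\<lambda>y. f (norm y) *\<^sub>R g (sgn y)) (I *\<^sub>R J)"
proof -
  have [measurable]: "g \<in> borel_measurable borel"
    using g by (auto simp: has_bochner_integral_iff dest: borel_measurable_integrable)
  interpret R: sigma_finite_measure "radial_measure DIM('a)"
    by (rule sigma_finite_radial_measure) simp
  interpret S: finite_measure "sphere_measure :: 'a measure"
    by (rule finite_measure_sphere_measure)
  interpret P: pair_sigma_finite "radial_measure DIM('a)" "sphere_measure :: 'a measure" ..
  have fr: "has_bochner_integral (radial_measure DIM('a)) f I"
  proof -
    have e: "radial_measure DIM('a) = density lborel (\<lambda>r. ennreal (indicator {0<..} r * r ^ (DIM('a) - 1)))"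
      unfolding radial_measure_def by (rule density_cong) (auto simp: indicator_def)
    show ?thesis
      unfolding e by (rule has_bochner_integral_density) (use f in \<open>auto simp: mult.assoc indicator_def\<close>)
  qed
  have int: "integrable (radial_measure DIM('a) \<Otimes>\<^sub>M sphere_measure) (\<lambda>(r, \<eta>). f r *\<^sub>R g \<eta>)"
  proof (rule P.Fubini_integrable)
    show "(\<lambda>(r, \<eta>). f r *\<^sub>R g \<eta>) \<in> borel_measurable (radial_measure DIM('a) \<Otimes>\<^sub>M sphere_measure)"
      by measurable
    have "integrable (radial_measure DIM('a)) (\<lambda>r. \<bar>f r\<bar> * (LINT \<eta>|sphere_measure. norm (g \<eta>)))"
      using fr by (intro integrable_mult_left integrable_abs) (auto simp: has_bochner_integral_iff)
    then show "integrable (radial_measure DIM('a)) (\<lambda>r. LINT \<eta>|sphere_measure. norm (case (r, \<eta>) of (r, \<eta>) \<Rightarrow> f r *\<^sub>R g \<eta>))"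
      by simp
    show "AE r in radial_measure DIM('a). integrable sphere_measure (\<lambda>\<eta>. case (r, \<eta>) of (r, \<eta>) \<Rightarrow> f r *\<^sub>R g \<eta>)"
      using g by (auto simp: has_bochner_integral_iff)
  qed
  have "(\<integral>x. (\<lambda>(r, \<eta>). f r *\<^sub>R g \<eta>) x \<partial>(radial_measure DIM('a) \<Otimes>\<^sub>M sphere_measure))
     = (LINT r|radial_measure DIM('a). LINT \<eta>|sphere_measure. f r *\<^sub>R g \<eta>)"
    using P.integral_fst'[OF int] by simp
  also have "\<dots> = I *\<^sub>R J"
    using fr g by (simp add: has_bochner_integral_iff)
  finally have "has_bochner_integral (distr lborel (borel \<Otimes>\<^sub>M borel) (\<lambda>y::'a. (norm y, sgn y))) (\<lambda>(r, \<eta>). f r *\<^sub>R g \<eta>) (I *\<^sub>R J)"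
    using int by (simp add: has_bochner_integral_iff polar_coordinates)
  then show ?thesis
    by (subst (asm) has_bochner_integral_iff)
      (auto simp: has_bochner_integral_iff integrable_distr_eq integral_distr)
qed

text \<open>Only the origin is not mapped to a unit vector by \<open>sgn\<close>. Identities for
  unit vectors are therefore used almost everywhere rather than pointwise.\<close>

lemma AE_sphere_measure: "AE \<eta> in (sphere_measure :: 'a::euclidean_space measure). norm \<eta> = 1"
proof -
  have "AE y in (lborel :: 'a measure). y \<noteq> 0" by (rule AE_lborel_singleton)
  then show ?thesis
    unfolding sphere_measure_def
    by (subst AE_distr_iff, measurable, subst AE_density, measurable)
      (auto simp: norm_sgn elim: eventually_mono)
qed

lemma measure_sphere_measure:
  "measure (sphere_measure :: 'a::euclidean_space measure) UNIV
     = 2 * pi powr (DIM('a) / 2) / Gamma (DIM('a) / 2)"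
proof -
  have "measure (sphere_measure :: 'a measure) UNIV = DIM('a) * unit_ball_vol DIM('a)"
    using emeasure_sphere_measure[of "UNIV :: 'a set"]
    by (simp add: measure_def cball_def[of "0::'a", simplified dist_norm, simplified, symmetric] emeasure_cball enn2real_mult)
  also have "\<dots> = DIM('a) * (pi powr (DIM('a) / 2) / Gamma (real DIM('a) / 2 + 1))"
    by (simp add: unit_ball_vol_def)
  also have "Gamma (real DIM('a) / 2 + 1) = DIM('a) / 2 * Gamma (real DIM('a) / 2)"
    by (rule Gamma_plus1) (use DIM_positive[where 'a='a] in \<open>auto elim!: nonpos_Ints_cases simp del: DIM_positive\<close>)
  also have "DIM('a) * (pi powr (DIM('a) / 2) / (DIM('a) / 2 * Gamma (real DIM('a) / 2)))
      = 2 * pi powr (DIM('a) / 2) / Gamma (DIM('a) / 2)"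
    by simp
  finally show ?thesis .
qed

section \<open>Gaussian integrals\<close>

text \<open>Substitution t = s r^2 in Euler's integral for Gamma at (p + 1)/2.\<close>

lemma has_bochner_integral_powr_gauss:
  fixes p s :: real
  assumes "- 1 < p" "0 < s"
  shows "has_bochner_integral lborel (\<lambda>r. indicator {0<..} r * (r powr p * exp (- s * r\<^sup>2)))
     (Gamma ((p + 1) / 2) / (2 * s powr ((p + 1) / 2)))"
proof -
  define x where "x = (p + 1) / 2"
  have "x > 0" using assms by (simp add: x_def)
  have I0: "((\<lambda>t. t powr (x - 1) / exp t) has_integral Gamma x) {0..}"
    by (rule Gamma_integral_real[OF \<open>x > 0\<close>])
  have I: "((\<lambda>t. t powr (x - 1) / exp t) has_integral Gamma x) {0<..}"
    by (rule has_integral_spike_set_eq[THEN iffD1, OF _ _ I0])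
      (auto intro: negligible_subset[OF negligible_sing[of 0]])
  have abs: "(\<lambda>t. t powr (x - 1) / exp t) absolutely_integrable_on {0<..}"
    by (rule nonnegative_absolutely_integrable_1) (use I in \<open>auto simp: has_integral_iff\<close>)
  have img: "(\<lambda>r. s * r\<^sup>2) ` {0<..} = {0<..}"
  proof (intro equalityI subsetI)
    fix t :: real assume "t \<in> {0<..}"
    then have "t = s * (sqrt (t / s))\<^sup>2" "sqrt (t / s) \<in> {0<..}" using assms by auto
    then show "t \<in> (\<lambda>r. s * r\<^sup>2) ` {0<..}" by blast
  qed (use assms in auto)
  have "(\<lambda>r. \<bar>2 * s * r\<bar> * ((s * r\<^sup>2) powr (x - 1) / exp (s * r\<^sup>2))) absolutely_integrable_on {0<..} \<and>
      integral {0<..} (\<lambda>r. \<bar>2 * s * r\<bar> * ((s * r\<^sup>2) powr (x - 1) / exp (s * r\<^sup>2))) = Gamma x"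
  proof (subst has_absolute_integral_change_of_variables_1'[where g = "\<lambda>r. s * r\<^sup>2"])
    show "inj_on (\<lambda>r. s * r\<^sup>2) {0<..}"
      using assms by (auto simp: inj_on_def power2_eq_iff)
    show "((\<lambda>r. s * r\<^sup>2) has_real_derivative 2 * s * r) (at r within {0<..})" for r
      by (auto intro!: derivative_eq_intros)
  qed (use I abs in \<open>auto simp: img has_integral_iff\<close>)
  moreover have "\<bar>2 * s * r\<bar> * ((s * r\<^sup>2) powr (x - 1) / exp (s * r\<^sup>2))
      = (2 * s powr x) * (r powr p * exp (- s * r\<^sup>2))" if "r \<in> {0<..}" for r
  proof -
    have "r > 0" using that by simp
    then have "(s * r\<^sup>2) powr (x - 1) = s powr (x - 1) * r powr (2 * (x - 1))"
      using assms by (simp add: powr_mult powr_powr flip: powr_numeral)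
    moreover have "r * r powr (2 * (x - 1)) = r powr p"
      using \<open>r > 0\<close> by (simp add: x_def powr_mult_base diff_divide_distrib)
    moreover have "s * s powr (x - 1) = s powr x"
      using assms by (simp add: powr_mult_base)
    moreover have "\<bar>2 * s * r\<bar> = 2 * s * r"
      using \<open>r > 0\<close> assms by simp
    ultimately show ?thesis
      by (simp add: exp_minus divide_inverse mult_ac) (simp add: mult_ac flip: mult.assoc)
  qed
  ultimately have 2: "(\<lambda>r. (2 * s powr x) * (r powr p * exp (- s * r\<^sup>2))) absolutely_integrable_on {0<..}"
    "integral {0<..} (\<lambda>r. (2 * s powr x) * (r powr p * exp (- s * r\<^sup>2))) = Gamma x"
    using set_integrable_cong[OF refl refl, of "{0<..}" "\<lambda>r. \<bar>2 * s * r\<bar> * ((s * r\<^sup>2) powr (x - 1) / exp (s * r\<^sup>2))"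
        "\<lambda>r. (2 * s powr x) * (r powr p * exp (- s * r\<^sup>2))" lebesgue]
      Henstock_Kurzweil_Integration.integral_cong[of "{0<..}" "\<lambda>r. \<bar>2 * s * r\<bar> * ((s * r\<^sup>2) powr (x - 1) / exp (s * r\<^sup>2))"
        "\<lambda>r. (2 * s powr x) * (r powr p * exp (- s * r\<^sup>2))"]
    by (metis (no_types, lifting))+
  then have "has_bochner_integral lebesgue (\<lambda>r. indicator {0<..} r *\<^sub>R ((2 * s powr x) * (r powr p * exp (- s * r\<^sup>2)))) (Gamma x)"
    unfolding has_bochner_integral_iff
    using set_lebesgue_integral_eq_integral(2)[OF 2(1)] 2
    unfolding set_integrable_def set_lebesgue_integral_def by metis
  then have "has_bochner_integral lborel (\<lambda>r. indicator {0<..} r *\<^sub>R ((2 * s powr x) * (r powr p * exp (- s * r\<^sup>2)))) (Gamma x)"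
    by (simp add: has_bochner_integral_iff integrable_completion integral_completion)
  from has_bochner_integral_mult_right[OF this, of "1 / (2 * s powr x)"]
  show ?thesis
    using assms by (simp add: x_def mult_ac)
qed

section \<open>Divergence theorem on the sphere from translation invariance\<close>

lemma has_bochner_integral_lborel_translate:
  fixes f :: "'a::euclidean_space \<Rightarrow> 'b::{banach, second_countable_topology}"
  assumes "has_bochner_integral lborel f I"
  shows "has_bochner_integral lborel (\<lambda>y. f (y + v)) I"
proof -
  have f [measurable]: "f \<in> borel_measurable borel"
    using assms by (auto dest: borel_measurable_has_bochner_integral)
  have "has_bochner_integral (distr lborel borel ((+) v)) f I"
    using assms by (simp add: lborel_distr_plus)
  then show ?thesis
    using integrable_distr_eq[of "(+) v" lborel borel f] integral_distr[of "(+) v" lborel borel f]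
    by (simp add: has_bochner_integral_iff add.commute)
qed

text \<open>Translation invariance takes the place of boundary terms: averaging the translates of
  \<open>D\<close> along \<open>v\<close> over t in [0,1] leaves the integral unchanged, and by
  Fubini's theorem the average integrates to that of \<open>\<Phi> (y + v) - \<Phi> y\<close>, which
  is zero.\<close>

lemma integral_directional_derivative_eq_0:
  fixes \<Phi> D :: "'a::euclidean_space \<Rightarrow> real"
  assumes der: "\<And>y t. ((\<lambda>t. \<Phi> (y + t *\<^sub>R v)) has_real_derivative D (y + t *\<^sub>R v)) (at t)"
    and cont: "continuous_on UNIV D"
    and \<Phi>: "integrable lborel \<Phi>" and D: "integrable lborel D"
  shows "(LINT y|lborel. D y) = 0"
proof -
  define F where "F = (\<lambda>t y. D (y + t *\<^sub>R v) * indicator {0..1} t)"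
  have [measurable]: "D \<in> borel_measurable borel"
    by (rule borel_measurable_continuous_onI[OF cont])
  have D': "has_bochner_integral lborel (\<lambda>y. D (y + t *\<^sub>R v)) (LINT y|lborel. D y)" for t
    by (rule has_bochner_integral_lborel_translate[OF has_bochner_integral_integrable[OF D]])
  have nD': "has_bochner_integral lborel (\<lambda>y. norm (D (y + t *\<^sub>R v))) (LINT y|lborel. norm (D y))" for t
    by (rule has_bochner_integral_lborel_translate[OF has_bochner_integral_integrable])
      (use D in auto)
  have inner: "(LINT t|lborel. F t y) = \<Phi> (y + v) - \<Phi> y" for y
  proof -
    have cD: "isCont D x" for x
      using cont continuous_on_eq_continuous_at[OF open_UNIV] by blast
    have "isCont (\<lambda>t. D (y + t *\<^sub>R v)) t" for t
      by (rule isCont_o2[OF _ cD]) (intro continuous_intros)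
    then have "(LINT t|lborel. F t y) = \<Phi> (y + 1 *\<^sub>R v) - \<Phi> (y + 0 *\<^sub>R v)"
      unfolding F_def by (intro integral_FTC_Icc_real der) simp_all
    then show ?thesis by simp
  qed
  have int: "integrable (lborel \<Otimes>\<^sub>M lborel) (case_prod F)"
  proof (rule lborel_pair.Fubini_integrable)
    show "case_prod F \<in> borel_measurable (lborel \<Otimes>\<^sub>M lborel)"
      unfolding F_def by measurable
    have "(LINT y|lborel. norm (F t y)) = (LINT y|lborel. norm (D y)) * indicator {0..1} t" for t
      using nD'[of t] by (cases "t \<in> {0..1}") (simp_all add: F_def has_bochner_integral_iff)
    then show "integrable lborel (\<lambda>t. LINT y|lborel. norm (case (t, y) of (t, y) \<Rightarrow> F t y))"
      by simp
    show "AE t in lborel. integrable lborel (\<lambda>y. case (t, y) of (t, y) \<Rightarrow> F t y)"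
      using D' by (simp add: F_def has_bochner_integral_iff)
  qed
  have "(LINT y|lborel. D y) = (LINT t|lborel. (LINT y|lborel. D y) * indicator {0..1::real} t)"
    by simp
  also have "\<dots> = (LINT t|lborel. LINT y|lborel. F t y)"
    using D' by (simp add: F_def has_bochner_integral_iff)
  also have "\<dots> = (LINT y|lborel. LINT t|lborel. F t y)"
    by (rule lborel_pair.Fubini_integral[OF int, symmetric])
  also have "\<dots> = (LINT y|lborel. \<Phi> (y + v)) - (LINT y|lborel. \<Phi> y)"
    using has_bochner_integral_lborel_translate[OF has_bochner_integral_integrable[OF \<Phi>], of v] \<Phi>
    by (simp add: inner has_bochner_integral_iff)
  also have "\<dots> = 0"
    using has_bochner_integral_lborel_translate[OF has_bochner_integral_integrable[OF \<Phi>], of v]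
    by (simp add: has_bochner_integral_iff)
  finally show ?thesis .
qed

lemma integrable_sphere_continuous:
  fixes f :: "'a::euclidean_space \<Rightarrow> 'b::euclidean_space"
  assumes "continuous_on UNIV f"
  shows "integrable sphere_measure f"
proof -
  interpret finite_measure "sphere_measure :: 'a measure"
    by (rule finite_measure_sphere_measure)
  have [measurable]: "f \<in> borel_measurable borel"
    by (rule borel_measurable_continuous_onI[OF assms])
  have "bounded (f ` sphere 0 1)"
    by (intro compact_imp_bounded compact_continuous_image continuous_on_subset[OF assms]) auto
  then obtain B where "\<And>y. y \<in> sphere 0 1 \<Longrightarrow> norm (f y) \<le> B"
    unfolding bounded_iff by blast
  then show ?thesis
    by (intro integrable_const_bound[of _ B])
      (use AE_sphere_measure in \<open>auto elim: eventually_mono\<close>)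
qed

text \<open>Transfers sphere integrals of homogeneous functions to the whole space, where
  integration by parts is available. The constant is the Gaussian moment of r^(m - 1 + n).\<close>

lemma has_bochner_integral_gauss_homogeneous:
  fixes g :: "'a::euclidean_space \<Rightarrow> real"
  assumes g: "continuous_on UNIV g" and hom: "\<And>y. g y = norm y ^ n * g (sgn y)"
  shows "has_bochner_integral lborel (\<lambda>y. g y * exp (- (norm y)\<^sup>2 / 2))
     (Gamma ((DIM('a) + real n) / 2) / (2 * (1 / 2) powr ((DIM('a) + real n) / 2)) * (LINT \<eta>|sphere_measure. g \<eta>))"
proof -
  define f where "f = (\<lambda>r::real. r ^ n * exp (- r\<^sup>2 / 2))"
  have dim: "DIM('a) > 0" by simp
  define N where "N = DIM('a) - 1 + n"
  have N: "real N + 1 = DIM('a) + real n"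
    using dim unfolding N_def by linarith
  have pN: "r ^ N = r ^ (DIM('a) - 1) * r ^ n" for r :: real
    unfolding N_def power_add ..
  have *: "has_bochner_integral lborel (\<lambda>r. indicator {0<..} r * (r powr N * exp (- (1 / 2) * r\<^sup>2)))
     (Gamma ((DIM('a) + real n) / 2) / (2 * (1 / 2) powr ((DIM('a) + real n) / 2)))"
    using has_bochner_integral_powr_gauss[of "real N" "1 / 2"] unfolding N by simp
  have "has_bochner_integral lborel (\<lambda>r. indicator {0<..} r * (r ^ (DIM('a) - 1) * f r))
     (Gamma ((DIM('a) + real n) / 2) / (2 * (1 / 2) powr ((DIM('a) + real n) / 2)))"
    by (rule has_bochner_integral_cong[THEN iffD1, OF refl _ refl *])
      (simp add: f_def indicator_def powr_realpow pN)
  then have "has_bochner_integral lborel (\<lambda>y. f (norm y) *\<^sub>R g (sgn y))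
     ((Gamma ((DIM('a) + real n) / 2) / (2 * (1 / 2) powr ((DIM('a) + real n) / 2))) *\<^sub>R (LINT \<eta>|sphere_measure. g \<eta>))"
    by (rule has_bochner_integral_polar)
      (auto simp: f_def intro!: has_bochner_integral_integrable integrable_sphere_continuous g)
  moreover have "f (norm y) *\<^sub>R g (sgn y) = g y * exp (- (norm y)\<^sup>2 / 2)" for y
    by (subst (2) hom) (simp add: f_def)
  ultimately show ?thesis by simp
qed

lemma inner_power_sgn: "(y \<bullet> v) ^ k = norm y ^ k * (sgn y \<bullet> v) ^ k" for y v :: "'a::euclidean_space"
proof -
  have "y \<bullet> v = norm y * (sgn y \<bullet> v)"
    by (cases "y = 0") (auto simp: sgn_div_norm)
  then show ?thesis by (simp add: power_mult_distrib)
qed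

text \<open>The derivative along \<open>v\<close> of the monomial times exp(-|y|^2/2) integrates to
  zero. Differentiating the Gaussian produces the term with \<open>y \<bullet> v\<close>, whose
  degree is two higher than that of the other terms, and homogeneity carries all three integrals to
  the sphere.\<close>

lemma sphere_divergence_monomial:
  fixes \<xi> \<zeta> v :: "'a::euclidean_space"
  shows "(real DIM('a) - 1 + i + j) * (LINT \<eta>|sphere_measure. (\<eta> \<bullet> v) * (\<eta> \<bullet> \<xi>) ^ i * (\<eta> \<bullet> \<zeta>) ^ j)
    = real i * (\<xi> \<bullet> v) * (LINT \<eta>|sphere_measure. (\<eta> \<bullet> \<xi>) ^ (i - 1) * (\<eta> \<bullet> \<zeta>) ^ j)
    + real j * (\<zeta> \<bullet> v) * (LINT \<eta>|sphere_measure. (\<eta> \<bullet> \<xi>) ^ i * (\<eta> \<bullet> \<zeta>) ^ (j - 1))"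
    (is "_ * ?V = _ * _ * ?S1 + _ * _ * ?S2")
proof -
  define G where "G n = Gamma ((DIM('a) + real n) / 2) / (2 * (1 / 2) powr ((DIM('a) + real n) / 2))" for n
  define D where "D y = (real i * (\<xi> \<bullet> v)) * ((y \<bullet> \<xi>) ^ (i - 1) * (y \<bullet> \<zeta>) ^ j * exp (- (norm y)\<^sup>2 / 2))
     + (real j * (\<zeta> \<bullet> v)) * ((y \<bullet> \<xi>) ^ i * (y \<bullet> \<zeta>) ^ (j - 1) * exp (- (norm y)\<^sup>2 / 2))
     - (y \<bullet> v) * (y \<bullet> \<xi>) ^ i * (y \<bullet> \<zeta>) ^ j * exp (- (norm y)\<^sup>2 / 2)" for y
  note pos = DIM_positive[where 'a='a]
  have dim: "real DIM('a) \<ge> 1" using pos by linarith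
  have i0: "has_bochner_integral lborel (\<lambda>y. (y \<bullet> \<xi>) ^ i * (y \<bullet> \<zeta>) ^ j * exp (- (norm y)\<^sup>2 / 2))
      (G (i + j) * (LINT \<eta>|sphere_measure. (\<eta> \<bullet> \<xi>) ^ i * (\<eta> \<bullet> \<zeta>) ^ j))" for i j
  proof -
    have "(y \<bullet> \<xi>) ^ i * (y \<bullet> \<zeta>) ^ j = norm y ^ (i + j) * ((sgn y \<bullet> \<xi>) ^ i * (sgn y \<bullet> \<zeta>) ^ j)" for y
      by (simp add: inner_power_sgn[of y \<xi>] inner_power_sgn[of y \<zeta>] power_add)
    then show ?thesis
      unfolding G_def by (intro has_bochner_integral_gauss_homogeneous[of "\<lambda>y. (y \<bullet> \<xi>) ^ i * (y \<bullet> \<zeta>) ^ j" "i + j"]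
        continuous_intros)
  qed
  have i1: "has_bochner_integral lborel (\<lambda>y. (y \<bullet> v) * (y \<bullet> \<xi>) ^ i * (y \<bullet> \<zeta>) ^ j * exp (- (norm y)\<^sup>2 / 2))
      (G (i + j + 1) * ?V)"
  proof -
    have "(y \<bullet> v) * (y \<bullet> \<xi>) ^ i * (y \<bullet> \<zeta>) ^ j
        = norm y ^ (i + j + 1) * ((sgn y \<bullet> v) * (sgn y \<bullet> \<xi>) ^ i * (sgn y \<bullet> \<zeta>) ^ j)" for y
      using inner_power_sgn[of y v 1]
      by (simp add: inner_power_sgn[of y \<xi>] inner_power_sgn[of y \<zeta>] power_add)
    then show ?thesis
      unfolding G_def
      by (intro has_bochner_integral_gauss_homogeneous[of "\<lambda>y. (y \<bullet> v) * (y \<bullet> \<xi>) ^ i * (y \<bullet> \<zeta>) ^ j" "i + j + 1"]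
        continuous_intros)
  qed
  have hD: "has_bochner_integral lborel D ((real i * (\<xi> \<bullet> v)) * (G (i - 1 + j) * ?S1)
      + (real j * (\<zeta> \<bullet> v)) * (G (i + (j - 1)) * ?S2) - G (i + j + 1) * ?V)"
    unfolding D_def
    by (intro has_bochner_integral_diff has_bochner_integral_add has_bochner_integral_mult_right i0 i1)
  have "(LINT y|lborel. D y) = 0"
  proof (rule integral_directional_derivative_eq_0)
    show "((\<lambda>t. ((y + t *\<^sub>R v) \<bullet> \<xi>) ^ i * ((y + t *\<^sub>R v) \<bullet> \<zeta>) ^ j * exp (- (norm (y + t *\<^sub>R v))\<^sup>2 / 2))
      has_real_derivative D (y + t *\<^sub>R v)) (at t)" for y t
    proof -
      have lin: "((\<lambda>t. (y + t *\<^sub>R v) \<bullet> u) has_real_derivative (u \<bullet> v)) (at t)" for u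
        unfolding inner_add_left inner_scaleR_left
        by (auto intro!: derivative_eq_intros simp: inner_commute)
      have "((\<lambda>t. y \<bullet> y + 2 * t * (y \<bullet> v) + t\<^sup>2 * (v \<bullet> v)) has_real_derivative
         2 * (y \<bullet> v) + 2 * t * (v \<bullet> v)) (at t)"
        by (auto intro!: derivative_eq_intros)
      also have "(\<lambda>t. y \<bullet> y + 2 * t * (y \<bullet> v) + t\<^sup>2 * (v \<bullet> v)) = (\<lambda>t. (norm (y + t *\<^sub>R v))\<^sup>2)"
        unfolding power2_norm_eq_inner
        by (simp add: fun_eq_iff inner_add_left inner_add_right inner_commute power2_eq_square algebra_simps)
      also have "2 * (y \<bullet> v) + 2 * t * (v \<bullet> v) = 2 * ((y + t *\<^sub>R v) \<bullet> v)"
        by (simp add: inner_add_left)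
      finally have "((\<lambda>t. (norm (y + t *\<^sub>R v))\<^sup>2) has_real_derivative 2 * ((y + t *\<^sub>R v) \<bullet> v)) (at t)" .
      from DERIV_cdivide[OF DERIV_minus[OF this], of 2]
      have sq: "((\<lambda>t. - (norm (y + t *\<^sub>R v))\<^sup>2 / 2) has_real_derivative
          - ((y + t *\<^sub>R v) \<bullet> v)) (at t)"
        by simp
      show ?thesis
        unfolding D_def
        by (rule DERIV_cong[OF DERIV_mult[OF DERIV_mult[OF DERIV_power[OF lin] DERIV_power[OF lin]]
              DERIV_fun_exp[OF sq]]])
          (simp add: ring_distribs mult_ac)
    qed
    show "continuous_on UNIV D"
      unfolding D_def by (intro continuous_intros) auto
  qed (use hD i0[of i j] in \<open>auto simp: has_bochner_integral_iff\<close>)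
  then have eq: "(real i * (\<xi> \<bullet> v)) * (G (i - 1 + j) * ?S1)
      + (real j * (\<zeta> \<bullet> v)) * (G (i + (j - 1)) * ?S2) = G (i + j + 1) * ?V"
    using hD by (simp add: has_bochner_integral_iff)
  have Gpos: "G n > 0" for n
  proof -
    have "real DIM('a) + real n > 0" using dim by linarith
    then show ?thesis by (auto simp: G_def intro!: Gamma_real_pos divide_pos_pos)
  qed
  \<comment> \<open>Raising the degree by two multiplies the radial moment by m + n; with n = i + j
    - 1 this is the factor on the left of the claim.\<close>
  have Grec: "G (n + 2) = (real DIM('a) + n) * G n" for n
  proof -
    have "Gamma ((DIM('a) + real n) / 2 + 1) = (DIM('a) + real n) / 2 * Gamma ((DIM('a) + real n) / 2)"
    proof (rule Gamma_plus1)
      have "DIM('a) + real n > 0" using dim by linarith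
      then have "(DIM('a) + real n) / 2 > 0" by (rule half_gt_zero)
      then show "(DIM('a) + real n) / 2 \<notin> \<int>\<^sub>\<le>\<^sub>0"
        by (auto elim!: nonpos_Ints_cases simp del: zero_less_divide_iff)
    qed
    note G1 = this
    have G2: "(DIM('a) + real (n + 2)) / 2 = (DIM('a) + real n) / 2 + 1"
      by (simp add: field_simps)
    have G3: "(1/2) powr ((DIM('a) + real n) / 2 + 1) = (1/2) powr ((DIM('a) + real n) / 2) * (1 / 2)"
      by (simp only: powr_add) simp
    show ?thesis
      unfolding G_def G2 G1 G3 by simp
  qed
  show ?thesis
  \<comment> \<open>Natural subtraction truncates. For i + j = 0 both derivative terms carry a zero
    factor, so the vector integral vanishes; otherwise the factors \<open>real i\<close> and
    \<open>real j\<close> kill the terms whose exponent was truncated.\<close>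
  proof (cases "i + j = 0")
    case True
    then show ?thesis using eq Gpos[of "i + j + 1"] by simp
  next
    case False
    define n where "n = i + j - 1"
    have n: "i + j + 1 = n + 2" using False by (simp add: n_def)
    have 1: "real i * G (i - 1 + j) = real i * G n" and 2: "real j * G (i + (j - 1)) = real j * G n"
      by (cases i; cases j; simp add: n_def)+
    have 3: "real DIM('a) - 1 + i + j = real DIM('a) + n"
      using n by linarith
    have "G n * (real i * (\<xi> \<bullet> v) * ?S1 + real j * (\<zeta> \<bullet> v) * ?S2)
       = (\<xi> \<bullet> v) * ?S1 * (real i * G n) + (\<zeta> \<bullet> v) * ?S2 * (real j * G n)"
      by (simp add: algebra_simps)
    also have "\<dots> = G (n + 2) * ?V"
      unfolding 1[symmetric] 2[symmetric] n[symmetric] eq[symmetric] by (simp only: mult_ac)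
    also have "\<dots> = G n * ((real DIM('a) + n) * ?V)"
      unfolding Grec by (simp only: mult_ac)
    finally have "G n * (real i * (\<xi> \<bullet> v) * ?S1 + real j * (\<zeta> \<bullet> v) * ?S2) = G n * ((real DIM('a) + n) * ?V)" .
    then show ?thesis
      using Gpos[of n] unfolding 3 by simp
  qed
qed

section \<open>Gegenbauer polynomials\<close>

text \<open>Formal polynomials give access to \<open>pderiv\<close> and to linearity arguments;
  \<open>pCons 0\<close> is multiplication by the variable.\<close>

fun geg_poly :: "nat \<Rightarrow> real \<Rightarrow> real poly" where
  "geg_poly 0 \<mu> = 1"
| "geg_poly (Suc 0) \<mu> = [:0, 2 * \<mu>:]"
| "geg_poly (Suc (Suc n)) \<mu> =
     smult (1 / (real n + 2)) (smult (2 * (real n + 1 + \<mu>)) (pCons 0 (geg_poly (Suc n) \<mu>))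
       - smult (real n + 2 * \<mu>) (geg_poly n \<mu>))"

lemma poly_geg_poly: "poly (geg_poly n \<mu>) w = gegenbauer n \<mu> w"
proof (induction n \<mu> rule: geg_poly.induct)
  case (3 n \<mu>)
  show ?case
    unfolding geg_poly.simps gegenbauer.simps poly_smult poly_diff poly_pCons 3 by simp
qed simp_all

text \<open>Extension by zero keeps the recurrence and the derivative identities valid at every
  integer, so that shifts such as i - 2 do not create boundary cases.\<close>

definition gegz :: "real \<Rightarrow> int \<Rightarrow> real poly" where
  "gegz \<mu> i = (if i < 0 then 0 else geg_poly (nat i) \<mu>)"

lemma gegz_neg: "i < 0 \<Longrightarrow> gegz \<mu> i = 0"
  by (simp add: gegz_def)

lemma gegz_of_nat: "gegz \<mu> (int n) = geg_poly n \<mu>"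
  by (simp add: gegz_def)

lemma gegz_rec:
  "smult (of_int (i + 2)) (gegz \<mu> (i + 2))
     = smult (2 * (of_int i + 1 + \<mu>)) (pCons 0 (gegz \<mu> (i + 1))) - smult (of_int i + 2 * \<mu>) (gegz \<mu> i)"
proof -
  consider "i < -2" | "i = -2" | "i = -1" | "0 \<le> i" by linarith
  then show ?thesis
  proof cases
    case 4
    define n where "n = nat i"
    have i: "i = int n" using 4 by (simp add: n_def)
    have e: "int n + 2 = int (Suc (Suc n))" "int n + 1 = int (Suc n)" by simp_all
    show ?thesis
      unfolding i e gegz_of_nat geg_poly.simps by (simp add: smult_diff_right add_ac)
  qed (simp_all add: gegz_def)
qed

lemma smult_left_cancel: "c \<noteq> 0 \<Longrightarrow> smult c p = smult c q \<Longrightarrow> p = q" for c :: real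
  by (metis smult_1_left smult_smult left_inverse)

text \<open>The three identities feed one another. Differentiating the recurrence and inserting the
  third gives the second at the next degree; this one, the recurrence and the first two give the
  third, and the third is the first shifted by one.\<close>

lemma geg_poly_deriv:
  "pCons 0 (pderiv (geg_poly n \<mu>)) = smult (real n) (geg_poly n \<mu>) + pderiv (gegz \<mu> (int n - 1)) \<and>
   pderiv (geg_poly (Suc n) \<mu>) = smult (2 * (real n + \<mu>)) (geg_poly n \<mu>) + pderiv (gegz \<mu> (int n - 1)) \<and>
   pCons 0 (pderiv (geg_poly (Suc n) \<mu>)) = smult (real (Suc n)) (geg_poly (Suc n) \<mu>) + pderiv (geg_poly n \<mu>)"
proof (induction n)
  case 0
  then show ?case by (simp add: gegz_def pderiv_pCons)
next
  case (Suc n)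
  define U where "U k = geg_poly k \<mu>" for k
  define W where "W = gegz \<mu> (int n - 1)"
  have g1: "pCons 0 (pderiv (U n)) = smult (real n) (U n) + pderiv W"
    and g2: "pderiv (U (Suc n)) = smult (2 * (real n + \<mu>)) (U n) + pderiv W"
    and g3: "pCons 0 (pderiv (U (Suc n))) = smult (real (Suc n)) (U (Suc n)) + pderiv (U n)"
    unfolding U_def W_def
    by (rule Suc.IH[THEN conjunct1], rule Suc.IH[THEN conjunct2, THEN conjunct1],
        rule Suc.IH[THEN conjunct2, THEN conjunct2])
  have r: "smult (real n + 2) (U (Suc (Suc n)))
      = smult (2 * (real n + 1 + \<mu>)) (pCons 0 (U (Suc n))) - smult (real n + 2 * \<mu>) (U n)"
    using gegz_rec[of "int n" \<mu>] unfolding U_def gegz_of_nat[symmetric] by (simp add: add_ac)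
  have "smult (real n + 2) (pderiv (U (Suc (Suc n)))) = smult (2 * (real n + 1 + \<mu>)) (U (Suc n) + pCons 0 (pderiv (U (Suc n))))
      - smult (real n + 2 * \<mu>) (pderiv (U n))"
    by (simp add: pderiv_smult[symmetric] r del: pderiv_smult) (rule poly_eqI, simp add: pderiv_diff pderiv_smult pderiv_pCons algebra_simps coeff_pCons split: nat.split)
  also have "\<dots> = smult (real n + 2) (smult (2 * (real n + 1 + \<mu>)) (U (Suc n)) + pderiv (U n))"
    unfolding g3 by (rule poly_eqI) (simp add: algebra_simps)
  finally have G2: "pderiv (U (Suc (Suc n))) = smult (2 * (real n + 1 + \<mu>)) (U (Suc n)) + pderiv (U n)"
    by (rule smult_left_cancel[rotated]) simp
  have "pCons 0 (pderiv (U (Suc (Suc n)))) = smult (2 * (real n + 1 + \<mu>)) (pCons 0 (U (Suc n))) + pCons 0 (pderiv (U n))"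
    unfolding G2 by simp
  also have "\<dots> = smult (real n + 2) (U (Suc (Suc n))) + smult (real n + 2 * \<mu>) (U n) + (smult (real n) (U n) + pderiv W)"
    unfolding g1 r by simp
  also have "\<dots> = smult (real n + 2) (U (Suc (Suc n))) + pderiv (U (Suc n))"
    unfolding g2 by (rule poly_eqI) (simp add: algebra_simps)
  finally have G3: "pCons 0 (pderiv (U (Suc (Suc n)))) = smult (real n + 2) (U (Suc (Suc n))) + pderiv (U (Suc n))" .
  have e: "int (Suc n) - 1 = int n" "real (Suc n) = real n + 1" "real (Suc (Suc n)) = real n + 2" by simp_all
  show ?case
    unfolding e gegz_of_nat
    by (rule conjI[OF g3[unfolded e U_def] conjI[OF G2[unfolded e U_def] G3[unfolded e U_def]]])
qed

lemma gegz_deriv_mult: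
  "pCons 0 (pderiv (gegz \<mu> i)) = smult (of_int i) (gegz \<mu> i) + pderiv (gegz \<mu> (i - 1))"
proof (cases "i < 0")
  case False
  define n where "n = nat i"
  have i: "i = int n" using False by (simp add: n_def)
  show ?thesis
    unfolding i gegz_of_nat of_int_of_nat_eq using geg_poly_deriv[of n \<mu>] by (elim conjE)
qed (simp add: gegz_neg)

lemma gegz_deriv_rec:
  "pderiv (gegz \<mu> i) = smult (2 * (of_int i - 1 + \<mu>)) (gegz \<mu> (i - 1)) + pderiv (gegz \<mu> (i - 2))"
proof -
  consider "i < 0" | "i = 0" | "0 < i" by linarith
  then show ?thesis
  proof cases
    case 1
    then show ?thesis by (simp add: gegz_neg)
  next
    case 2
    then show ?thesis by (simp only: gegz_neg) (simp add: gegz_def)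
  next
    case 3
    define n where "n = nat (i - 1)"
    have i: "i = int (Suc n)"
      using 3 by (simp add: n_def)
    have e: "int (Suc n) - 1 = int n" "int (Suc n) - 2 = int n - 1"
      "real_of_int (int (Suc n)) - 1 = real n"
      by simp_all
    show ?thesis
      unfolding i e gegz_of_nat using geg_poly_deriv[of n \<mu>] by (elim conjE)
  qed
qed

section \<open>Averages of Gegenbauer polynomials over the sphere\<close>

definition sph_dot :: "'a::euclidean_space \<Rightarrow> 'a \<Rightarrow> real poly \<Rightarrow> real poly \<Rightarrow> real" where
  "sph_dot \<xi> \<zeta> p q = (LINT \<eta>|sphere_measure. poly p (\<eta> \<bullet> \<xi>) * poly q (\<eta> \<bullet> \<zeta>))"

text \<open>The component along \<open>v\<close> of the vector-valued integral of \<eta> p q; real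
  components suffice to recover the Clifford-valued integrals.\<close>

definition sph_mom :: "'a::euclidean_space \<Rightarrow> 'a \<Rightarrow> 'a \<Rightarrow> real poly \<Rightarrow> real poly \<Rightarrow> real" where
  "sph_mom v \<xi> \<zeta> p q = (LINT \<eta>|sphere_measure. (\<eta> \<bullet> v) * poly p (\<eta> \<bullet> \<xi>) * poly q (\<eta> \<bullet> \<zeta>))"

lemma integrable_sph_dot [simp]:
  "integrable sphere_measure (\<lambda>\<eta>::'a::euclidean_space. poly p (\<eta> \<bullet> \<xi>) * poly q (\<eta> \<bullet> \<zeta>))"
  by (intro integrable_sphere_continuous continuous_intros)

lemma integrable_sph_mom [simp]:
  "integrable sphere_measure (\<lambda>\<eta>::'a::euclidean_space. (\<eta> \<bullet> v) * poly p (\<eta> \<bullet> \<xi>) * poly q (\<eta> \<bullet> \<zeta>))"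
  by (intro integrable_sphere_continuous continuous_intros)

lemma sph_dot_commute: "sph_dot \<xi> \<zeta> p q = sph_dot \<zeta> \<xi> q p"
  by (simp add: sph_dot_def mult.commute)

lemma sph_mom_commute: "sph_mom v \<xi> \<zeta> p q = sph_mom v \<zeta> \<xi> q p"
  by (simp add: sph_mom_def mult_ac)

lemma sph_dot_linear:
  "sph_dot \<xi> \<zeta> (p + p') q = sph_dot \<xi> \<zeta> p q + sph_dot \<xi> \<zeta> p' q"
  "sph_dot \<xi> \<zeta> p (q + q') = sph_dot \<xi> \<zeta> p q + sph_dot \<xi> \<zeta> p q'"
  "sph_dot \<xi> \<zeta> p (q - q') = sph_dot \<xi> \<zeta> p q - sph_dot \<xi> \<zeta> p q'"
  "sph_dot \<xi> \<zeta> (smult c p) q = c * sph_dot \<xi> \<zeta> p q"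
  "sph_dot \<xi> \<zeta> p (smult c q) = c * sph_dot \<xi> \<zeta> p q"
  "sph_dot \<xi> \<zeta> 0 q = 0" "sph_dot \<xi> \<zeta> p 0 = 0"
  by (simp_all add: sph_dot_def ring_distribs mult.assoc mult.left_commute[of _ c])

lemma sph_mom_linear:
  "sph_mom v \<xi> \<zeta> (p + p') q = sph_mom v \<xi> \<zeta> p q + sph_mom v \<xi> \<zeta> p' q"
  "sph_mom v \<xi> \<zeta> p (q + q') = sph_mom v \<xi> \<zeta> p q + sph_mom v \<xi> \<zeta> p q'"
  "sph_mom v \<xi> \<zeta> (smult c p) q = c * sph_mom v \<xi> \<zeta> p q"
  "sph_mom v \<xi> \<zeta> p (smult c q) = c * sph_mom v \<xi> \<zeta> p q"
  "sph_mom v \<xi> \<zeta> 0 q = 0" "sph_mom v \<xi> \<zeta> p 0 = 0"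
proof -
  show "sph_mom v \<xi> \<zeta> (p + p') q = sph_mom v \<xi> \<zeta> p q + sph_mom v \<xi> \<zeta> p' q"
    "sph_mom v \<xi> \<zeta> p (q + q') = sph_mom v \<xi> \<zeta> p q + sph_mom v \<xi> \<zeta> p q'"
    "sph_mom v \<xi> \<zeta> 0 q = 0" "sph_mom v \<xi> \<zeta> p 0 = 0"
    by (simp_all add: sph_mom_def ring_distribs)
  have "(\<eta> \<bullet> v) * (c * poly p (\<eta> \<bullet> \<xi>)) * poly q (\<eta> \<bullet> \<zeta>) = c * ((\<eta> \<bullet> v) * poly p (\<eta> \<bullet> \<xi>) * poly q (\<eta> \<bullet> \<zeta>))"
    "(\<eta> \<bullet> v) * poly p (\<eta> \<bullet> \<xi>) * (c * poly q (\<eta> \<bullet> \<zeta>)) = c * ((\<eta> \<bullet> v) * poly p (\<eta> \<bullet> \<xi>) * poly q (\<eta> \<bullet> \<zeta>))" for \<eta>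
    by simp_all
  then show "sph_mom v \<xi> \<zeta> (smult c p) q = c * sph_mom v \<xi> \<zeta> p q"
    "sph_mom v \<xi> \<zeta> p (smult c q) = c * sph_mom v \<xi> \<zeta> p q"
    unfolding sph_mom_def poly_smult by (simp_all only: integral_mult_right_zero)
qed

lemma sph_dot_pCons_right: "sph_dot \<xi> \<zeta> p (pCons 0 q) = sph_mom \<zeta> \<xi> \<zeta> p q"
  by (simp add: sph_dot_def sph_mom_def mult_ac)

lemma poly_bilinear_induct:
  fixes P :: "real poly \<Rightarrow> real poly \<Rightarrow> bool"
  assumes add1: "\<And>p p' q. P p q \<Longrightarrow> P p' q \<Longrightarrow> P (p + p') q"
    and add2: "\<And>p q q'. P p q \<Longrightarrow> P p q' \<Longrightarrow> P p (q + q')"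
    and smult1: "\<And>c p q. P p q \<Longrightarrow> P (smult c p) q"
    and smult2: "\<And>c p q. P p q \<Longrightarrow> P p (smult c q)"
    and monom: "\<And>i j. P (monom 1 i) (monom 1 j)"
  shows "P p q"
proof -
  have sum1: "P (sum f {..n}) q" if "\<And>i. P (f i) q" for f :: "nat \<Rightarrow> real poly" and n q
    by (induction n) (auto intro!: that add1)
  have sum2: "P p (sum f {..n})" if "\<And>i. P p (f i)" for f :: "nat \<Rightarrow> real poly" and n p
    by (induction n) (auto intro!: that add2)
  have m: "monom c i = smult c (monom 1 i)" for c :: real and i
    by (simp add: smult_monom)
  have "P (\<Sum>i\<le>degree p. monom (coeff p i) i) (\<Sum>i\<le>degree q. monom (coeff q i) i)"
    by (intro sum1 sum2) (subst (1 2) m, intro smult1 smult2 monom)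
  then show ?thesis by (simp add: poly_as_sum_of_monoms)
qed

text \<open>Both sides are bilinear, so monomials suffice. The degree of a monomial is expressed by
  the Euler operator \<open>pCons 0 (pderiv p)\<close>, which makes sense for all
  polynomials.\<close>

theorem sphere_divergence:
  fixes v \<xi> \<zeta> :: "'a::euclidean_space"
  shows "(real DIM('a) - 1) * sph_mom v \<xi> \<zeta> p q + sph_mom v \<xi> \<zeta> (pCons 0 (pderiv p)) q
      + sph_mom v \<xi> \<zeta> p (pCons 0 (pderiv q))
    = (\<xi> \<bullet> v) * sph_dot \<xi> \<zeta> (pderiv p) q + (\<zeta> \<bullet> v) * sph_dot \<xi> \<zeta> p (pderiv q)" (is "?P p q")
proof (rule poly_bilinear_induct[of ?P])
  have smult: "pCons 0 (smult c p) = smult c (pCons 0 p)" for c :: real and p by simp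
  have add: "pCons 0 (p + q) = pCons 0 p + pCons 0 q" for p q :: "real poly" by simp
  show "?P (smult c p) q" "?P p (smult c q)" if "?P p q" for c p q
    using arg_cong[OF that, of "(*) c"] unfolding pderiv_smult smult sph_mom_linear sph_dot_linear
    by (simp_all add: algebra_simps)
  show "?P (p + p') q" if "?P p q" "?P p' q" for p p' q
    using that unfolding pderiv_add add sph_mom_linear sph_dot_linear distrib_left by linarith
  show "?P p (q + q')" if "?P p q" "?P p q'" for p q q'
    using that unfolding pderiv_add add sph_mom_linear sph_dot_linear distrib_left by linarith
  have x: "pCons 0 (pderiv (monom 1 i)) = smult (real i) (monom 1 i)" for i
    by (rule poly_eqI) (auto simp: coeff_pCons coeff_pderiv split: nat.splits)
  have d: "pderiv (monom 1 i) = smult (real i) (monom 1 (i - 1))" for i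
    by (simp add: pderiv_monom smult_monom)
  show "?P (monom 1 i) (monom 1 j)" for i j
    unfolding x unfolding d sph_mom_linear sph_dot_linear
    using sphere_divergence_monomial[of i j v \<xi> \<zeta>]
    by (simp add: sph_mom_def sph_dot_def poly_monom algebra_simps)
qed

text \<open>The derivative of degree j unfolds in steps of two into terms 2(r + \<mu>) times the
  polynomial of degree r, for r = j - 1, j - 3, and so on. Terms with r >= i all contribute the
  polynomial of degree i at \<open>w\<close>, and their coefficients form an arithmetic progression
  with the stated sum; the terms below i reassemble a derivative at \<open>w\<close>. The hypothesis
  covers only r < j, which is what an induction on i + j can supply.\<close>

lemma sph_dot_gegz_deriv:
  fixes \<xi> \<zeta> :: "'a::euclidean_space" and i j :: int and T w \<mu> :: real
  assumes S: "\<And>r. r < j \<Longrightarrow> sph_dot \<xi> \<zeta> (gegz \<mu> i) (gegz \<mu> r) = (if even (i + r) then T * poly (gegz \<mu> (min i r)) w else 0)"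
  shows "sph_dot \<xi> \<zeta> (gegz \<mu> i) (pderiv (gegz \<mu> j)) =
    (if even (i + j) then 0 else T * (if j < i then poly (pderiv (gegz \<mu> j)) w
       else poly (pderiv (gegz \<mu> (i - 1))) w + (j - i + 1) / 2 * (i + j - 1 + 2 * \<mu>) * poly (gegz \<mu> i) w))"
  using S
proof (induction "nat j" arbitrary: j rule: less_induct)
  case less
  show ?case
  proof (cases "j \<le> 0")
    case True
    then have 0: "pderiv (gegz \<mu> j) = 0" "i < j \<longrightarrow> gegz \<mu> i = 0" "i \<le> j \<longrightarrow> pderiv (gegz \<mu> (i - 1)) = 0"
      by (auto simp: gegz_def)
    consider "j < i" | "i = j" | "i < j" by linarith
    then show ?thesis
      by cases (use 0 in \<open>auto simp: sph_dot_linear\<close>)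
  next
    case False
    have IH: "sph_dot \<xi> \<zeta> (gegz \<mu> i) (pderiv (gegz \<mu> (j - 2))) =
      (if even (i + (j - 2)) then 0 else T * (if j - 2 < i then poly (pderiv (gegz \<mu> (j - 2))) w
       else poly (pderiv (gegz \<mu> (i - 1))) w
         + real_of_int (j - 2 - i + 1) / 2 * (real_of_int (i + (j - 2) - 1) + 2 * \<mu>) * poly (gegz \<mu> i) w))"
      using less.hyps[of "j - 2"] less.prems False by simp
    have rec: "sph_dot \<xi> \<zeta> (gegz \<mu> i) (pderiv (gegz \<mu> j)) =
        2 * (of_int j - 1 + \<mu>) * (if even (i + (j - 1)) then T * poly (gegz \<mu> (min i (j - 1))) w else 0)
        + sph_dot \<xi> \<zeta> (gegz \<mu> i) (pderiv (gegz \<mu> (j - 2)))"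
      using less.prems[of "j - 1"] by (subst gegz_deriv_rec) (simp add: sph_dot_linear)
    consider "even (i + j)" | "odd (i + j)" "j < i" | "odd (i + j)" "j = i + 1" | "odd (i + j)" "i + 1 < j"
      by (metis add.commute even_add linorder_neqE not_less zless_add1_eq)
    then show ?thesis
    proof cases
      case 1
      then show ?thesis unfolding rec IH by simp
    next
      case 2
      then show ?thesis
        unfolding rec IH by (subst gegz_deriv_rec[of \<mu> j]) (simp add: algebra_simps)
    next
      case 3
      then show ?thesis
        unfolding rec IH by (simp add: algebra_simps)
    next
      case 4
      then have "min i (j - 1) = i" "\<not> j - 2 < i" "\<not> j < i" using 4 by presburger+
      with 4 show ?thesis
        unfolding rec IH by (simp add: field_simps)
    qed
  qed
qed

text \<open>The same unfolding with the opposite parity: the progression now starts at r = i + 1,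
  and the part below i reassembles the derivative of degree i along \<open>\<xi>\<close>.\<close>

lemma sph_mom_gegz_deriv:
  fixes \<xi> \<zeta> :: "'a::euclidean_space" and i j :: int and T w \<mu> :: real
  assumes V: "\<And>r. r < j \<Longrightarrow> sph_mom v \<xi> \<zeta> (gegz \<mu> i) (gegz \<mu> r) = (if odd (i + r) then
     T * (if r < i then (\<xi> \<bullet> v) * poly (gegz \<mu> r) w else (\<zeta> \<bullet> v) * poly (gegz \<mu> i) w) else 0)"
  shows "sph_mom v \<xi> \<zeta> (gegz \<mu> i) (pderiv (gegz \<mu> j)) =
    (if odd (i + j) then 0 else T * (if j \<le> i then (\<xi> \<bullet> v) * poly (pderiv (gegz \<mu> j)) w
       else (\<xi> \<bullet> v) * poly (pderiv (gegz \<mu> i)) w + (\<zeta> \<bullet> v) * ((j - i) / 2 * (i + j + 2 * \<mu>)) * poly (gegz \<mu> i) w))"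
  using V
proof (induction "nat j" arbitrary: j rule: less_induct)
  case less
  show ?case
  proof (cases "j \<le> 0")
    case True
    then have 0: "pderiv (gegz \<mu> j) = 0" "i < j \<longrightarrow> gegz \<mu> i = 0" "i \<le> j \<longrightarrow> pderiv (gegz \<mu> i) = 0"
      by (auto simp: gegz_def)
    consider "j < i" | "i = j" | "i < j" by linarith
    then show ?thesis
      by cases (use 0 in \<open>auto simp: sph_mom_linear\<close>)
  next
    case False
    have IH: "sph_mom v \<xi> \<zeta> (gegz \<mu> i) (pderiv (gegz \<mu> (j - 2))) =
      (if odd (i + (j - 2)) then 0 else T * (if j - 2 \<le> i then (\<xi> \<bullet> v) * poly (pderiv (gegz \<mu> (j - 2))) w
       else (\<xi> \<bullet> v) * poly (pderiv (gegz \<mu> i)) w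
         + (\<zeta> \<bullet> v) * (real_of_int (j - 2 - i) / 2 * (real_of_int (i + (j - 2)) + 2 * \<mu>)) * poly (gegz \<mu> i) w))"
      using less.hyps[of "j - 2"] less.prems False by simp
    have rec: "sph_mom v \<xi> \<zeta> (gegz \<mu> i) (pderiv (gegz \<mu> j)) =
        2 * (of_int j - 1 + \<mu>) * (if odd (i + (j - 1)) then
     T * (if j - 1 < i then (\<xi> \<bullet> v) * poly (gegz \<mu> (j - 1)) w else (\<zeta> \<bullet> v) * poly (gegz \<mu> i) w) else 0)
        + sph_mom v \<xi> \<zeta> (gegz \<mu> i) (pderiv (gegz \<mu> (j - 2)))"
      using less.prems[of "j - 1"] by (subst gegz_deriv_rec) (simp add: sph_mom_linear)
    consider "odd (i + j)" | "even (i + j)" "j \<le> i" | "even (i + j)" "j = i + 2" | "even (i + j)" "i + 2 < j"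
      by (smt (verit) dvd_diff even_add odd_one)
    then show ?thesis
    proof cases
      case 1
      then show ?thesis unfolding rec IH by simp
    next
      case 2
      then show ?thesis
        unfolding rec IH by (subst gegz_deriv_rec[of \<mu> j]) (simp add: algebra_simps)
    next
      case 3
      then show ?thesis
        unfolding rec IH by (simp add: algebra_simps)
    next
      case 4
      then have "\<not> j - 1 < i" "\<not> j - 2 \<le> i" "\<not> j \<le> i" using 4 by presburger+
      with 4 show ?thesis
        unfolding rec IH by (simp add: field_simps)
    qed
  qed
qed

text \<open>The index m/2 is one above the index \<lambda> of orthogonality, so distinct degrees of
  equal parity still interact, through the smaller degree. Scalar and vector integrals are proved
  together: the divergence theorem yields the vector integral from data of smaller total degree, and
  the three-term recurrence yields the scalar one by contracting a vector integral with
  \<open>\<zeta>\<close>.\<close>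

theorem sphere_gegz:
  fixes \<xi> \<zeta> :: "'a::euclidean_space"
  assumes dim: "2 \<le> DIM('a)" and \<xi>: "norm \<xi> = 1" and \<zeta>: "norm \<zeta> = 1"
  defines "\<mu> \<equiv> real DIM('a) / 2" and "T \<equiv> measure (sphere_measure :: 'a measure) UNIV" and "w \<equiv> \<xi> \<bullet> \<zeta>"
  shows "sph_dot \<xi> \<zeta> (gegz \<mu> i) (gegz \<mu> j) = (if even (i + j) then T * poly (gegz \<mu> (min i j)) w else 0)
     \<and> (\<forall>v. sph_mom v \<xi> \<zeta> (gegz \<mu> i) (gegz \<mu> j) = (if odd (i + j) then
       T * (if j < i then (\<xi> \<bullet> v) * poly (gegz \<mu> j) w else (\<zeta> \<bullet> v) * poly (gegz \<mu> i) w) else 0))"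
proof -
  define S where "S \<xi> \<zeta> i j \<longleftrightarrow> sph_dot \<xi> \<zeta> (gegz \<mu> i) (gegz \<mu> j) =
     (if even (i + j) then T * poly (gegz \<mu> (min i j)) w else 0)" for \<xi> \<zeta> :: 'a and i j :: int
  define V where "V v \<xi> \<zeta> i j \<longleftrightarrow> sph_mom v \<xi> \<zeta> (gegz \<mu> i) (gegz \<mu> j) = (if odd (i + j) then
       T * (if j < i then (\<xi> \<bullet> v) * poly (gegz \<mu> j) w else (\<zeta> \<bullet> v) * poly (gegz \<mu> i) w) else 0)"
    for v \<xi> \<zeta> :: 'a and i j :: int
  have Sc: "S \<xi> \<zeta> i j \<longleftrightarrow> S \<zeta> \<xi> j i" for \<xi> \<zeta> i j
    unfolding S_def by (subst sph_dot_commute) (simp add: add.commute min.commute)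
  have Vc: "V v \<xi> \<zeta> i j \<longleftrightarrow> V v \<zeta> \<xi> j i" for v \<xi> \<zeta> i j
    unfolding V_def by (subst sph_mom_commute) (cases i j rule: linorder_cases; auto simp: add.commute)
  have Sneg: "S \<xi> \<zeta> i j" if "i < 0 \<or> j < 0" for \<xi> \<zeta> i j
    using that by (auto simp: S_def gegz_neg sph_dot_linear)
  have Vneg: "V v \<xi> \<zeta> i j" if "i < 0 \<or> j < 0" for v \<xi> \<zeta> i j
    using that by (auto simp: V_def gegz_neg sph_mom_linear)
  have vstep: "V v \<xi> \<zeta> i j"
    if w: "\<xi> \<bullet> \<zeta> = w" and ij: "0 \<le> i" "i \<le> j" and IS: "\<And>\<xi>' \<zeta>' i' j'. {\<xi>', \<zeta>'} = {\<xi>, \<zeta>} \<Longrightarrow> i' + j' < i + j \<Longrightarrow> S \<xi>' \<zeta>' i' j'"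
      and IV: "\<And>\<xi>' \<zeta>' i' j'. {\<xi>', \<zeta>'} = {\<xi>, \<zeta>} \<Longrightarrow> i' + j' < i + j \<Longrightarrow> V v \<xi>' \<zeta>' i' j'"
    for v \<xi> \<zeta> i j
  proof -
    have sw: "{\<zeta>, \<xi>} = {\<xi>, \<zeta>}" by auto
    \<comment> \<open>In the borderline case j = i + 1 the two branches of the derivative formula
      coincide, because the factor j - 1 - i vanishes.\<close>
    have adj: "j - 1 \<le> i \<Longrightarrow> even i \<Longrightarrow> odd j \<Longrightarrow> j = i + 1"
        "j - 1 \<le> i \<Longrightarrow> odd i \<Longrightarrow> even j \<Longrightarrow> j = i + 1"
      using ij by presburger+
    define M where "M = sph_mom v \<xi> \<zeta> (gegz \<mu> i) (gegz \<mu> j)"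
    \<comment> \<open>The Euler operator sends the polynomial of degree i to i times itself plus a
      derivative of degree i - 1, so the unknown \<open>M\<close> collects the factor m - 1 + i + j
      and all other terms are known by induction.\<close>
    have *: "(real DIM('a) - 1 + i + j) * M + sph_mom v \<zeta> \<xi> (gegz \<mu> j) (pderiv (gegz \<mu> (i - 1)))
        + sph_mom v \<xi> \<zeta> (gegz \<mu> i) (pderiv (gegz \<mu> (j - 1)))
      = (\<xi> \<bullet> v) * sph_dot \<zeta> \<xi> (gegz \<mu> j) (pderiv (gegz \<mu> i)) + (\<zeta> \<bullet> v) * sph_dot \<xi> \<zeta> (gegz \<mu> i) (pderiv (gegz \<mu> j))"
      using sphere_divergence[of v \<xi> \<zeta> "gegz \<mu> i" "gegz \<mu> j"]
      unfolding gegz_deriv_mult sph_mom_linear M_def sph_mom_commute[of v \<zeta>] sph_dot_commute[of \<zeta>]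
      by (simp add: algebra_simps)
    have 1: "sph_mom v \<zeta> \<xi> (gegz \<mu> j) (pderiv (gegz \<mu> (i - 1)))
        = (if odd (i + j) then T * (\<zeta> \<bullet> v) * poly (pderiv (gegz \<mu> (i - 1))) w else 0)"
      by (rule trans[OF sph_mom_gegz_deriv[where T = T and w = w]])
        (use ij IV[OF sw, of j] in \<open>auto simp: V_def add.commute\<close>)
    have 2: "sph_mom v \<xi> \<zeta> (gegz \<mu> i) (pderiv (gegz \<mu> (j - 1)))
        = (if odd (i + j) then T * ((\<xi> \<bullet> v) * poly (pderiv (gegz \<mu> i)) w
            + (\<zeta> \<bullet> v) * ((j - 1 - i) / 2 * (i + j - 1 + 2 * \<mu>)) * poly (gegz \<mu> i) w) else 0)"
      by (rule trans[OF sph_mom_gegz_deriv[where T = T and w = w]])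
        (use ij IV[OF refl, of i] in \<open>auto simp: V_def dest: adj\<close>)
    have 3: "sph_dot \<zeta> \<xi> (gegz \<mu> j) (pderiv (gegz \<mu> i))
        = (if odd (i + j) then T * poly (pderiv (gegz \<mu> i)) w else 0)"
      by (rule trans[OF sph_dot_gegz_deriv[where T = T and w = w]])
        (use ij IS[OF sw, of j] in \<open>auto simp: S_def add.commute\<close>)
    have 4: "sph_dot \<xi> \<zeta> (gegz \<mu> i) (pderiv (gegz \<mu> j))
        = (if odd (i + j) then T * (poly (pderiv (gegz \<mu> (i - 1))) w + (j - i + 1) / 2 * (i + j - 1 + 2 * \<mu>) * poly (gegz \<mu> i) w) else 0)"
      by (rule trans[OF sph_dot_gegz_deriv[where T = T and w = w]])
        (use ij IS[OF refl, of i] in \<open>auto simp: S_def dest: adj\<close>)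
    have m: "real DIM('a) = 2 * \<mu>" by (simp add: \<mu>_def)
    have pos: "real DIM('a) - 1 + i + j > 0"
      using ij dim by linarith
    \<comment> \<open>All derivatives cancel, and the two progressions differ by i + j - 1 + 2\<mu>.
      This equals the factor on the left exactly because 2\<mu> = m.\<close>
    have "(real DIM('a) - 1 + i + j) * M = (real DIM('a) - 1 + i + j) *
        (if odd (i + j) then T * (\<zeta> \<bullet> v) * poly (gegz \<mu> i) w else 0)"
      using * unfolding 1 2 3 4 m by (cases "odd (i + j)") (simp_all add: field_simps)
    then have "M = (if odd (i + j) then T * (\<zeta> \<bullet> v) * poly (gegz \<mu> i) w else 0)"
      using pos by simp
    then show ?thesis
      using ij by (auto simp: V_def M_def)
  qed
  have sstep: "S \<xi> \<zeta> i j"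
    if w: "\<xi> \<bullet> \<zeta> = w" and n: "norm \<zeta> = 1" and ij: "0 \<le> i" "i \<le> j" and IS: "S \<xi> \<zeta> i (j - 2)"
      and IV: "V \<zeta> \<xi> \<zeta> i (j - 1)"
    for \<xi> \<zeta> i j
  proof (cases "j = 0")
    case True
    then show ?thesis
      using ij by (simp add: S_def gegz_def sph_dot_def T_def)
  next
    case False
    have nn: "\<zeta> \<bullet> \<zeta> = 1"
      using n by (simp add: norm_eq_1)
    have r: "smult (of_int j) (gegz \<mu> j) = smult (2 * (of_int j - 1 + \<mu>)) (pCons 0 (gegz \<mu> (j - 1)))
        - smult (of_int j - 2 + 2 * \<mu>) (gegz \<mu> (j - 2))"
      using gegz_rec[of "j - 2" \<mu>] by simp
    have "of_int j * sph_dot \<xi> \<zeta> (gegz \<mu> i) (gegz \<mu> j) = sph_dot \<xi> \<zeta> (gegz \<mu> i) (smult (of_int j) (gegz \<mu> j))"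
      by (simp add: sph_dot_linear)
    also have "\<dots> = 2 * (of_int j - 1 + \<mu>) * sph_mom \<zeta> \<xi> \<zeta> (gegz \<mu> i) (gegz \<mu> (j - 1))
       - (of_int j - 2 + 2 * \<mu>) * sph_dot \<xi> \<zeta> (gegz \<mu> i) (gegz \<mu> (j - 2))"
      unfolding r sph_dot_linear sph_dot_pCons_right by simp
    also have "\<dots> = of_int j * (if even (i + j) then T * poly (gegz \<mu> i) w else 0)"
    \<comment> \<open>For i = j the vector integral points along \<open>\<xi>\<close>, and
      contraction gives \<open>w\<close>, so the recurrence at \<open>w\<close> closes the case. For
      i <= j - 2 it points along the unit vector \<open>\<zeta>\<close>, and the coefficients
      combine as 2(j - 1 + \<mu>) - (j - 2 + 2\<mu>) = j.\<close>
    proof (cases "i = j")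
      case True
      have "of_int j * poly (gegz \<mu> j) w = 2 * (of_int j - 1 + \<mu>) * w * poly (gegz \<mu> (j - 1)) w
        - (of_int j - 2 + 2 * \<mu>) * poly (gegz \<mu> (j - 2)) w"
        using arg_cong[OF r, of "\<lambda>p. poly p w"] by simp
      from arg_cong[OF this, of "(*) T"] show ?thesis
        using IS IV w True by (simp add: S_def V_def algebra_simps)
    next
      case False
      show ?thesis
      proof (cases "even (i + j)")
        case True
        then have "i \<le> j - 2" using False ij by presburger
        then show ?thesis
          using IS IV nn True by (simp add: S_def V_def min_def algebra_simps)
      qed (use IS IV in \<open>simp add: S_def V_def\<close>)
    qed
    finally show ?thesis
      using False ij by (simp add: S_def min_def)
  qed
  \<comment> \<open>The vectors are generalised because the case i > j is obtained by exchanging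
    them.\<close>
  have main: "\<And>\<xi> \<zeta> i j. norm \<xi> = 1 \<Longrightarrow> norm \<zeta> = 1 \<Longrightarrow> \<xi> \<bullet> \<zeta> = w \<Longrightarrow> 0 \<le> i \<Longrightarrow> 0 \<le> j \<Longrightarrow> nat (i + j) = n \<Longrightarrow>
     S \<xi> \<zeta> i j \<and> (\<forall>v. V v \<xi> \<zeta> i j)" for n
  proof (induction n rule: less_induct)
    case (less n)
    have IH: "S \<xi>' \<zeta>' i' j' \<and> (\<forall>v. V v \<xi>' \<zeta>' i' j')"
      if "norm \<xi>' = 1" "norm \<zeta>' = 1" "\<xi>' \<bullet> \<zeta>' = w" "i' + j' < int n" for \<xi>' \<zeta>' i' j'
    proof (cases "i' < 0 \<or> j' < 0")
      case False
      then show ?thesis using less.IH[of "nat (i' + j')"] that by auto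
    qed (use Sneg Vneg in blast)
    have *: "S \<xi> \<zeta> i j \<and> (\<forall>v. V v \<xi> \<zeta> i j)"
      if h: "norm \<xi> = 1" "norm \<zeta> = 1" "\<xi> \<bullet> \<zeta> = w" "0 \<le> i" "i \<le> j" "i + j = int n" for \<xi> \<zeta> i j
    proof (intro conjI allI)
      show "S \<xi> \<zeta> i j"
        by (rule sstep) (use IH h in auto)
      show "V v \<xi> \<zeta> i j" for v
        by (rule vstep) (use IH h in \<open>auto simp: doubleton_eq_iff inner_commute\<close>)
    qed
    show ?case
    proof (cases "i \<le> j")
      case True
      then show ?thesis using *[of \<xi> \<zeta> i j] less.prems by auto
    next
      case False
      then show ?thesis using *[of \<zeta> \<xi> j i] less.prems Sc Vc by (auto simp: inner_commute)
    qed
  qed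
  have "S \<xi> \<zeta> i j \<and> (\<forall>v. V v \<xi> \<zeta> i j)"
  proof (cases "i < 0 \<or> j < 0")
    case False
    then show ?thesis using main[of \<xi> \<zeta> i j] \<xi> \<zeta> by (auto simp: w_def)
  qed (use Sneg Vneg in blast)
  then show ?thesis unfolding S_def V_def .
qed

section \<open>Zonal Clifford kernels\<close>

lemma smult_of_real: "complex_of_real r *s u = r *\<^sub>R u"
  by (simp add: vec_eq_iff) (simp add: scaleR_conv_of_real)

lemma cl_mult_scaleR_left: "(r *\<^sub>R u) \<star> v = r *\<^sub>R (u \<star> v)"
  and cl_mult_scaleR_right: "u \<star> (r *\<^sub>R v) = r *\<^sub>R (u \<star> v)"
  by (simp_all add: cl_mult_smult_left cl_mult_smult_right flip: smult_of_real)

lemma cl_mult_zero [simp]: "0 \<star> v = 0" "v \<star> 0 = 0"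
  by (simp_all add: vec_eq_iff cl_mult_nth)

lemma cl_mult_minus_left: "(- u) \<star> v = - (u \<star> v)"
  and cl_mult_minus_right: "u \<star> (- v) = - (u \<star> v)"
  by (simp_all add: vec_eq_iff cl_mult_nth sum_negf)

definition cl_vec :: "(real, 'n::{finite,linorder}) vec \<Rightarrow> 'n cclifford" where
  "cl_vec x = (\<Sum>i\<in>UNIV. (x $ i) *\<^sub>R cl_gen i)"

lemma bounded_bilinear_cl_mult:
  "bounded_bilinear ((\<star>) :: 'n::{finite,linorder} cclifford \<Rightarrow> 'n cclifford \<Rightarrow> 'n cclifford)"
  unfolding bilinear_conv_bounded_bilinear[symmetric] bilinear_def
  by (auto intro!: linearI simp: cl_mult_add_left cl_mult_add_right cl_mult_scaleR_left cl_mult_scaleR_right)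

lemmas continuous_on_cl_mult = bounded_bilinear.continuous_on[OF bounded_bilinear_cl_mult]

lemma continuous_on_cl_vec: "continuous_on S f \<Longrightarrow> continuous_on S (\<lambda>x. cl_vec (f x))"
  unfolding cl_vec_def by (intro continuous_intros)

lemma cl_vec_scaleR: "cl_vec (r *\<^sub>R x) = r *\<^sub>R cl_vec x"
  by (simp add: cl_vec_def scaleR_sum_right)

lemma cl_vec_zero [simp]: "cl_vec 0 = 0"
  by (simp add: cl_vec_def)

text \<open>Splitting the double sum at the diagonal, anticommutation folds the lower triangle onto
  the upper one. This translates between the bivector form of the kernels and the form with a
  product of two vectors, which multiplies well.\<close>

lemma cl_vec_mult:
  "cl_vec x \<star> cl_vec y = cl_wedge x y - (x \<bullet> y) *\<^sub>R cl_one"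
proof -
  define f where "f = (\<lambda>(i, j). (x $ i * y $ j) *\<^sub>R (cl_gen i \<star> cl_gen j))"
  have "cl_vec x \<star> cl_vec y = (\<Sum>i\<in>UNIV. \<Sum>j\<in>UNIV. f (i, j))"
    unfolding cl_vec_def[of x] cl_mult_sum_left cl_mult_scaleR_left cl_vec_def[of y] cl_mult_sum_right
      cl_mult_scaleR_right f_def
    by (simp add: scaleR_sum_right) (subst sum.swap, simp add: mult.commute)
  also have "\<dots> = sum f (UNIV \<times> UNIV)"
    by (simp add: sum.cartesian_product)
  also have "UNIV \<times> UNIV = {(i, j). i < j} \<union> {(i, j). j < i} \<union> {(i, j). i = (j::'a)}"
    by auto
  also have "sum f \<dots> = sum f {(i, j). i < j} + sum f {(i, j). j < i} + sum f {(i, j). i = j}"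
    by (subst sum.union_disjoint; (subst sum.union_disjoint)?) auto
  also have "sum f {(i, j). j < i} = (\<Sum>(i, j)\<in>{(i, j). i < j}. f (j, i))"
    by (rule sum.reindex_bij_witness[where i = prod.swap and j = prod.swap]) auto
  also have "\<dots> = (\<Sum>(i, j)\<in>{(i, j). i < j}. - ((x $ j * y $ i) *\<^sub>R (cl_gen i \<star> cl_gen j)))"
  proof (rule sum.cong[OF refl], clarify)
    fix i j :: 'a assume "i < j"
    then have "cl_gen j \<star> cl_gen i = - (cl_gen i \<star> cl_gen j)"
      using cl_gen_anticommute[of j i] by (simp add: eq_neg_iff_add_eq_0)
    then show "f (j, i) = - ((x $ j * y $ i) *\<^sub>R (cl_gen i \<star> cl_gen j))"
      by (simp add: f_def)
  qed
  also have "sum f {(i, j). i = j} = (\<Sum>i\<in>UNIV. f (i, i))"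
    by (rule sum.reindex_bij_witness[where i = "\<lambda>i. (i, i)" and j = fst]) auto
  also have "\<dots> = - ((x \<bullet> y) *\<^sub>R cl_one)"
    by (simp add: f_def cl_gen_square inner_vec_def scaleR_sum_left sum_negf)
  also have "sum f {(i, j). i < j} + (\<Sum>(i, j)\<in>{(i, j). i < j}. - ((x $ j * y $ i) *\<^sub>R (cl_gen i \<star> cl_gen j)))
    = cl_wedge x y"
    unfolding cl_wedge_def f_def sum.distrib[symmetric] smult_of_real
    by (rule sum.cong) (auto simp: scaleR_left_diff_distrib)
  finally show ?thesis by simp
qed

lemma cl_wedge_commute: "cl_wedge x y = - cl_wedge y x"
  unfolding cl_wedge_def sum_negf[symmetric]
  by (rule sum.cong) (auto simp: vec_eq_iff algebra_simps)

lemma cl_vec_square: "cl_vec x \<star> cl_vec x = - ((norm x)\<^sup>2 *\<^sub>R cl_one)"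
proof -
  have "cl_wedge x x = 0"
    by (simp add: cl_wedge_def)
  then show ?thesis by (simp add: cl_vec_mult power2_norm_eq_inner)
qed

text \<open>
  For \<open>n \<ge> 0\<close> this is the reproducing kernel of the spherical monogenics of degree \<open>n\<close>; the
  index \<open>n = -k < 0\<close> stands for the complementary kernel of degree \<open>k\<close>.
\<close>

definition zonal :: "int \<Rightarrow> (real, 'n::{finite,linorder}) vec \<Rightarrow> (real, 'n) vec \<Rightarrow> 'n cclifford" where
  "zonal n \<eta> \<xi> = (if 0 \<le> n then 1 else - 1) *\<^sub>R
     (poly (gegz (real CARD('n) / 2) (\<bar>n + 1\<bar> - 1)) (\<eta> \<bullet> \<xi>) *\<^sub>R cl_one
      + poly (gegz (real CARD('n) / 2) (\<bar>n\<bar> - 1)) (\<eta> \<bullet> \<xi>) *\<^sub>R (cl_vec \<xi> \<star> cl_vec \<eta>))"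

lemma continuous_on_zonal:
  "continuous_on S f \<Longrightarrow> continuous_on S g \<Longrightarrow> continuous_on S (\<lambda>x. zonal n (f x) (g x))"
  unfolding zonal_def by (intro continuous_intros continuous_on_cl_mult continuous_on_cl_vec)

text \<open>Adjacent factors \<open>\<eta>\<close> collapse to -1, so apart from scalar coefficients
  every term is at most linear in \<open>\<eta>\<close>; this is why scalar and vector integrals are
  enough. The linear terms are spelled out in coordinates to integrate coefficient by
  coefficient.\<close>

lemma cl_product_expand:
  assumes "norm \<eta> = 1"
  shows "(f *\<^sub>R cl_one + g *\<^sub>R (cl_vec \<xi> \<star> cl_vec \<eta>)) \<star> (f' *\<^sub>R cl_one + g' *\<^sub>R (cl_vec \<eta> \<star> cl_vec \<zeta>))
   = (f * f') *\<^sub>R cl_one + (\<Sum>k\<in>UNIV. ((\<eta> $ k) * g * f') *\<^sub>R (cl_vec \<xi> \<star> cl_gen k))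
    + (\<Sum>k\<in>UNIV. ((\<eta> $ k) * f * g') *\<^sub>R (cl_gen k \<star> cl_vec \<zeta>)) - (g * g') *\<^sub>R (cl_vec \<xi> \<star> cl_vec \<zeta>)"
proof -
  have "(cl_vec \<xi> \<star> cl_vec \<eta>) \<star> (cl_vec \<eta> \<star> cl_vec \<zeta>) = cl_vec \<xi> \<star> ((cl_vec \<eta> \<star> cl_vec \<eta>) \<star> cl_vec \<zeta>)"
    by (simp only: cl_mult_assoc)
  also have "\<dots> = - (cl_vec \<xi> \<star> cl_vec \<zeta>)"
    using assms by (simp add: cl_vec_square cl_mult_minus_left cl_mult_minus_right cl_mult_scaleR_left cl_one_left)
  finally have 1: "(cl_vec \<xi> \<star> cl_vec \<eta>) \<star> (cl_vec \<eta> \<star> cl_vec \<zeta>) = - (cl_vec \<xi> \<star> cl_vec \<zeta>)" .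
  have 2: "(\<Sum>k\<in>UNIV. ((\<eta> $ k) * g * f') *\<^sub>R (cl_vec \<xi> \<star> cl_gen k)) = (g * f') *\<^sub>R (cl_vec \<xi> \<star> cl_vec \<eta>)"
    by (simp add: cl_vec_def[of \<eta>] cl_mult_sum_right cl_mult_scaleR_right scaleR_sum_right mult_ac)
  have 3: "(\<Sum>k\<in>UNIV. ((\<eta> $ k) * f * g') *\<^sub>R (cl_gen k \<star> cl_vec \<zeta>)) = (f * g') *\<^sub>R (cl_vec \<eta> \<star> cl_vec \<zeta>)"
    by (simp add: cl_vec_def[of \<eta>] cl_mult_sum_left cl_mult_scaleR_left scaleR_sum_right mult_ac)
  show ?thesis
    unfolding 2 3
    by (simp add: cl_mult_add_left cl_mult_add_right cl_mult_scaleR_left cl_mult_scaleR_right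
        cl_one_left cl_one_right 1 mult_ac scaleR_add_right scaleR_diff_right)
qed

text \<open>After expansion there are four integrals, two scalar and two vector ones. For n
  different from l they cancel in pairs; for n = l they add up to the kernel itself, with the sign
  that separates the two families.\<close>

theorem zonal_orthogonal:
  fixes \<xi> \<zeta> :: "(real, 'n::{finite,linorder}) vec"
  assumes dim: "2 \<le> CARD('n)" and \<xi>: "norm \<xi> = 1" and \<zeta>: "norm \<zeta> = 1"
  shows "has_bochner_integral sphere_measure (\<lambda>\<eta>. zonal n \<eta> \<xi> \<star> zonal l \<zeta> \<eta>)
     (if n = l then measure (sphere_measure :: (real, 'n) vec measure) UNIV *\<^sub>R zonal n \<zeta> \<xi> else 0)"
proof -
  define \<mu> where "\<mu> = real CARD('n) / 2"
  define T where "T = measure (sphere_measure :: (real, 'n) vec measure) UNIV"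
  define w where "w = \<xi> \<bullet> \<zeta>"
  define U where "U i = gegz \<mu> i" for i
  \<comment> \<open>The pair (i, j) is (n, n - 1) for n >= 0 and (k - 2, k - 1) for n = -k: the
    entries always differ by one, and only their order tells the families apart.\<close>
  define i j i' j' where "i = \<bar>n + 1\<bar> - 1" and "j = \<bar>n\<bar> - 1" and "i' = \<bar>l + 1\<bar> - 1" and "j' = \<bar>l\<bar> - 1"
  define e where "e n = (if 0 \<le> n then 1 else - 1 :: real)" for n :: int
  define X where "X = cl_vec \<xi> \<star> cl_vec \<zeta>"
  define F where "F \<eta> = (poly (U i) (\<eta> \<bullet> \<xi>) * poly (U i') (\<eta> \<bullet> \<zeta>)) *\<^sub>R cl_one
      + (\<Sum>k\<in>UNIV. ((\<eta> $ k) * poly (U j) (\<eta> \<bullet> \<xi>) * poly (U i') (\<eta> \<bullet> \<zeta>)) *\<^sub>R (cl_vec \<xi> \<star> cl_gen k))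
      + (\<Sum>k\<in>UNIV. ((\<eta> $ k) * poly (U i) (\<eta> \<bullet> \<xi>) * poly (U j') (\<eta> \<bullet> \<zeta>)) *\<^sub>R (cl_gen k \<star> cl_vec \<zeta>))
      - (poly (U j) (\<eta> \<bullet> \<xi>) * poly (U j') (\<eta> \<bullet> \<zeta>)) *\<^sub>R X" for \<eta>
  have mom: "sph_mom (axis k 1) \<xi> \<zeta> p q = (LINT \<eta>|sphere_measure. (\<eta> $ k) * poly p (\<eta> \<bullet> \<xi>) * poly q (\<eta> \<bullet> \<zeta>))"
    and imom: "integrable sphere_measure (\<lambda>\<eta>. (\<eta> $ k) * poly p (\<eta> \<bullet> \<xi>) * poly q (\<eta> \<bullet> \<zeta>))" for k p q
    using integrable_sph_mom[of "axis k 1" p \<xi> q \<zeta>] by (simp_all add: sph_mom_def inner_axis)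
  have F1: "has_bochner_integral sphere_measure F (sph_dot \<xi> \<zeta> (U i) (U i') *\<^sub>R cl_one
      + (\<Sum>k\<in>UNIV. sph_mom (axis k 1) \<xi> \<zeta> (U j) (U i') *\<^sub>R (cl_vec \<xi> \<star> cl_gen k))
      + (\<Sum>k\<in>UNIV. sph_mom (axis k 1) \<xi> \<zeta> (U i) (U j') *\<^sub>R (cl_gen k \<star> cl_vec \<zeta>))
      - sph_dot \<xi> \<zeta> (U j) (U j') *\<^sub>R X)"
    unfolding F_def sph_dot_def mom
    by (intro has_bochner_integral_add has_bochner_integral_diff has_bochner_integral_sum
        has_bochner_integral_scaleR_left has_bochner_integral_integrable integrable_sph_dot imom)
  \<comment> \<open>Since the entries of each pair differ by one, the parity of i + i' decides
    whether all four integrals vanish.\<close>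
  have par: "even (j + i') = odd (i + i')" "even (i + j') = odd (i + i')" "even (j + j') = even (i + i')"
    unfolding i_def j_def i'_def j'_def by (auto simp: abs_if)
  have D: "DIM((real, 'n) vec) = CARD('n)" by simp
  note sg = sphere_gegz[OF _ \<xi> \<zeta>, unfolded D, folded w_def \<mu>_def T_def, OF dim]
  have dots: "sph_dot \<xi> \<zeta> (U i) (U i') = (if even (i + i') then T * poly (U (min i i')) w else 0)"
    "sph_dot \<xi> \<zeta> (U j) (U j') = (if even (i + i') then T * poly (U (min j j')) w else 0)"
    unfolding U_def using par(3) by (simp_all only: sg)
  have sum1: "(\<Sum>k\<in>UNIV. sph_mom (axis k 1) \<xi> \<zeta> (U j) (U i') *\<^sub>R (cl_vec \<xi> \<star> cl_gen k))
     = (if even (i + i') then T *\<^sub>R (if i' < j then - (poly (U i') w *\<^sub>R cl_one) else poly (U j) w *\<^sub>R X) else 0)"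
  proof -
    define v where "v = (if even (i + i') then
        (if i' < j then (T * poly (U i') w) *\<^sub>R \<xi> else (T * poly (U j) w) *\<^sub>R \<zeta>) else 0)"
    have "sph_mom (axis k 1) \<xi> \<zeta> (U j) (U i') = v $ k" for k
      unfolding U_def sg[THEN conjunct2, rule_format] v_def using par(1) by (simp add: inner_axis)
    then have "(\<Sum>k\<in>UNIV. sph_mom (axis k 1) \<xi> \<zeta> (U j) (U i') *\<^sub>R (cl_vec \<xi> \<star> cl_gen k))
        = cl_vec \<xi> \<star> cl_vec v"
      by (simp add: cl_vec_def[of v] cl_mult_sum_right cl_mult_scaleR_right)
    then show ?thesis
      using \<xi> by (simp add: v_def X_def cl_vec_scaleR cl_vec_zero cl_mult_scaleR_right cl_vec_square)
  qed
  have sum2: "(\<Sum>k\<in>UNIV. sph_mom (axis k 1) \<xi> \<zeta> (U i) (U j') *\<^sub>R (cl_gen k \<star> cl_vec \<zeta>))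
     = (if even (i + i') then T *\<^sub>R (if j' < i then poly (U j') w *\<^sub>R X else - (poly (U i) w *\<^sub>R cl_one)) else 0)"
  proof -
    define v where "v = (if even (i + i') then
        (if j' < i then (T * poly (U j') w) *\<^sub>R \<xi> else (T * poly (U i) w) *\<^sub>R \<zeta>) else 0)"
    have "sph_mom (axis k 1) \<xi> \<zeta> (U i) (U j') = v $ k" for k
      unfolding U_def sg[THEN conjunct2, rule_format] v_def using par(2) by (simp add: inner_axis)
    then have "(\<Sum>k\<in>UNIV. sph_mom (axis k 1) \<xi> \<zeta> (U i) (U j') *\<^sub>R (cl_gen k \<star> cl_vec \<zeta>))
        = cl_vec v \<star> cl_vec \<zeta>"
      by (simp add: cl_vec_def[of v] cl_mult_sum_left cl_mult_scaleR_left)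
    then show ?thesis
      using \<zeta> by (simp add: v_def X_def cl_vec_scaleR cl_vec_zero cl_mult_scaleR_left cl_vec_square)
  qed
  have G: "has_bochner_integral sphere_measure (\<lambda>\<eta>. (e n * e l) *\<^sub>R F \<eta>)
     (if n = l then T *\<^sub>R zonal n \<zeta> \<xi> else 0)"
  proof (rule has_bochner_integral_cong[THEN iffD1, OF refl refl _ has_bochner_integral_scaleR_right[OF F1, of "e n * e l"]])
    have z: "zonal n \<zeta> \<xi> = e n *\<^sub>R (poly (U i) w *\<^sub>R cl_one + poly (U j) w *\<^sub>R X)"
      by (simp add: zonal_def e_def U_def \<mu>_def i_def j_def w_def X_def inner_commute)
    show "(e n * e l) *\<^sub>R (sph_dot \<xi> \<zeta> (U i) (U i') *\<^sub>R cl_one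
      + (\<Sum>k\<in>UNIV. sph_mom (axis k 1) \<xi> \<zeta> (U j) (U i') *\<^sub>R (cl_vec \<xi> \<star> cl_gen k))
      + (\<Sum>k\<in>UNIV. sph_mom (axis k 1) \<xi> \<zeta> (U i) (U j') *\<^sub>R (cl_gen k \<star> cl_vec \<zeta>))
      - sph_dot \<xi> \<zeta> (U j) (U j') *\<^sub>R X) = (if n = l then T *\<^sub>R zonal n \<zeta> \<xi> else 0)"
    proof (cases "even (i + i')")
      case True
      have "i \<noteq> j'" "i' \<noteq> j" using True par(1,2) by auto
      show ?thesis
      proof (cases "n = l")
        case True
        then have "i' = i" "j' = j" "e n * e l = 1"
          by (auto simp: i_def i'_def j_def j'_def e_def)
        moreover have "j < i \<longleftrightarrow> 0 \<le> n" "i < j \<longleftrightarrow> n < 0"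
          by (auto simp: i_def j_def abs_if)
        ultimately show ?thesis
          using True \<open>even (i + i')\<close> unfolding dots sum1 sum2 z
          by (auto simp: e_def algebra_simps)
      next
        case False
        have "even (n + l)"
          using True unfolding i_def i'_def by (auto simp: abs_if split: if_splits)
        then obtain q where q: "n + l = 2 * q" by (elim evenE)
        have abs1: "\<bar>a + 1\<bar> = a + 1" "\<bar>a\<bar> = a" if "0 \<le> a" for a :: int
          using that by auto
        have abs2: "\<bar>a + 1\<bar> = - a - 1" "\<bar>a\<bar> = - a" if "a < 0" for a :: int
          using that by auto
        \<comment> \<open>For distinct n and l of equal parity, one pair dominates the other. Then
          the scalar part of one vector integral cancels the first scalar integral, and the bivector
          part of the other cancels the second.\<close>
        from False q have "(i' < j \<and> j' < i \<and> i' \<le> i \<and> j' \<le> j) \<or> (\<not> i' < j \<and> \<not> j' < i \<and> i \<le> i' \<and> j \<le> j')"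
          unfolding i_def j_def i'_def j'_def
          by (cases "0 \<le> n"; cases "0 \<le> l"; simp only: not_le abs1 abs2; presburger)
        then show ?thesis
          using True False unfolding dots sum1 sum2
          by (auto simp: algebra_simps min_def)
      qed
    next
      case False
      then have "n \<noteq> l" by (auto simp: i_def i'_def)
      then show ?thesis
        using False unfolding dots sum1 sum2 by simp
    qed
  qed
  have AE: "AE \<eta> in sphere_measure. (e n * e l) *\<^sub>R F \<eta> = zonal n \<eta> \<xi> \<star> zonal l \<zeta> \<eta>"
    using AE_sphere_measure
  proof eventually_elim
    case (elim \<eta>)
    show ?case
      unfolding zonal_def F_def cl_mult_scaleR_left cl_mult_scaleR_right inner_commute[of \<zeta> \<eta>]
      by (subst cl_product_expand[OF elim])
        (simp add: e_def U_def \<mu>_def i_def j_def i'_def j'_def X_def)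
  qed
  have [measurable]: "(\<lambda>\<eta>. zonal n \<eta> \<xi> \<star> zonal l \<zeta> \<eta>) \<in> borel_measurable borel"
    by (intro borel_measurable_continuous_onI continuous_on_cl_mult continuous_on_zonal continuous_intros)
  from G have "(\<lambda>\<eta>. (e n * e l) *\<^sub>R F \<eta>) \<in> borel_measurable sphere_measure"
    by (rule borel_measurable_has_bochner_integral)
  then show ?thesis
    unfolding T_def[symmetric] by (rule has_bochner_integral_cong_AE[THEN iffD1, OF _ _ AE G]) simp
qed

section \<open>Bessel series and the Weber integral\<close>

text \<open>The entire factor of Bessel functions: J(t) is (t/2)^\<nu> times its value at -t^2/4,
  and the modified function I(t) is the same power times its value at t^2/4. A single real function
  thus serves all kernels.\<close>

definition bessel_entire :: "real \<Rightarrow> real \<Rightarrow> real" where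
  "bessel_entire \<nu> q = (\<Sum>n. q ^ n / fact n * rGamma (\<nu> + real n + 1))"

lemma rGamma_real_pos: "0 < x \<Longrightarrow> 0 < rGamma (x :: real)"
  by (simp add: rGamma_inverse_Gamma Gamma_real_pos)

text \<open>For \<nu> >= -1/2 the Pochhammer symbol of \<nu> + 1 dominates that of 1/2, and n! times
  the latter is (2n)!/4^n. The comparison series is therefore the even part of an exponential
  series.\<close>

lemma bessel_entire_term_bound:
  assumes "- 1 / 2 \<le> \<nu>"
  shows "norm (q ^ n / fact n * rGamma (\<nu> + real n + 1))
     \<le> rGamma (\<nu> + 1) * ((2 * sqrt \<bar>q\<bar>) ^ (2 * n) / fact (2 * n))"
proof -
  have r: "rGamma (\<nu> + 1) = pochhammer (\<nu> + 1) n * rGamma (\<nu> + real n + 1)"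
    using pochhammer_rGamma[of "\<nu> + 1" n] by (simp add: add_ac)
  have pos: "rGamma (\<nu> + real n + 1) > 0"
    using assms by (intro rGamma_real_pos) linarith
  have ph: "0 < pochhammer (1 / 2 :: real) n" "pochhammer (1 / 2) n \<le> pochhammer (\<nu> + 1) n"
    using assms by (simp_all add: pochhammer_pos) (auto intro!: prod_mono simp: pochhammer_prod)
  have "(2 * sqrt \<bar>q\<bar>) ^ (2 * n) = 2 ^ (2 * n) * \<bar>q\<bar> ^ n"
    by (simp add: power_mult power_mult_distrib)
  then have e: "(2 * sqrt \<bar>q\<bar>) ^ (2 * n) / fact (2 * n) = \<bar>q\<bar> ^ n / fact n / pochhammer (1 / 2) n"
    by (simp add: fact_double)
  have "norm (q ^ n / fact n * rGamma (\<nu> + real n + 1)) = \<bar>q\<bar> ^ n / fact n * rGamma (\<nu> + real n + 1)"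
    using pos by (simp add: abs_mult power_abs)
  also have "\<dots> \<le> \<bar>q\<bar> ^ n / fact n * (rGamma (\<nu> + 1) / pochhammer (1 / 2) n)"
    unfolding r using ph pos by (intro mult_left_mono) (auto simp: pos_le_divide_eq mult.commute)
  finally show ?thesis unfolding e by (simp add: mult_ac)
qed

lemma
  assumes "- 1 / 2 \<le> \<nu>"
  shows summable_bessel_entire: "summable (\<lambda>n. norm (q ^ n / fact n * rGamma (\<nu> + real n + 1)))"
    and suminf_norm_bessel_entire:
      "(\<Sum>n. norm (q ^ n / fact n * rGamma (\<nu> + real n + 1))) \<le> rGamma (\<nu> + 1) * exp (2 * sqrt \<bar>q\<bar>)"
proof -
  define x where "x = 2 * sqrt \<bar>q\<bar>"
  have x: "0 \<le> x" by (simp add: x_def)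
  have s: "summable (\<lambda>n. x ^ n / fact n)" and es: "(\<Sum>n. x ^ n / fact n) = exp x"
    using exp_converges[of x] by (auto simp: sums_iff field_simps)
  have inj: "inj ((*) (2::nat))" by (auto intro: injI)
  have s2: "summable (\<lambda>n. x ^ (2 * n) / fact (2 * n))"
    and e2: "(\<Sum>n. x ^ (2 * n) / fact (2 * n)) \<le> exp x"
    using summable_reindex[OF s inj] suminf_reindex_mono[OF s inj] x unfolding es by (auto simp: o_def)
  have s3: "summable (\<lambda>n. rGamma (\<nu> + 1) * (x ^ (2 * n) / fact (2 * n)))"
    using s2 by (rule summable_mult)
  note b = bessel_entire_term_bound[OF assms, of q, folded x_def]
  show s4: "summable (\<lambda>n. norm (q ^ n / fact n * rGamma (\<nu> + real n + 1)))"
    by (rule summable_comparison_test'[OF s3, of 0]) (use b in auto)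
  have "(\<Sum>n. norm (q ^ n / fact n * rGamma (\<nu> + real n + 1))) \<le> (\<Sum>n. rGamma (\<nu> + 1) * (x ^ (2 * n) / fact (2 * n)))"
    by (intro suminf_le b s3 s4)
  also have "\<dots> = rGamma (\<nu> + 1) * (\<Sum>n. x ^ (2 * n) / fact (2 * n))"
    by (rule suminf_mult[OF s2])
  also have "\<dots> \<le> rGamma (\<nu> + 1) * exp x"
    using e2 assms by (intro mult_left_mono less_imp_le[OF rGamma_real_pos]) auto
  finally show "(\<Sum>n. norm (q ^ n / fact n * rGamma (\<nu> + real n + 1))) \<le> rGamma (\<nu> + 1) * exp (2 * sqrt \<bar>q\<bar>)"
    by (simp add: x_def)
qed

lemma abs_bessel_entire_le:
  assumes "- 1 / 2 \<le> \<nu>"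
  shows "\<bar>bessel_entire \<nu> q\<bar> \<le> rGamma (\<nu> + 1) * exp (2 * sqrt \<bar>q\<bar>)"
  using order_trans[OF summable_norm[OF summable_bessel_entire[OF assms]] suminf_norm_bessel_entire[OF assms], of q]
  unfolding bessel_entire_def real_norm_def .

lemma borel_measurable_bessel_entire [measurable]:
  "bessel_entire \<nu> \<in> borel_measurable borel"
  unfolding bessel_entire_def by measurable

text \<open>The quotient of Gamma values is a Pochhammer symbol, that is k! times the binomial
  coefficient of l + (\<nu> + k) over k; the Chu-Vandermonde convolution expands it.\<close>

lemma weber_coefficient:
  fixes \<nu> :: real
  assumes "- 1 < \<nu>"
  shows "Gamma (\<nu> + real (k + l) + 1) * (rGamma (\<nu> + real k + 1) / fact k) * (rGamma (\<nu> + real l + 1) / fact l)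
    = (\<Sum>p\<le>min k l. rGamma (\<nu> + real p + 1) / (fact p * fact (k - p) * fact (l - p)))"
proof -
  have "Gamma (\<nu> + real (k + l) + 1) * rGamma (\<nu> + real l + 1) = pochhammer (\<nu> + real l + 1) k"
  proof -
    have "rGamma (\<nu> + real l + 1) = pochhammer (\<nu> + real l + 1) k * rGamma (\<nu> + real (k + l) + 1)"
      using pochhammer_rGamma[of "\<nu> + real l + 1" k] by (simp add: add_ac)
    moreover have "Gamma z * rGamma z = 1" if "z > 0" for z :: real
      using Gamma_real_pos[OF that] by (simp add: rGamma_inverse_Gamma)
    then have "Gamma (\<nu> + real (k + l) + 1) * rGamma (\<nu> + real (k + l) + 1) = 1"
      using assms by simp
    ultimately show ?thesis by simp
  qed
  also have "\<dots> = fact k * ((real l + (\<nu> + real k)) gchoose k)"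
    by (simp add: gbinomial_pochhammer' add_ac)
  also have "\<dots> = fact k * (\<Sum>p=0..k. (real l gchoose p) * ((\<nu> + real k) gchoose (k - p)))"
    by (simp only: gbinomial_Vandermonde)
  also have "(\<Sum>p=0..k. (real l gchoose p) * ((\<nu> + real k) gchoose (k - p)))
      = (\<Sum>p\<le>min k l. (real l gchoose p) * ((\<nu> + real k) gchoose (k - p)))"
    by (intro sum.mono_neutral_right) (auto simp: binomial_gbinomial[symmetric])
  finally have G: "Gamma (\<nu> + real (k + l) + 1) * rGamma (\<nu> + real l + 1)
     = fact k * (\<Sum>p\<le>min k l. (real l gchoose p) * ((\<nu> + real k) gchoose (k - p)))" .
  have t: "(real l gchoose p) * ((\<nu> + real k) gchoose (k - p)) * rGamma (\<nu> + real k + 1) / fact l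
      = rGamma (\<nu> + real p + 1) / (fact p * fact (k - p) * fact (l - p))" if "p \<le> min k l" for p
  proof -
    have 1: "real l gchoose p = fact l / (fact p * fact (l - p))"
      using that by (simp add: binomial_gbinomial[symmetric] binomial_fact)
    have 2: "rGamma (\<nu> + real p + 1) = pochhammer (\<nu> + real p + 1) (k - p) * rGamma (\<nu> + real k + 1)"
      using pochhammer_rGamma[of "\<nu> + real p + 1" "k - p"] that by (simp add: of_nat_diff add_ac)
    have 3: "(\<nu> + real k) gchoose (k - p) = pochhammer (\<nu> + real p + 1) (k - p) / fact (k - p)"
      using that by (simp add: gbinomial_pochhammer' of_nat_diff add_ac)
    show ?thesis unfolding 1 2 3 by (simp add: field_simps)
  qed
  have "Gamma (\<nu> + real (k + l) + 1) * (rGamma (\<nu> + real k + 1) / fact k) * (rGamma (\<nu> + real l + 1) / fact l)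
     = (\<Sum>p\<le>min k l. (real l gchoose p) * ((\<nu> + real k) gchoose (k - p))) * rGamma (\<nu> + real k + 1) / fact l"
    using G by (simp add: field_simps)
  also have "\<dots> = (\<Sum>p\<le>min k l. rGamma (\<nu> + real p + 1) / (fact p * fact (k - p) * fact (l - p)))"
    unfolding sum_distrib_right sum_divide_distrib by (rule sum.cong) (auto simp: t)
  finally show ?thesis .
qed

text \<open>Both sides are sorted by total degree \<open>N\<close> in \<open>a\<close> and
  \<open>b\<close>. The right side is the Cauchy product of the exponential with the series in ab,
  and \<open>weber_coefficient\<close> identifies its terms with those produced by Gaussian moments
  of a product of two Bessel series.\<close>

lemma weber_series:
  fixes a b \<nu> :: real
  assumes "- 1 / 2 \<le> \<nu>"
  shows "(\<lambda>N. Gamma (\<nu> + real N + 1) * (\<Sum>k\<le>N. ((- a) ^ k / fact k * rGamma (\<nu> + real k + 1))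
       * ((- b) ^ (N - k) / fact (N - k) * rGamma (\<nu> + real (N - k) + 1))))
     sums (exp (- (a + b)) * bessel_entire \<nu> (a * b))"
proof -
  let ?c = "\<lambda>N. Gamma (\<nu> + real N + 1) * (\<Sum>k\<le>N. ((- a) ^ k / fact k * rGamma (\<nu> + real k + 1))
       * ((- b) ^ (N - k) / fact (N - k) * rGamma (\<nu> + real (N - k) + 1)))"
  \<comment> \<open>The term (ab)^p has total degree 2p, so the series is spread over the even
    indices before the Cauchy product is formed.\<close>
  define h where "h n = (if even n then (a * b) ^ (n div 2) / fact (n div 2) * rGamma (\<nu> + real (n div 2) + 1) else 0)" for n
  have sm: "strict_mono ((*) (2::nat))" by (simp add: strict_mono_def)
  have rng: "n \<notin> range ((*) 2) \<Longrightarrow> odd n" for n :: nat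
    by (metis evenE rangeI)
  have h2: "h (2 * p) = (a * b) ^ p / fact p * rGamma (\<nu> + real p + 1)" for p
    by (simp add: h_def)
  have hs: "summable (\<lambda>n. norm (h n))"
    using summable_mono_reindex[OF sm, of "\<lambda>n. norm (h n)"] summable_bessel_entire[OF assms, of "a * b"] rng
    by (simp add: h2) (simp add: h_def)
  have hsum: "(\<Sum>n. h n) = bessel_entire \<nu> (a * b)"
  proof -
    have "(\<Sum>p. h (2 * p)) = (\<Sum>n. h n)"
      by (rule suminf_mono_reindex[OF sm]) (use rng in \<open>auto simp: h_def\<close>)
    then show ?thesis by (simp add: h2 bessel_entire_def)
  qed
  have es: "summable (\<lambda>n. norm ((- (a + b)) ^ n / fact n))"
    using summable_norm_exp[of "- (a + b)"] by (simp add: field_simps)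
  have esum: "(\<Sum>n. (- (a + b)) ^ n / fact n) = exp (- (a + b))"
    using exp_converges[of "- (a + b)"] by (simp add: sums_iff field_simps)
  have "(\<lambda>N. \<Sum>n\<le>N. h n * ((- (a + b)) ^ (N - n) / fact (N - n))) sums (bessel_entire \<nu> (a * b) * exp (- (a + b)))"
    using Cauchy_product_sums[OF hs es] unfolding hsum esum .
  moreover have "(\<Sum>n\<le>N. h n * ((- (a + b)) ^ (N - n) / fact (N - n)))
     = ?c N" for N
  proof -
    define g where "g p i = rGamma (\<nu> + real p + 1) / fact p * (a * b) ^ p * ((- a) ^ i / fact i * ((- b) ^ (N - 2 * p - i) / fact (N - 2 * p - i)))" for p i
    have "(\<Sum>n\<le>N. h n * ((- (a + b)) ^ (N - n) / fact (N - n)))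
       = (\<Sum>p\<in>{p. 2 * p \<le> N}. h (2 * p) * ((- (a + b)) ^ (N - 2 * p) / fact (N - 2 * p)))"
    proof -
      have "(\<Sum>n\<le>N. h n * ((- (a + b)) ^ (N - n) / fact (N - n)))
         = (\<Sum>n\<in>{n. n \<le> N \<and> even n}. h n * ((- (a + b)) ^ (N - n) / fact (N - n)))"
        by (rule sum.mono_neutral_right) (auto simp: h_def)
      also have "\<dots> = (\<Sum>p\<in>{p. 2 * p \<le> N}. h (2 * p) * ((- (a + b)) ^ (N - 2 * p) / fact (N - 2 * p)))"
        by (rule sum.reindex_bij_witness[where i = "(*) 2" and j = "\<lambda>n. n div 2"]) auto
      finally show ?thesis .
    qed
    also have "\<dots> = (\<Sum>p\<in>{p. 2 * p \<le> N}. \<Sum>i\<le>N - 2 * p. g p i)"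
    proof (rule sum.cong[OF refl])
      fix p
      define M where "M = N - 2 * p"
      have "(- (a + b)) ^ M / fact M = (\<Sum>i\<le>M. (- a) ^ i / fact i * ((- b) ^ (M - i) / fact (M - i)))"
      proof -
        have "(- a + - b) ^ M = (\<Sum>i\<le>M. of_nat (M choose i) * (- a) ^ i * (- b) ^ (M - i))"
          by (rule binomial_ring)
        then show ?thesis
          by (simp add: sum_divide_distrib binomial_fact field_simps)
      qed
      then show "h (2 * p) * ((- (a + b)) ^ (N - 2 * p) / fact (N - 2 * p)) = (\<Sum>i\<le>N - 2 * p. g p i)"
        unfolding h2 M_def[symmetric] g_def by (simp add: sum_distrib_left mult_ac)
    qed
    also have "\<dots> = (\<Sum>(p, i)\<in>Sigma {p. 2 * p \<le> N} (\<lambda>p. {..N - 2 * p}). g p i)"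
      by (rule sum.Sigma) (auto intro: finite_subset[of _ "{..N}"])
    also have "\<dots> = (\<Sum>(k, p)\<in>Sigma {..N} (\<lambda>k. {..min k (N - k)}).
        (- a) ^ k * (- b) ^ (N - k) * (rGamma (\<nu> + real p + 1) / (fact p * fact (k - p) * fact (N - k - p))))"
    \<comment> \<open>With p factors ab and i further factors a from the exponential, the exponent
      of a is k = i + p.\<close>
    proof (rule sum.reindex_bij_witness[where i = "\<lambda>(k, p). (p, k - p)" and j = "\<lambda>(p, i). (i + p, p)"])
      fix x assume x: "x \<in> Sigma {p. 2 * p \<le> N} (\<lambda>p. {..N - 2 * p})"
      obtain p i where [simp]: "x = (p, i)" by force
      have pi: "2 * p \<le> N" "i \<le> N - 2 * p" using x by auto
      define q where "q = N - 2 * p - i"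
      have e1: "N - (i + p) - p = q" and e2: "N - (i + p) = p + q" using pi by (simp_all add: q_def)
      have eq: "(- a) ^ (i + p) * (- b) ^ (N - (i + p)) = (a * b) ^ p * ((- a) ^ i * (- b) ^ q)"
      proof -
        have "(a * b) ^ p = (- a) ^ p * (- b) ^ p"
          by (simp add: power_mult_distrib[symmetric])
        then show ?thesis unfolding e2 power_add by (simp only: mult_ac)
      qed
      show "(case (case x of (p, i) \<Rightarrow> (i + p, p)) of (k, p) \<Rightarrow>
          (- a) ^ k * (- b) ^ (N - k) * (rGamma (\<nu> + real p + 1) / (fact p * fact (k - p) * fact (N - k - p)))) = (case x of (p, i) \<Rightarrow> g p i)"
        unfolding \<open>x = (p, i)\<close> prod.case e1 eq add_diff_cancel_right' g_def q_def[symmetric]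
        by (simp add: divide_divide_eq_left mult_ac)
    qed auto
    also have "\<dots> = (\<Sum>k\<le>N. \<Sum>p\<le>min k (N - k).
        (- a) ^ k * (- b) ^ (N - k) * (rGamma (\<nu> + real p + 1) / (fact p * fact (k - p) * fact (N - k - p))))"
      by (rule sum.Sigma[symmetric]) auto
    also have "\<dots> = (\<Sum>k\<le>N. (- a) ^ k * (- b) ^ (N - k) *
        (Gamma (\<nu> + real (k + (N - k)) + 1) * (rGamma (\<nu> + real k + 1) / fact k) * (rGamma (\<nu> + real (N - k) + 1) / fact (N - k))))"
      using assms by (subst weber_coefficient) (auto simp: sum_distrib_left)
    also have "\<dots> = ?c N"
      unfolding sum_distrib_left by (rule sum.cong) auto
    finally show ?thesis .
  qed
  ultimately show ?thesis by (simp add: mult.commute)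
qed

text \<open>Completing the square: half of the Gaussian absorbs the linear exponent.\<close>

lemma integrable_powr_gauss_exp:
  fixes p s L :: real
  assumes "- 1 < p" "0 < s"
  shows "integrable lborel (\<lambda>r. indicator {0<..} r * (r powr p * exp (- s * r\<^sup>2) * exp (L * r)))"
proof (rule Bochner_Integration.integrable_bound)
  show "integrable lborel (\<lambda>r. exp (L\<^sup>2 / (2 * s)) * (indicator {0<..} r * (r powr p * exp (- (s / 2) * r\<^sup>2))))"
    using has_bochner_integral_powr_gauss[of p "s / 2"] assms
    by (intro integrable_mult_right) (auto simp: has_bochner_integral_iff)
  have "L * r - s * r\<^sup>2 \<le> L\<^sup>2 / (2 * s) - s / 2 * r\<^sup>2" for r
  proof -
    have "0 \<le> (L - s * r)\<^sup>2 / (2 * s)" using assms by simp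
    also have "\<dots> = L\<^sup>2 / (2 * s) - s / 2 * r\<^sup>2 - (L * r - s * r\<^sup>2)"
      using assms by (simp add: power2_eq_square field_simps)
    finally show ?thesis by simp
  qed
  then have "exp (- s * r\<^sup>2) * exp (L * r) \<le> exp (L\<^sup>2 / (2 * s)) * exp (- (s / 2) * r\<^sup>2)" for r
    by (simp add: exp_add[symmetric])
  then have "r powr p * (exp (- s * r\<^sup>2) * exp (L * r)) \<le> r powr p * (exp (L\<^sup>2 / (2 * s)) * exp (- (s / 2) * r\<^sup>2))" for r
    by (intro mult_left_mono) auto
  then show "AE r in lborel. norm (indicator {0<..} r * (r powr p * exp (- s * r\<^sup>2) * exp (L * r)))
     \<le> norm (exp (L\<^sup>2 / (2 * s)) * (indicator {0<..} r * (r powr p * exp (- (s / 2) * r\<^sup>2))))"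
    by (intro AE_I2) (auto simp: indicator_def abs_mult mult_ac)
qed measurable

text \<open>The product of the two series is integrated term by term after grouping by total degree,
  each term being a Gaussian moment. With a = p^2/4 and b = q^2/4 this is the classical integral of
  J(pr) J(qr) r exp(-s r^2), with the powers of p and q divided out.\<close>

theorem weber_second_exponential_integral:
  fixes \<nu> s a b :: real
  assumes \<nu>: "- 1 / 2 \<le> \<nu>" and s: "0 < s" and a: "0 \<le> a" and b: "0 \<le> b"
  shows "has_bochner_integral lborel
     (\<lambda>r. indicator {0<..} r * (r powr (2 * \<nu> + 1) * exp (- s * r\<^sup>2)
        * (bessel_entire \<nu> (- a * r\<^sup>2) * bessel_entire \<nu> (- b * r\<^sup>2))))
     (exp (- (a + b) / s) * bessel_entire \<nu> (a * b / s\<^sup>2) / (2 * s powr (\<nu> + 1)))"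
proof -
  define G where "G = rGamma (\<nu> + 1)"
  define t where "t x k = (- x) ^ k / fact k * rGamma (\<nu> + real k + 1)" for x k
  define c where "c N = (\<Sum>k\<le>N. t a k * t b (N - k))" for N
  define g where "g r = indicator {0<..} r * (r powr (2 * \<nu> + 1) * exp (- s * r\<^sup>2))" for r :: real
  define P where "P M r = g r * (\<Sum>N<M. c N * r ^ (2 * N))" for M r
  define F where "F r = g r * (bessel_entire \<nu> (- a * r\<^sup>2) * bessel_entire \<nu> (- b * r\<^sup>2))" for r
  define W where "W r = G\<^sup>2 * (indicator {0<..} r * (r powr (2 * \<nu> + 1) * exp (- s * r\<^sup>2) * exp ((2 * sqrt a + 2 * sqrt b) * r)))" for r
  have G0: "0 < G" unfolding G_def using \<nu> by (intro rGamma_real_pos) linarith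
  have tt: "t x k * r ^ (2 * k) = (- x * r\<^sup>2) ^ k / fact k * rGamma (\<nu> + real k + 1)" for x k r
    by (simp add: t_def power_mult_distrib[symmetric] power_mult)
  have sm: "summable (\<lambda>k. norm (t x k * r ^ (2 * k)))" for x r
    unfolding tt by (rule summable_bessel_entire[OF \<nu>])
  have su: "(\<Sum>k. t x k * r ^ (2 * k)) = bessel_entire \<nu> (- x * r\<^sup>2)" for x r
    unfolding tt bessel_entire_def ..
  have sn: "(\<Sum>k. norm (t x k * r ^ (2 * k))) \<le> G * exp (2 * sqrt x * r)" if "0 \<le> x" "0 \<le> r" for x r
    using suminf_norm_bessel_entire[OF \<nu>, of "- x * r\<^sup>2"] that
    unfolding tt by (simp add: G_def abs_mult real_sqrt_mult mult_ac)
  have cr: "c N * r ^ (2 * N) = (\<Sum>k\<le>N. (t a k * r ^ (2 * k)) * (t b (N - k) * r ^ (2 * (N - k))))" for N r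
    unfolding c_def sum_distrib_right
  proof (rule sum.cong[OF refl])
    fix k assume "k \<in> {..N}"
    then have "2 * N = 2 * k + 2 * (N - k)" by simp
    then have "r ^ (2 * N) = r ^ (2 * k) * r ^ (2 * (N - k))" by (metis power_add)
    then show "t a k * t b (N - k) * r ^ (2 * N) = t a k * r ^ (2 * k) * (t b (N - k) * r ^ (2 * (N - k)))"
      by simp
  qed
  have csums: "(\<lambda>N. c N * r ^ (2 * N)) sums (bessel_entire \<nu> (- a * r\<^sup>2) * bessel_entire \<nu> (- b * r\<^sup>2))" for r
    using Cauchy_product_sums[OF sm[of a r] sm[of b r]] unfolding cr su .
  \<comment> \<open>Absolute values are taken before grouping, so the bound does not depend on the
    number of terms; the exponentials come from the norm bound of the Bessel series at -a r^2 and -b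
    r^2.\<close>
  have cbound: "\<bar>\<Sum>N<M. c N * r ^ (2 * N)\<bar> \<le> G\<^sup>2 * exp ((2 * sqrt a + 2 * sqrt b) * r)" if "0 \<le> r" for M r
  proof -
    let ?C = "\<lambda>N. \<Sum>k\<le>N. norm (t a k * r ^ (2 * k)) * norm (t b (N - k) * r ^ (2 * (N - k)))"
    have S: "?C sums ((\<Sum>k. norm (t a k * r ^ (2 * k))) * (\<Sum>k. norm (t b k * r ^ (2 * k))))"
      by (rule Cauchy_product_sums) (use sm in simp_all)
    have "\<bar>\<Sum>N<M. c N * r ^ (2 * N)\<bar> \<le> (\<Sum>N<M. ?C N)"
      unfolding cr real_norm_def[symmetric]
      by (intro order_trans[OF norm_sum] sum_mono) (simp add: abs_mult)
    also have "\<dots> \<le> (\<Sum>k. norm (t a k * r ^ (2 * k))) * (\<Sum>k. norm (t b k * r ^ (2 * k)))"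
      unfolding sums_unique[OF S] by (rule sum_le_suminf) (use S in \<open>auto simp: sums_iff intro!: sum_nonneg\<close>)
    also have "\<dots> \<le> (G * exp (2 * sqrt a * r)) * (G * exp (2 * sqrt b * r))"
      using sn[OF a that] sn[OF b that] G0 by (intro mult_mono suminf_nonneg sm) auto
    also have "\<dots> = G\<^sup>2 * exp ((2 * sqrt a + 2 * sqrt b) * r)"
      by (simp add: power2_eq_square exp_add[symmetric] distrib_right)
    finally show ?thesis .
  qed
  have Pint: "has_bochner_integral lborel (P M)
     (1 / (2 * s powr (\<nu> + 1)) * (\<Sum>N<M. Gamma (\<nu> + real N + 1) * (\<Sum>k\<le>N. t (a / s) k * t (b / s) (N - k))))" for M
  proof -
    \<comment> \<open>The powers of s in the moments are absorbed by rescaling a and b to a/s and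
      b/s, which brings the sum into the form of \<open>weber_series\<close>.\<close>
    have c': "(\<Sum>k\<le>N. t (a / s) k * t (b / s) (N - k)) = c N / s ^ N" for N
      unfolding c_def sum_divide_distrib
    proof (rule sum.cong[OF refl])
      fix k assume "k \<in> {..N}"
      then have "s ^ N = s ^ k * s ^ (N - k)" by (simp flip: power_add)
      moreover have "(- (x / s)) ^ k = (- x) ^ k / s ^ k" for x k
        by (metis minus_divide_left power_divide)
      ultimately show "t (a / s) k * t (b / s) (N - k) = t a k * t b (N - k) / s ^ N"
        by (simp add: t_def)
    qed
    have one: "has_bochner_integral lborel (\<lambda>r. g r * (c N * r ^ (2 * N)))
       (c N * (Gamma (\<nu> + real N + 1) / (2 * s powr (\<nu> + real N + 1))))" for N
    proof -
      define p where "p = 2 * \<nu> + 1 + real (2 * N)"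
      have p: "(p + 1) / 2 = \<nu> + real N + 1" by (simp add: p_def field_simps)
      have "- 1 < p" using \<nu> unfolding p_def by linarith
      from has_bochner_integral_mult_right[OF has_bochner_integral_powr_gauss[OF this s], of "c N"]
      have "has_bochner_integral lborel (\<lambda>r. c N * (indicator {0<..} r * (r powr p * exp (- s * r\<^sup>2))))
       (c N * (Gamma (\<nu> + real N + 1) / (2 * s powr (\<nu> + real N + 1))))"
        unfolding p .
      moreover have "c N * (indicator {0<..} r * (r powr p * exp (- s * r\<^sup>2))) = g r * (c N * r ^ (2 * N))" for r
      proof (cases "0 < r")
        case True
        then have "r powr p = r powr (2 * \<nu> + 1) * r ^ (2 * N)"
          unfolding p_def powr_add by (simp only: powr_realpow)
        then show ?thesis using True by (simp add: g_def mult_ac)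
      qed (simp add: g_def)
      ultimately show ?thesis by (simp only:)
    qed
    have "has_bochner_integral lborel (\<lambda>r. \<Sum>N<M. g r * (c N * r ^ (2 * N)))
       (\<Sum>N<M. c N * (Gamma (\<nu> + real N + 1) / (2 * s powr (\<nu> + real N + 1))))"
      by (rule has_bochner_integral_sum) (rule one)
    moreover have "c N * (Gamma (\<nu> + real N + 1) / (2 * s powr (\<nu> + real N + 1)))
       = 1 / (2 * s powr (\<nu> + 1)) * (Gamma (\<nu> + real N + 1) * (c N / s ^ N))" for N
    proof -
      have "s powr (\<nu> + real N + 1) = s powr (\<nu> + 1) * s ^ N"
        using s by (simp add: powr_add powr_realpow)
      then show ?thesis by (simp add: mult_ac)
    qed
    ultimately show ?thesis
      unfolding P_def c' by (simp add: sum_distrib_left)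
  qed
  have [measurable]: "g \<in> borel_measurable borel" unfolding g_def by measurable
  have Fm: "F \<in> borel_measurable lborel" unfolding F_def by measurable
  have Pm: "P M \<in> borel_measurable lborel" for M unfolding P_def by measurable
  have Wi: "integrable lborel W"
    unfolding W_def using \<nu> s by (intro integrable_mult_right integrable_powr_gauss_exp) auto
  have conv: "AE r in lborel. (\<lambda>M. P M r) \<longlonglongrightarrow> F r"
    using csums unfolding sums_def P_def F_def by (intro AE_I2 tendsto_mult_left) auto
  have dom: "AE r in lborel. norm (P M r) \<le> W r" for M
  proof (rule AE_I2)
    fix r
    show "norm (P M r) \<le> W r"
    proof (cases "0 < r")
      case True
      have "norm (P M r) = g r * \<bar>\<Sum>N<M. c N * r ^ (2 * N)\<bar>"
        by (simp add: P_def g_def abs_mult)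
      also have "\<dots> \<le> g r * (G\<^sup>2 * exp ((2 * sqrt a + 2 * sqrt b) * r))"
        using True by (intro mult_left_mono cbound) (auto simp: g_def)
      finally show ?thesis using True by (simp add: W_def g_def mult_ac)
    qed (simp add: P_def g_def W_def)
  qed
  have "(\<lambda>M. integral\<^sup>L lborel (P M)) \<longlonglongrightarrow> integral\<^sup>L lborel F"
    by (rule integral_dominated_convergence[OF Fm Pm Wi conv dom])
  moreover have "(\<lambda>M. integral\<^sup>L lborel (P M)) \<longlonglongrightarrow> 1 / (2 * s powr (\<nu> + 1)) *
      (exp (- (a / s + b / s)) * bessel_entire \<nu> (a / s * (b / s)))"
    unfolding Pint[THEN has_bochner_integral_integral_eq]
    by (rule tendsto_mult_left)
      (rule weber_series[OF \<nu>, of "a / s" "b / s", folded t_def, unfolded sums_def])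
  ultimately have "integral\<^sup>L lborel F = 1 / (2 * s powr (\<nu> + 1)) *
      (exp (- (a / s + b / s)) * bessel_entire \<nu> (a / s * (b / s)))"
    by (rule LIMSEQ_unique)
  moreover have "integrable lborel F"
    by (rule integrable_dominated_convergence[OF Fm Pm Wi conv dom])
  ultimately have "has_bochner_integral lborel F (exp (- (a + b) / s) * bessel_entire \<nu> (a * b / s\<^sup>2) / (2 * s powr (\<nu> + 1)))"
    by (simp add: has_bochner_integral_iff power2_eq_square add_divide_distrib diff_divide_distrib)
  then show ?thesis
    unfolding F_def g_def by (simp only: mult.assoc)
qed

section \<open>Growth of the zonal kernels\<close>

text \<open>Links the index \<mu> with \<mu> + 1. The induction compares the derivative recurrence
  at \<mu> with the three-term recurrence at \<mu> + 1, both multiplied by i - 1 to avoid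
  division.\<close>

lemma gegz_deriv: "pderiv (gegz \<mu> i) = smult (2 * \<mu>) (gegz (\<mu> + 1) (i - 1))"
proof (induction "nat i" arbitrary: i rule: less_induct)
  case less
  consider "i \<le> 0" | "i = 1" | "2 \<le> i" by linarith
  then show ?case
  proof cases
    case 1
    then have "gegz (\<mu> + 1) (i - 1) = 0" "pderiv (gegz \<mu> i) = 0"
      by (auto simp: gegz_def)
    then show ?thesis by (simp only: smult_0_right)
  next
    case 2
    then show ?thesis by (simp add: gegz_def pderiv_pCons)
  next
    case 3
    define N where "N = real_of_int (i - 1)"
    have N: "0 < N" "real_of_int i = N + 1" "real_of_int (i - 3) = N - 2" using 3 by (simp_all add: N_def)
    have r: "smult N (gegz (\<mu> + 1) (i - 1)) = smult (2 * (N + \<mu>)) (pCons 0 (gegz (\<mu> + 1) (i - 2)))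
        - smult (N + 2 * \<mu>) (gegz (\<mu> + 1) (i - 3))"
    proof -
      have e: "i - 3 + 2 = i - 1" "i - 3 + 1 = i - 2" "real_of_int (i - 1) = N"
        "N - 2 + 1 + (\<mu> + 1) = N + \<mu>" "N - 2 + 2 * (\<mu> + 1) = N + 2 * \<mu>"
        by (simp_all add: N_def)
      show ?thesis using gegz_rec[of "i - 3" "\<mu> + 1"] unfolding N(3) e .
    qed
    have 1: "pderiv (gegz \<mu> (i - 1)) = smult (2 * \<mu>) (gegz (\<mu> + 1) (i - 2))"
      and 2: "pderiv (gegz \<mu> (i - 2)) = smult (2 * \<mu>) (gegz (\<mu> + 1) (i - 3))"
    proof -
      have n: "nat (i - 1) < nat i" "nat (i - 2) < nat i"
        and e: "i - 1 - 1 = i - 2" "i - 2 - 1 = i - 3" using 3 by simp_all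
      show "pderiv (gegz \<mu> (i - 1)) = smult (2 * \<mu>) (gegz (\<mu> + 1) (i - 2))"
        by (rule less[OF n(1), unfolded e])
      show "pderiv (gegz \<mu> (i - 2)) = smult (2 * \<mu>) (gegz (\<mu> + 1) (i - 3))"
        by (rule less[OF n(2), unfolded e])
    qed
    have a: "pderiv (gegz \<mu> i) = smult (2 * (N + \<mu>)) (gegz \<mu> (i - 1)) + pderiv (gegz \<mu> (i - 2))"
      using gegz_deriv_rec[of \<mu> i] unfolding N(2) add_diff_cancel_right' .
    have b: "pCons 0 (pderiv (gegz \<mu> (i - 1))) = smult N (gegz \<mu> (i - 1)) + pderiv (gegz \<mu> (i - 2))"
      using gegz_deriv_mult[of \<mu> "i - 1"] by (simp add: N_def)
    have "smult N (pderiv (gegz \<mu> i)) = smult (2 * (N + \<mu>)) (smult N (gegz \<mu> (i - 1))) + smult N (pderiv (gegz \<mu> (i - 2)))"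
      unfolding a by (simp add: smult_add_right mult.commute)
    also have "smult N (gegz \<mu> (i - 1)) = pCons 0 (pderiv (gegz \<mu> (i - 1))) - pderiv (gegz \<mu> (i - 2))"
      unfolding b by simp
    also have "smult (2 * (N + \<mu>)) (pCons 0 (pderiv (gegz \<mu> (i - 1))) - pderiv (gegz \<mu> (i - 2))) + smult N (pderiv (gegz \<mu> (i - 2)))
        = smult (2 * \<mu>) (smult N (gegz (\<mu> + 1) (i - 1)))"
      unfolding r 1 2 by (rule poly_eqI) (simp add: algebra_simps coeff_pCons split: nat.split)
    also have "\<dots> = smult N (smult (2 * \<mu>) (gegz (\<mu> + 1) (i - 1)))"
      by (simp add: mult.commute)
    finally have *: "smult N (pderiv (gegz \<mu> i)) = smult N (smult (2 * \<mu>) (gegz (\<mu> + 1) (i - 1)))" .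
    show ?thesis by (rule smult_left_cancel[OF _ *]) (rule less_imp_neq[OF N(1), symmetric])
  qed
qed

text \<open>Both derivative recurrences, read at \<open>w\<close>, contain a common factor \<mu>
  once derivatives are rewritten with the index \<mu> + 1. Cancelling it leaves expressions
  continuous at \<mu> = 0, so the limit prescribed there is a plain evaluation.\<close>

lemma gegenbauer_shift:
  assumes "\<mu> \<noteq> 0"
  shows "(real k + 2 * \<mu>) / (2 * \<mu>) * gegenbauer k \<mu> w
      = poly (gegz (\<mu> + 1) (int k)) w - w * poly (gegz (\<mu> + 1) (int k - 1)) w"
    and "real k / \<mu> * gegenbauer k \<mu> w
      = 2 * (w * poly (gegz (\<mu> + 1) (int k - 1)) w - poly (gegz (\<mu> + 1) (int k - 2)) w)"
proof -
  define C where "C = gegenbauer k \<mu> w"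
  define U where "U i = poly (gegz (\<mu> + 1) i) w" for i
  have C: "poly (gegz \<mu> (int k)) w = C"
    by (simp only: C_def gegz_of_nat poly_geg_poly)
  have D: "poly (pderiv (gegz \<mu> i)) w = 2 * \<mu> * U (i - 1)" for i
    by (simp only: gegz_deriv poly_smult U_def)
  have e: "int k - 1 - 1 = int k - 2" "int k + 1 - 1 = int k" "int k + 1 - 2 - 1 = int k - 2"
    "real_of_int (int k) = real k" "real_of_int (int k + 1) = real k + 1"
    by simp_all
  have "w * (2 * \<mu> * U (int k - 1)) = real k * C + 2 * \<mu> * U (int k - 2)"
    using arg_cong[OF gegz_deriv_mult[of \<mu> "int k"], of "\<lambda>p. poly p w"]
    unfolding poly_pCons poly_smult poly_add D C e by linarith
  then have 1: "real k * C = \<mu> * (2 * (w * U (int k - 1) - U (int k - 2)))"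
    by (simp add: algebra_simps)
  have "2 * \<mu> * U (int k) = 2 * (real k + \<mu>) * C + 2 * \<mu> * U (int k - 2)"
    using arg_cong[OF gegz_deriv_rec[of \<mu> "int k + 1"], of "\<lambda>p. poly p w"]
    unfolding poly_smult poly_add D e C by simp
  with 1 have 2: "(real k + 2 * \<mu>) * C = (2 * \<mu>) * (U (int k) - w * U (int k - 1))"
    by (simp add: algebra_simps)
  show "(real k + 2 * \<mu>) / (2 * \<mu>) * gegenbauer k \<mu> w
      = poly (gegz (\<mu> + 1) (int k)) w - w * poly (gegz (\<mu> + 1) (int k - 1)) w"
    unfolding C_def[symmetric] U_def[symmetric] times_divide_eq_left 2 using assms by simp
  show "real k / \<mu> * gegenbauer k \<mu> w
      = 2 * (w * poly (gegz (\<mu> + 1) (int k - 1)) w - poly (gegz (\<mu> + 1) (int k - 2)) w)"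
    unfolding C_def[symmetric] U_def[symmetric] times_divide_eq_left 1 using assms by simp
qed

lemma isCont_gegenbauer: "isCont (\<lambda>\<mu>. gegenbauer k (\<mu> + 1) w) (\<mu> :: real)"
proof (induction k rule: less_induct)
  case (less k)
  show ?case
  proof (cases k)
    case (Suc n)
    show ?thesis
    proof (cases n)
      case (Suc l)
      then have "isCont (\<lambda>\<mu>. gegenbauer (Suc l) (\<mu> + 1) w) \<mu>" "isCont (\<lambda>\<mu>. gegenbauer l (\<mu> + 1) w) \<mu>"
        using less \<open>k = Suc n\<close> by auto
      then show ?thesis
        unfolding \<open>k = Suc n\<close> Suc gegenbauer.simps by (intro continuous_intros) auto
    qed (simp add: Suc)
  qed simp
qed

lemma isCont_gegz: "isCont (\<lambda>\<mu>. poly (gegz (\<mu> + 1) i) w) (\<mu> :: real)"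
proof (cases "i < 0")
  case False
  then have "poly (gegz (\<mu> + 1) i) w = gegenbauer (nat i) (\<mu> + 1) w" for \<mu>
    by (simp only: gegz_def if_False poly_geg_poly)
  then show ?thesis by (simp only: isCont_gegenbauer)
qed (simp only: gegz_neg poly_0 continuous_const)

lemma value_or_limit_eq:
  assumes "\<And>\<mu>. \<mu> \<noteq> 0 \<Longrightarrow> f \<mu> = g \<mu>" "isCont g 0"
  shows "value_or_limit f \<mu> = g \<mu>"
proof (cases "\<mu> = 0")
  case True
  have "(g \<longlongrightarrow> g 0) (at 0)" using assms(2) by (simp add: isCont_def)
  moreover have "\<forall>\<^sub>F \<mu> in at 0. g \<mu> = f \<mu>" using assms(1) by (auto simp: eventually_at_filter)
  ultimately have "(f \<longlongrightarrow> g 0) (at 0)" by (rule Lim_transform_eventually)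
  then show ?thesis using True by (simp add: value_or_limit_def tendsto_Lim)
qed (simp add: value_or_limit_def assms)

lemma gegP_eq: "gegP k lam w = poly (gegz (lam + 1) (int k)) w - w * poly (gegz (lam + 1) (int k - 1)) w"
  unfolding gegP_def
  by (rule value_or_limit_eq, erule gegenbauer_shift) (intro continuous_intros isCont_gegz)

lemma gegQ_eq: "gegQ k lam w = 2 * (w * poly (gegz (lam + 1) (int k - 1)) w - poly (gegz (lam + 1) (int k - 2)) w)"
  unfolding gegQ_def
  by (rule value_or_limit_eq, erule gegenbauer_shift) (intro continuous_intros isCont_gegz)

text \<open>The recurrence coefficients add up to 3n + 2 + 4\<mu>, at most (n + 2)(3 + 4\<mu>). The
  rate is far from sharp but suffices against super-geometric decay; for \<mu> = m/2 it is 3 +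
  2m.\<close>

lemma abs_gegenbauer_le:
  assumes "0 \<le> \<mu>" "\<bar>w\<bar> \<le> 1"
  shows "\<bar>gegenbauer k \<mu> w\<bar> \<le> (3 + 4 * \<mu>) ^ k"
proof (induction k rule: less_induct)
  case (less k)
  consider "k = 0" | "k = 1" | n where "k = Suc (Suc n)"
    by (metis One_nat_def not0_implies_Suc)
  then show ?case
  proof cases
    case 2
    have "\<bar>2 * \<mu> * w\<bar> \<le> 2 * \<mu> * 1"
      using assms unfolding abs_mult by (intro mult_mono) auto
    then show ?thesis using 2 assms by simp
  next
    case (3 n)
    define g1 g0 R where "g1 = gegenbauer (Suc n) \<mu> w" and "g0 = gegenbauer n \<mu> w" and "R = 3 + 4 * \<mu>"
    have R: "1 \<le> R" using assms by (simp add: R_def)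
    have 1: "\<bar>g1\<bar> \<le> R ^ Suc n" and 0: "\<bar>g0\<bar> \<le> R ^ Suc n"
      using less[of "Suc n"] less[of n] 3 power_increasing[OF _ R, of n "Suc n"]
      unfolding g1_def g0_def R_def by (auto intro: order_trans)
    define X where "X = 2 * (real n + 1 + \<mu>) * w * g1 - (real n + 2 * \<mu>) * g0"
    have "\<bar>X\<bar>
       \<le> \<bar>2 * (real n + 1 + \<mu>) * w * g1\<bar> + \<bar>(real n + 2 * \<mu>) * g0\<bar>"
      unfolding X_def by (rule abs_triangle_ineq4)
    also have "\<dots> = 2 * (real n + 1 + \<mu>) * (\<bar>w\<bar> * \<bar>g1\<bar>) + (real n + 2 * \<mu>) * \<bar>g0\<bar>"
      using assms by (simp add: abs_mult)
    also have "\<dots> \<le> 2 * (real n + 1 + \<mu>) * (1 * R ^ Suc n) + (real n + 2 * \<mu>) * R ^ Suc n"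
      using assms 0 1 by (intro add_mono mult_left_mono mult_mono) auto
    also have "\<dots> = (3 * real n + 2 + 4 * \<mu>) * R ^ Suc n"
      by (simp only: mult_1 distrib_right[symmetric]) (simp add: algebra_simps)
    also have "\<dots> \<le> (real n + 2) * R * R ^ Suc n"
      using assms by (intro mult_right_mono) (auto simp: R_def algebra_simps)
    finally have "\<bar>X\<bar> \<le> (real n + 2) * (R * R ^ Suc n)" by (simp only: mult.assoc)
    then have "\<bar>X\<bar> / (real n + 2) \<le> R ^ k"
      unfolding 3 power_Suc[of R "Suc n"] by (simp add: pos_divide_le_eq mult.commute)
    moreover have "gegenbauer k \<mu> w = X / (real n + 2)"
      unfolding 3 gegenbauer.simps X_def g1_def g0_def ..
    ultimately show ?thesis by (simp add: R_def)
  qed simp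
qed

lemma abs_gegz_le:
  assumes "0 \<le> \<mu>" "\<bar>w\<bar> \<le> 1" "i \<le> int k"
  shows "\<bar>poly (gegz \<mu> i) w\<bar> \<le> (3 + 4 * \<mu>) ^ k"
proof (cases "i < 0")
  case False
  have "\<bar>poly (gegz \<mu> i) w\<bar> \<le> (3 + 4 * \<mu>) ^ nat i"
    using abs_gegenbauer_le[OF assms(1,2), of "nat i"] False by (simp add: gegz_def poly_geg_poly)
  also have "\<dots> \<le> (3 + 4 * \<mu>) ^ k"
    using assms by (intro power_increasing) auto
  finally show ?thesis .
qed (use assms in \<open>simp add: gegz_neg\<close>)

lemma norm_axis_eq: "norm (axis i x :: ('a::real_normed_vector, 'n::finite) vec) = norm x"
proof -
  have "(\<Sum>j\<in>UNIV. (norm ((axis i x :: ('a, 'n) vec) $ j))\<^sup>2) = (\<Sum>j\<in>UNIV. if j = i then (norm x)\<^sup>2 else 0)"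
    by (rule sum.cong) (auto simp: axis_def)
  then show ?thesis by (simp add: norm_vec_def L2_set_def)
qed

lemma norm_zonal_le:
  obtains K where "0 < K" and "\<And>n \<eta> \<xi> :: (real, 'n::{finite,linorder}) vec. norm \<eta> = 1 \<Longrightarrow> norm \<xi> = 1 \<Longrightarrow>
     norm (zonal n \<eta> \<xi>) \<le> K * (3 + 2 * real CARD('n)) ^ nat \<bar>n\<bar>"
proof -
  obtain B where B: "0 < B" "\<And>u v :: 'n cclifford. norm (u \<star> v) \<le> norm u * norm v * B"
    using bounded_bilinear.pos_bounded[OF bounded_bilinear_cl_mult] by blast
  define c where "c = real CARD('n)"
  have cv: "norm (cl_vec x) \<le> c" if "norm x = 1" for x :: "(real, 'n) vec"
  proof -
    have "norm (cl_vec x) \<le> (\<Sum>i\<in>UNIV. norm ((x $ i) *\<^sub>R (cl_gen i :: 'n cclifford)))"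
      unfolding cl_vec_def by (rule norm_sum)
    also have "\<dots> \<le> (\<Sum>i\<in>(UNIV :: 'n set). 1)"
      using component_le_norm_cart[of x] that by (intro sum_mono) (auto simp: cl_gen_def norm_axis_eq)
    finally show ?thesis by (simp add: c_def)
  qed
  show ?thesis
  proof (rule that[of "norm (cl_one :: 'n cclifford) + c * c * B + 1"])
    have c: "0 \<le> c * c * B" using B(1) by (simp add: c_def)
    then show "0 < norm (cl_one :: 'n cclifford) + c * c * B + 1"
      by (simp add: add_nonneg_pos)
    fix n :: int and \<eta> \<xi> :: "(real, 'n) vec"
    assume u: "norm \<eta> = 1" "norm \<xi> = 1"
    define R where "R = (3 + 2 * c) ^ nat \<bar>n\<bar>"
    have w: "\<bar>\<eta> \<bullet> \<xi>\<bar> \<le> 1" using Cauchy_Schwarz_ineq2[of \<eta> \<xi>] u by simp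
    have R0: "0 \<le> R" by (simp add: R_def c_def)
    have g: "\<bar>poly (gegz (c / 2) i) (\<eta> \<bullet> \<xi>)\<bar> \<le> R" if "i \<le> \<bar>n\<bar>" for i
      using abs_gegz_le[OF _ w, of "c / 2" i "nat \<bar>n\<bar>"] that by (simp add: R_def c_def)
    have m: "norm (cl_vec \<xi> \<star> cl_vec \<eta>) \<le> c * c * B"
      using B(1) cv[OF u(1)] cv[OF u(2)] by (intro order_trans[OF B(2)] mult_mono) (auto simp: c_def)
    have "norm (zonal n \<eta> \<xi>) \<le> \<bar>poly (gegz (c / 2) (\<bar>n + 1\<bar> - 1)) (\<eta> \<bullet> \<xi>)\<bar> * norm (cl_one :: 'n cclifford)
       + \<bar>poly (gegz (c / 2) (\<bar>n\<bar> - 1)) (\<eta> \<bullet> \<xi>)\<bar> * norm (cl_vec \<xi> \<star> cl_vec \<eta>)"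
      unfolding zonal_def c_def[symmetric] norm_scaleR by (auto intro!: order_trans[OF norm_triangle_ineq])
    also have "\<dots> \<le> R * norm (cl_one :: 'n cclifford) + R * (c * c * B)"
      using m R0 by (intro add_mono mult_mono g) auto
    also have "\<dots> \<le> (norm (cl_one :: 'n cclifford) + c * c * B + 1) * R"
      using R0 by (simp add: algebra_simps)
    finally show "norm (zonal n \<eta> \<xi>) \<le> (norm (cl_one :: 'n cclifford) + c * c * B + 1) * (3 + 2 * real CARD('n)) ^ nat \<bar>n\<bar>"
      by (simp add: R_def c_def)
  qed
qed

text \<open>Returns to the basis in which the kernels are given. The sign of the bivector comes from
  the reversed order of the factors \<open>\<xi>\<close> and \<open>\<eta>\<close> in
  \<open>zonal\<close>.\<close>

lemma zonal_of_nat: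
  fixes \<eta> \<xi> :: "(real, 'n::{finite,linorder}) vec"
  assumes "2 \<le> CARD('n)"
  defines "w \<equiv> \<eta> \<bullet> \<xi>" and "lam \<equiv> param_lambda CARD('n)"
  shows "zonal (int k) \<eta> \<xi> = gegP k lam w *\<^sub>R cl_one - poly (gegz (lam + 1) (int k - 1)) w *\<^sub>R cl_wedge \<eta> \<xi>"
    and "0 < k \<Longrightarrow> zonal (- int k) \<eta> \<xi> = (gegQ k lam w / 2) *\<^sub>R cl_one + poly (gegz (lam + 1) (int k - 1)) w *\<^sub>R cl_wedge \<eta> \<xi>"
proof -
  have l: "real CARD('n) / 2 = lam + 1"
    by (simp add: lam_def param_lambda_def field_simps)
  have m: "cl_vec \<xi> \<star> cl_vec \<eta> = - cl_wedge \<eta> \<xi> - w *\<^sub>R cl_one"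
    unfolding cl_vec_mult w_def by (subst cl_wedge_commute) (simp add: inner_commute)
  show "zonal (int k) \<eta> \<xi> = gegP k lam w *\<^sub>R cl_one - poly (gegz (lam + 1) (int k - 1)) w *\<^sub>R cl_wedge \<eta> \<xi>"
    unfolding zonal_def l m gegP_eq w_def[symmetric]
    by (simp add: scaleR_diff_right scaleR_diff_left mult.commute)
  assume k: "0 < k"
  then have i: "\<bar>- int k + 1\<bar> - 1 = int k - 2" by simp
  show "zonal (- int k) \<eta> \<xi> = (gegQ k lam w / 2) *\<^sub>R cl_one + poly (gegz (lam + 1) (int k - 1)) w *\<^sub>R cl_wedge \<eta> \<xi>"
    unfolding zonal_def l m gegQ_eq i w_def[symmetric] using k
    by (simp add: scaleR_diff_right scaleR_diff_left mult.commute diff_divide_distrib)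
qed

section \<open>Convergence of the kernel series\<close>

text \<open>Restrict Euler's integral for Gamma to u >= T and bound u^p from below by T^p there. For
  real p this replaces the comparison of a single term with the exponential series.\<close>

lemma powr_le_exp_Gamma:
  fixes T p :: real
  assumes "0 < T" "0 \<le> p"
  shows "T powr p * rGamma (p + 1) \<le> exp T"
proof -
  have G: "0 < Gamma (p + 1)" using assms by (intro Gamma_real_pos) auto
  have I: "((\<lambda>u. u powr p / exp u) has_integral Gamma (p + 1)) {0..}"
    using Gamma_integral_real[of "p + 1"] assms by simp
  have "((\<lambda>u. exp (- 1 * u)) has_integral exp (- 1 * T) / 1) {T..}"
    by (rule has_integral_exp_minus_to_infinity) simp
  then have "((\<lambda>u. T powr p * exp (- u)) has_integral T powr p * exp (- T)) {T..}"
    by (intro has_integral_mult_right) simp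
  then have J: "((\<lambda>u. if u \<in> {T..} then T powr p * exp (- u) else 0) has_integral T powr p * exp (- T)) {0..}"
    using assms by (subst has_integral_restrict) auto
  have "T powr p * exp (- T) \<le> Gamma (p + 1)"
    using assms by (intro has_integral_le[OF J I]) (auto simp: exp_minus divide_inverse intro!: powr_mono2)
  then show ?thesis
    using G by (simp add: rGamma_inverse_Gamma exp_minus field_simps)
qed

text \<open>The free parameter \<open>M\<close> buys any geometric rate of decay in \<beta>, paid
  for by a faster exponential in t. The base t + 1 exceeds 1, so the exponent may be raised to \<nu>
  + \<beta> + 1; one step of the Gamma recurrence makes the argument fit and produces the linear
  factor.\<close>

lemma bessel_coeff_bound:
  assumes \<nu>: "- 1 / 2 \<le> \<nu>" and \<beta>: "0 \<le> \<beta>" and M: "1 \<le> M" and t: "0 < t" and q: "\<bar>q\<bar> = t\<^sup>2 / 4"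
  shows "\<bar>(t / 2) powr \<beta> * bessel_entire (\<nu> + \<beta>) q\<bar> \<le> (\<nu> + \<beta> + 1) * M powr (- \<beta>) * exp (M * (t + 1) + t)"
proof -
  define \<kappa> where "\<kappa> = \<nu> + \<beta>"
  have \<kappa>: "- 1 / 2 \<le> \<kappa>" "\<beta> \<le> \<kappa> + 1" using \<nu> \<beta> by (auto simp: \<kappa>_def)
  have sq: "2 * sqrt \<bar>q\<bar> = t"
    unfolding q using t by (simp add: real_sqrt_divide)
  have rg: "rGamma (\<kappa> + 1) = (\<kappa> + 1) * rGamma (\<kappa> + 1 + 1)"
    by (rule rGamma_plus1[symmetric])
  have rp: "0 < rGamma (\<kappa> + 1 + 1)" using \<kappa> by (intro rGamma_real_pos) linarith
  have "(t / 2) powr \<beta> \<le> (t + 1) powr \<beta>"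
    using t \<beta> by (intro powr_mono2) auto
  also have "\<dots> \<le> (t + 1) powr (\<kappa> + 1)"
    using t \<kappa> by (intro powr_mono) auto
  also have "\<dots> = (t + 1) powr (\<kappa> + 1) * (M powr (\<kappa> + 1) * M powr (- (\<kappa> + 1)))"
    using M by (simp flip: powr_add)
  also have "\<dots> = (M * (t + 1)) powr (\<kappa> + 1) * M powr (- (\<kappa> + 1))"
    using M t by (simp only: powr_mult mult_ac)
  also have "\<dots> \<le> (M * (t + 1)) powr (\<kappa> + 1) * M powr (- \<beta>)"
    using M \<kappa> by (intro mult_left_mono powr_mono) auto
  finally have 1: "(t / 2) powr \<beta> \<le> (M * (t + 1)) powr (\<kappa> + 1) * M powr (- \<beta>)" .
  have "\<bar>(t / 2) powr \<beta> * bessel_entire \<kappa> q\<bar> \<le> (t / 2) powr \<beta> * (rGamma (\<kappa> + 1) * exp t)"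
    using abs_bessel_entire_le[OF \<kappa>(1), of q] unfolding sq abs_mult by (intro mult_mono) auto
  also have "\<dots> \<le> ((M * (t + 1)) powr (\<kappa> + 1) * M powr (- \<beta>)) * (rGamma (\<kappa> + 1) * exp t)"
    using 1 rp \<kappa> unfolding rg by (intro mult_right_mono) auto
  also have "\<dots> = (\<kappa> + 1) * M powr (- \<beta>) * ((M * (t + 1)) powr (\<kappa> + 1) * rGamma (\<kappa> + 1 + 1)) * exp t"
    unfolding rg by (simp only: mult_ac)
  also have "\<dots> \<le> (\<kappa> + 1) * M powr (- \<beta>) * exp (M * (t + 1)) * exp t"
    using M t \<kappa> by (intro mult_right_mono mult_left_mono powr_le_exp_Gamma) auto
  finally show ?thesis
    unfolding \<kappa>_def by (simp add: exp_add mult.assoc)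
qed

text \<open>One integer index for both Bessel families of the kernels: n = k >= 0 gives the order
  \<gamma>_k/2 - 1, and n = -k < 0 gives \<gamma>_(k-1)/2.\<close>

definition bessel_index :: "nat \<Rightarrow> real \<Rightarrow> int \<Rightarrow> real" where
  "bessel_index m c n = (if 0 \<le> n then param_gamma m c n / 2 - 1 else param_gamma m c (- n - 1) / 2)"

definition bessel_shift :: "nat \<Rightarrow> real \<Rightarrow> real" where
  "bessel_shift m c = (param_delta m c - 2) / 2"

definition radial_exponent :: "real \<Rightarrow> int \<Rightarrow> real" where
  "radial_exponent c n = (if 0 \<le> n then of_int n / (1 + c) else (c - of_int n) / (1 + c))"

lemma radial_exponent_neg:
  assumes "- 1 < c" "n < 0"
  shows "radial_exponent c n = 1 - (1 + of_int n) * (1 / (1 + c))"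
  using assms by (simp add: radial_exponent_def field_simps)

text \<open>The order is a shift common to all n plus the exponent with which \<zeta> occurs in the
  n-th coefficient. The prefactor of the kernels removes the shift, leaving a nonnegative power
  times an entire function.\<close>

lemma bessel_index_eq:
  assumes "- 1 < c"
  shows "bessel_index m c n = bessel_shift m c + radial_exponent c n"
proof -
  define a where "a = 1 / (1 + c)"
  have a: "x / (1 + c) = x * a" for x by (simp add: a_def)
  have g: "(c + 2) / (1 + c) = 1 + a"
    using assms by (simp add: a_def field_simps)
  show ?thesis
  proof (cases "0 \<le> n")
    case True
    then show ?thesis
      unfolding bessel_index_def bessel_shift_def radial_exponent_def param_gamma_def param_delta_def g
      unfolding a by (simp add: field_simps)
  next
    case False
    then have r: "radial_exponent c n = 1 - (1 + of_int n) * a"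
      using radial_exponent_neg[OF assms, of n] by (simp add: a_def)
    show ?thesis
      using False unfolding r bessel_index_def bessel_shift_def param_gamma_def param_delta_def g
      unfolding a by (simp add: field_simps)
  qed
qed

lemma bessel_shift_ge:
  assumes "2 \<le> m" "- 1 < c"
  shows "- 1 / 2 \<le> bessel_shift m c"
  using assms by (simp add: bessel_shift_def param_delta_def)

lemma radial_exponent_bounds:
  assumes "- 1 < c"
  shows "0 \<le> radial_exponent c n" "(\<bar>of_int n\<bar> - 1) / (1 + c) \<le> radial_exponent c n"
    "radial_exponent c n \<le> 1 + \<bar>of_int n\<bar> / (1 + c)"
proof -
  define a where "a = 1 / (1 + c)"
  have a: "x / (1 + c) = x * a" for x by (simp add: a_def)
  have a0: "0 < a" using assms by (simp add: a_def)
  have "0 \<le> radial_exponent c n \<and> (\<bar>of_int n\<bar> - 1) / (1 + c) \<le> radial_exponent c n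
    \<and> radial_exponent c n \<le> 1 + \<bar>of_int n\<bar> / (1 + c)"
  proof (cases "0 \<le> n")
    case True
    then show ?thesis
      using a0 unfolding radial_exponent_def a by (simp add: algebra_simps)
  next
    case False
    then have n: "of_int n \<le> (- 1 :: real)" by linarith
    have r: "radial_exponent c n = 1 + (- 1 - of_int n) * a"
    proof -
      have "radial_exponent c n = 1 - (1 + of_int n) * a"
        unfolding a_def using False by (intro radial_exponent_neg[OF assms]) simp
      then show ?thesis by (simp add: algebra_simps)
    qed
    have "0 \<le> (- 1 - of_int n) * a" using n a0 by (intro mult_nonneg_nonneg) auto
    then show ?thesis
      using a0 n unfolding r a by (simp add: algebra_simps)
  qed
  then show "0 \<le> radial_exponent c n" "(\<bar>of_int n\<bar> - 1) / (1 + c) \<le> radial_exponent c n"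
    "radial_exponent c n \<le> 1 + \<bar>of_int n\<bar> / (1 + c)" by blast+
qed

text \<open>The exponent grows linearly in |n| with slope 1/(1 + c), so a large \<open>M\<close>
  reaches any rate \<open>q\<close>. Only |u| enters, so Bessel functions at real and at imaginary
  arguments are covered together.\<close>

lemma radial_coeff_geometric_bound:
  assumes m: "2 \<le> m" and c: "- 1 < c" and q: "0 < q" "q < 1"
  obtains C L where "0 \<le> C" and "\<And>n t u. 0 < t \<Longrightarrow> \<bar>u\<bar> = t\<^sup>2 / 4 \<Longrightarrow>
     \<bar>(t / 2) powr radial_exponent c n * bessel_entire (bessel_index m c n) u\<bar> \<le> C * exp (L * t) * q ^ nat \<bar>n\<bar>"
proof -
  define a where "a = 1 / (1 + c)"
  define \<nu> where "\<nu> = bessel_shift m c"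
  define M where "M = (2 / q) powr (1 / a)"
  have a: "0 < a" using c by (simp add: a_def)
  have \<nu>: "- 1 / 2 \<le> \<nu>" unfolding \<nu>_def by (rule bessel_shift_ge[OF m c])
  have M: "1 \<le> M" unfolding M_def using q a by (intro ge_one_powr_ge_zero) auto
  \<comment> \<open>The choice of \<open>M\<close> aims at q/2 rather than q; the spare factor
    2^(-k) pays for the linear growth of the prefactor.\<close>
  have Ma: "M powr (- a) = q / 2"
    using q a by (simp add: M_def powr_powr powr_minus)
  show ?thesis
  proof (rule that[of "(\<nu> + 2 + a) * M powr a * exp M" "M + 1"])
    show "0 \<le> (\<nu> + 2 + a) * M powr a * exp M" using \<nu> a by simp
    fix n t u assume t: "0 < (t::real)" and u: "\<bar>u\<bar> = t\<^sup>2 / 4"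
    define \<beta> k where "\<beta> = radial_exponent c n" and "k = nat \<bar>n\<bar>"
    have k: "\<bar>real_of_int n\<bar> = real k" by (simp add: k_def)
    have \<beta>: "0 \<le> \<beta>" "a * (real k - 1) \<le> \<beta>" "\<beta> \<le> 1 + a * real k"
      using radial_exponent_bounds[OF c, of n] unfolding \<beta>_def a_def k by simp_all
    have 1: "M powr (- \<beta>) \<le> M powr a * (q / 2) ^ k"
    proof -
      have "M powr (- \<beta>) \<le> M powr (a + (- a) * real k)"
        using M \<beta>(2) by (intro powr_mono) (auto simp: algebra_simps)
      also have "\<dots> = M powr a * (M powr (- a)) powr real k"
        by (simp only: powr_add powr_powr)
      also have "(M powr (- a)) powr real k = (q / 2) ^ k"
        unfolding Ma using q by (simp add: powr_realpow)
      finally show ?thesis .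
    qed
    have 2: "\<nu> + \<beta> + 1 \<le> (\<nu> + 2 + a) * 2 ^ k"
    proof -
      have "1 + real k \<le> 2 ^ k"
        using Bernoulli_inequality[of 1 k] by simp
      have "\<nu> + \<beta> + 1 \<le> (\<nu> + 2) * 1 + a * real k" using \<beta>(3) by simp
      also have "\<dots> \<le> (\<nu> + 2) * (1 + real k) + a * (1 + real k)"
        using \<nu> a by (intro add_mono mult_left_mono) auto
      also have "\<dots> = (\<nu> + 2 + a) * (1 + real k)" by (simp add: algebra_simps)
      also have "\<dots> \<le> (\<nu> + 2 + a) * 2 ^ k"
        using \<nu> a \<open>1 + real k \<le> 2 ^ k\<close> by (intro mult_left_mono) auto
      finally show ?thesis .
    qed
    have "\<bar>(t / 2) powr \<beta> * bessel_entire (\<nu> + \<beta>) u\<bar> \<le> (\<nu> + \<beta> + 1) * M powr (- \<beta>) * exp (M * (t + 1) + t)"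
      by (rule bessel_coeff_bound[OF \<nu> \<beta>(1) M t u])
    also have "\<dots> \<le> ((\<nu> + 2 + a) * 2 ^ k) * (M powr a * (q / 2) ^ k) * exp (M * (t + 1) + t)"
      using 1 2 \<nu> a by (intro mult_right_mono mult_mono) auto
    also have "\<dots> = (\<nu> + 2 + a) * M powr a * exp M * exp ((M + 1) * t) * q ^ k"
    proof -
      have "2 ^ k * (q / 2) ^ k = q ^ k" by (simp flip: power_mult_distrib)
      moreover have "exp (M * (t + 1) + t) = exp M * exp ((M + 1) * t)"
        by (simp add: exp_add[symmetric] algebra_simps)
      moreover have "((\<nu> + 2 + a) * 2 ^ k) * (M powr a * (q / 2) ^ k) * exp (M * (t + 1) + t)
         = (\<nu> + 2 + a) * M powr a * (2 ^ k * (q / 2) ^ k) * exp (M * (t + 1) + t)"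
        by (simp only: mult_ac)
      ultimately show ?thesis by (simp only: mult_ac)
    qed
    finally show "\<bar>(t / 2) powr radial_exponent c n * bessel_entire (bessel_index m c n) u\<bar>
       \<le> (\<nu> + 2 + a) * M powr a * exp M * exp ((M + 1) * t) * q ^ nat \<bar>n\<bar>"
      unfolding bessel_index_eq[OF c] \<nu>_def \<beta>_def k_def .
  qed
qed

section \<open>Symmetric partial sums of zonal series\<close>

definition zonal_sum ::
  "nat \<Rightarrow> (int \<Rightarrow> complex) \<Rightarrow> (real, 'n::{finite,linorder}) vec \<Rightarrow> (real, 'n) vec \<Rightarrow> 'n cclifford" where
  "zonal_sum N p \<eta> \<xi> = (\<Sum>n\<in>{- int N..int N}. p n *s zonal n \<eta> \<xi>)"

lemma sum_symmetric_int_Suc: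
  "(\<Sum>n\<in>{- int (Suc N)..int (Suc N)}. f n) = (\<Sum>n\<in>{- int N..int N}. f n) + f (int (Suc N)) + (f (- int (Suc N)) :: 'a::comm_monoid_add)"
proof -
  have "{- int (Suc N)..int (Suc N)} = insert (int (Suc N)) (insert (- int (Suc N)) {- int N..int N})"
    by auto
  then show ?thesis by (simp add: add_ac)
qed

lemma norm_smult_complex: "norm (a *s u) = cmod a * norm (u :: (complex, 'k::finite) vec)"
  by (simp add: norm_vec_def norm_mult L2_set_right_distrib)

text \<open>The decay rate is half the reciprocal of the growth rate of the zonal kernels, so each
  term is at most K C 2^(-|n|); summing over both signs gives the factor 3, uniformly in
  \<open>N\<close>.\<close>

lemma zonal_sum_bound:
  obtains K where "0 < K" and "\<And>N p C. \<And>\<eta> \<xi> :: (real, 'n::{finite,linorder}) vec. norm \<eta> = 1 \<Longrightarrow> norm \<xi> = 1 \<Longrightarrow> 0 \<le> C \<Longrightarrow>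
     (\<And>n. cmod (p n) \<le> C * (1 / (2 * (3 + 2 * real CARD('n)))) ^ nat \<bar>n\<bar>) \<Longrightarrow> norm (zonal_sum N p \<eta> \<xi>) \<le> K * C"
proof -
  obtain K where K: "0 < K" "\<And>n. \<And>\<eta> \<xi> :: (real, 'n) vec. norm \<eta> = 1 \<Longrightarrow> norm \<xi> = 1 \<Longrightarrow>
     norm (zonal n \<eta> \<xi>) \<le> K * (3 + 2 * real CARD('n)) ^ nat \<bar>n\<bar>"
    by (rule norm_zonal_le[where 'n = 'n, OF that])
  show ?thesis
  proof (rule that[of "3 * K"])
    show "0 < 3 * K" using K by simp
    fix N p C and \<eta> \<xi> :: "(real, 'n) vec"
    assume u: "norm \<eta> = 1" "norm \<xi> = 1" and C: "0 \<le> C"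
      and p: "\<And>n. cmod (p n) \<le> C * (1 / (2 * (3 + 2 * real CARD('n)))) ^ nat \<bar>n\<bar>"
    define R where "R = 3 + 2 * real CARD('n)"
    have R: "0 < R" by (simp add: R_def add_pos_nonneg)
    have "norm (p n *s zonal n \<eta> \<xi>) \<le> K * C * (1 / 2) ^ nat \<bar>n\<bar>" for n
    proof -
      have "norm (p n *s zonal n \<eta> \<xi>) \<le> (C * (1 / (2 * R)) ^ nat \<bar>n\<bar>) * (K * R ^ nat \<bar>n\<bar>)"
        unfolding norm_smult_complex using p[of n] K(2)[OF u, of n] C R
        by (intro mult_mono) (auto simp: R_def)
      also have "\<dots> = K * C * ((1 / (2 * R)) * R) ^ nat \<bar>n\<bar>"
        by (simp only: power_mult_distrib mult_ac)
      also have "(1 / (2 * R)) * R = 1 / 2" using R by simp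
      finally show ?thesis .
    qed
    then have "norm (zonal_sum N p \<eta> \<xi>) \<le> (\<Sum>n\<in>{- int N..int N}. K * C * (1 / 2) ^ nat \<bar>n\<bar>)"
      unfolding zonal_sum_def by (intro order_trans[OF norm_sum] sum_mono)
    also have "\<dots> = K * C * (\<Sum>n\<in>{- int N..int N}. (1 / 2) ^ nat \<bar>n\<bar>)"
      by (rule sum_distrib_left[symmetric])
    also have "(\<Sum>n\<in>{- int N..int N}. (1 / 2 :: real) ^ nat \<bar>n\<bar>) = 3 - 2 * (1 / 2) ^ N"
    proof (induction N)
      case (Suc N)
      have e: "nat \<bar>int (Suc N)\<bar> = Suc N" "nat \<bar>- int (Suc N)\<bar> = Suc N" by linarith+
      show ?case unfolding sum_symmetric_int_Suc Suc.IH e power_Suc by simp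
    qed simp
    also have "K * C * (3 - 2 * (1 / 2) ^ N) \<le> K * C * 3"
      using K C by (intro mult_left_mono) auto
    finally show "norm (zonal_sum N p \<eta> \<xi>) \<le> 3 * K * C" by (simp add: mult_ac)
  qed
qed

lemma zonal_sum_tendsto:
  fixes \<eta> \<xi> :: "(real, 'n::{finite,linorder}) vec"
  assumes m: "2 \<le> CARD('n)" and u: "norm \<eta> = 1" "norm \<xi> = 1"
    and p: "\<And>n. cmod (p n) \<le> C * (1 / (2 * (3 + 2 * real CARD('n)))) ^ nat \<bar>n\<bar>"
  defines "w \<equiv> \<eta> \<bullet> \<xi>" and "lam \<equiv> param_lambda CARD('n)"
  shows "(\<lambda>N. zonal_sum N p \<eta> \<xi>) \<longlonglongrightarrow>
     (\<Sum>k. p (int k) * of_real (gegP k lam w) + (if k = 0 then 0 else p (- int k) * of_real (gegQ k lam w / 2))) *s cl_one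
     + (\<Sum>l. (- p (int (Suc l)) + p (- int (Suc l))) * of_real (gegenbauer l (lam + 1) w)) *s cl_wedge \<eta> \<xi>" (is ?lim)
    and "summable (\<lambda>l. (- p (int (Suc l)) + p (- int (Suc l))) * of_real (gegenbauer l (lam + 1) w))" (is ?sum)
proof -
  define R where "R = 3 + 2 * real CARD('n)"
  define q where "q = 1 / (2 * R)"
  have R: "1 \<le> R" by (simp add: R_def)
  have q: "0 \<le> q" "q * R = 1 / 2" using R by (simp_all add: q_def)
  have pk: "cmod (p (int k)) \<le> C * q ^ k" "cmod (p (- int k)) \<le> C * q ^ k" for k
    using p[of "int k"] p[of "- int k"] by (simp_all add: q_def R_def)
  have C: "0 \<le> C" using order_trans[OF norm_ge_zero pk(1)[of 0]] by simp
  have l4: "3 + 4 * (lam + 1) = R" and l0: "0 \<le> lam + 1"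
    by (simp_all add: lam_def param_lambda_def R_def field_simps)
  have w: "\<bar>w\<bar> \<le> 1" unfolding w_def using Cauchy_Schwarz_ineq2[of \<eta> \<xi>] u by simp
  have U: "\<bar>poly (gegz (lam + 1) i) w\<bar> \<le> R ^ k" if "i \<le> int k" for i k
    using abs_gegz_le[OF l0 w that] unfolding l4 .
  have wU: "\<bar>w * poly (gegz (lam + 1) i) w\<bar> \<le> R ^ k" if "i \<le> int k" for i k
    using mult_mono[OF w U[OF that]] by (simp add: abs_mult)
  have P: "\<bar>gegP k lam w\<bar> \<le> 2 * R ^ k" for k
    unfolding gegP_eq using abs_triangle_ineq4[of "poly (gegz (lam + 1) (int k)) w" "w * poly (gegz (lam + 1) (int k - 1)) w"]
      U[of "int k" k] wU[of "int k - 1" k] by simp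
  have Q: "\<bar>gegQ k lam w / 2\<bar> \<le> 2 * R ^ k" for k
    unfolding gegQ_eq using abs_triangle_ineq4[of "w * poly (gegz (lam + 1) (int k - 1)) w" "poly (gegz (lam + 1) (int k - 2)) w"]
      U[of "int k - 2" k] wU[of "int k - 1" k] by simp
  define A where "A k = p (int k) * of_real (gegP k lam w) + (if k = 0 then 0 else p (- int k) * of_real (gegQ k lam w / 2))" for k
  define B where "B l = (- p (int (Suc l)) + p (- int (Suc l))) * of_real (gegenbauer l (lam + 1) w)" for l
  have geo: "summable (\<lambda>k. D * (1 / 2 :: real) ^ k)" for D
    by (intro summable_mult summable_geometric) simp
  have qR: "q ^ k * R ^ k = (1 / 2) ^ k" for k
    by (simp add: power_mult_distrib[symmetric] q)
  have sA: "summable A"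
  proof (rule summable_comparison_test'[OF geo[of "4 * C"], of 0])
    fix k :: nat
    have "norm (A k) \<le> cmod (p (int k)) * \<bar>gegP k lam w\<bar> + cmod (p (- int k)) * \<bar>gegQ k lam w / 2\<bar>"
      unfolding A_def by (intro order_trans[OF norm_triangle_ineq] add_mono) (auto simp: norm_mult norm_divide)
    also have "\<dots> \<le> (C * q ^ k) * (2 * R ^ k) + (C * q ^ k) * (2 * R ^ k)"
      using pk[of k] P[of k] Q[of k] C q by (intro add_mono mult_mono) auto
    also have "\<dots> = 4 * C * (q ^ k * R ^ k)" by simp
    finally show "norm (A k) \<le> 4 * C * (1 / 2) ^ k" unfolding qR .
  qed
  have sB: "summable B"
  proof (rule summable_comparison_test'[OF geo[of "2 * C"], of 0])
    fix k :: nat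
    have "norm (B k) \<le> (cmod (p (int (Suc k))) + cmod (p (- int (Suc k)))) * \<bar>gegenbauer k (lam + 1) w\<bar>"
      unfolding B_def norm_mult norm_of_real
      by (intro mult_right_mono order_trans[OF norm_triangle_ineq]) (auto simp del: of_nat_Suc)
    also have "\<dots> \<le> (C * q ^ Suc k + C * q ^ Suc k) * R ^ Suc k"
    proof -
      have "\<bar>gegenbauer k (lam + 1) w\<bar> \<le> R ^ Suc k"
        using abs_gegenbauer_le[OF l0 w, of k] power_increasing[OF _ R, of k "Suc k"] unfolding l4 by simp
      then show ?thesis using pk[of "Suc k"] C q by (intro add_mono mult_mono) (auto simp del: of_nat_Suc)
    qed
    also have "\<dots> = 2 * C * (q ^ Suc k * R ^ Suc k)" by (simp only: mult_2 distrib_right mult.assoc)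
    also have "\<dots> \<le> 2 * C * (1 / 2) ^ k"
      unfolding qR using C by (intro mult_left_mono) auto
    finally show "norm (B k) \<le> 2 * C * (1 / 2) ^ k" .
  qed
  \<comment> \<open>The indices k and -k together make up the k-th terms of both series. The
    bivector series starts at k = 1, hence the different ranges \<open>Suc N\<close> and
    \<open>N\<close>.\<close>
  have part: "zonal_sum N p \<eta> \<xi> = (\<Sum>k<Suc N. A k) *s cl_one + (\<Sum>l<N. B l) *s cl_wedge \<eta> \<xi>" for N
  proof (induction N)
    case 0
    show ?case
      using zonal_of_nat(1)[OF m, where k = 0 and \<eta> = \<eta> and \<xi> = \<xi>]
      by (simp add: zonal_sum_def A_def gegz_neg w_def lam_def flip: smult_of_real)
  next
    case (Suc N)
    have g: "poly (gegz (lam + 1) (int (Suc N) - 1)) w = gegenbauer N (lam + 1) w"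
      by (simp add: gegz_of_nat poly_geg_poly)
    have z1: "p (int (Suc N)) *s zonal (int (Suc N)) \<eta> \<xi> =
       (p (int (Suc N)) * of_real (gegP (Suc N) lam w)) *s cl_one - (p (int (Suc N)) * of_real (gegenbauer N (lam + 1) w)) *s cl_wedge \<eta> \<xi>"
      using zonal_of_nat(1)[OF m, where k = "Suc N" and \<eta> = \<eta> and \<xi> = \<xi>, folded w_def lam_def]
      unfolding g
      by (simp only: vec_eq_iff vector_smult_component vector_minus_component vector_add_component
          vector_scaleR_component) (simp add: scaleR_conv_of_real algebra_simps)
    have z2: "p (- int (Suc N)) *s zonal (- int (Suc N)) \<eta> \<xi> =
       (p (- int (Suc N)) * of_real (gegQ (Suc N) lam w / 2)) *s cl_one + (p (- int (Suc N)) * of_real (gegenbauer N (lam + 1) w)) *s cl_wedge \<eta> \<xi>"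
      using zonal_of_nat(2)[OF m, where k = "Suc N" and \<eta> = \<eta> and \<xi> = \<xi>, folded w_def lam_def]
      unfolding g
      by (simp only: vec_eq_iff vector_smult_component vector_minus_component vector_add_component
          vector_scaleR_component) (simp add: scaleR_conv_of_real algebra_simps)
    have "zonal_sum (Suc N) p \<eta> \<xi> = zonal_sum N p \<eta> \<xi> + p (int (Suc N)) *s zonal (int (Suc N)) \<eta> \<xi>
        + p (- int (Suc N)) *s zonal (- int (Suc N)) \<eta> \<xi>"
      unfolding zonal_sum_def by (rule sum_symmetric_int_Suc)
    also have "\<dots> = (\<Sum>k<Suc (Suc N). A k) *s cl_one + (\<Sum>l<Suc N. B l) *s cl_wedge \<eta> \<xi>"
      unfolding z1 z2 Suc.IH sum.lessThan_Suc[of _ "Suc N"] sum.lessThan_Suc[of _ N] A_def[of "Suc N"] B_def[of N]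
      by (simp add: vec_eq_iff algebra_simps)
    finally show ?case .
  qed
  have "(\<lambda>N. (\<Sum>k<Suc N. A k) *s cl_one + (\<Sum>l<N. B l) *s cl_wedge \<eta> \<xi>) \<longlonglongrightarrow> (suminf A) *s cl_one + (suminf B) *s cl_wedge \<eta> \<xi>"
  proof (rule vec_tendstoI)
    fix i
    have a: "(\<lambda>N. \<Sum>k<Suc N. A k) \<longlonglongrightarrow> suminf A"
      using summable_LIMSEQ[OF sA] by (rule LIMSEQ_Suc)
    have b: "(\<lambda>N. \<Sum>l<N. B l) \<longlonglongrightarrow> suminf B"
      by (rule summable_LIMSEQ[OF sB])
    show "(\<lambda>N. ((\<Sum>k<Suc N. A k) *s cl_one + (\<Sum>l<N. B l) *s cl_wedge \<eta> \<xi>) $ i)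
       \<longlonglongrightarrow> ((suminf A) *s cl_one + (suminf B) *s cl_wedge \<eta> \<xi>) $ i"
      unfolding vector_add_component vector_smult_component
      by (intro tendsto_add tendsto_mult tendsto_const a b)
  qed
  then show ?lim
    unfolding part A_def B_def .
  show ?sum
    using sB unfolding B_def .
qed

section \<open>The kernels as zonal series\<close>

lemma bessel_J_of_real:
  assumes "- 1 / 2 \<le> \<nu>" "0 < t"
  shows "bessel_J \<nu> (of_real t) = of_real ((t / 2) powr \<nu> * bessel_entire \<nu> (- (t\<^sup>2 / 4)))"
proof -
  have e: "(- 1) ^ n / fact n * rGamma (complex_of_real \<nu> + of_nat n + 1) * (complex_of_real t / 2) ^ (2 * n)
     = of_real ((- (t\<^sup>2 / 4)) ^ n / fact n * rGamma (\<nu> + real n + 1))" for n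
  proof -
    have r: "rGamma (complex_of_real \<nu> + of_nat n + 1) = of_real (rGamma (\<nu> + real n + 1))"
      using rGamma_complex_of_real[of "\<nu> + real n + 1"] by simp
    have p: "(- (t\<^sup>2 / 4)) ^ n = (- 1) ^ n * (t / 2) ^ (2 * n)"
      by (simp add: power_mult power_divide power_minus[of "t\<^sup>2 / 4"])
    show ?thesis unfolding r p by simp
  qed
  have "summable (\<lambda>n. (- (t\<^sup>2 / 4)) ^ n / fact n * rGamma (\<nu> + real n + 1))"
    by (rule summable_norm_cancel[OF summable_bessel_entire[OF assms(1)]])
  then have "(\<Sum>n. of_real ((- (t\<^sup>2 / 4)) ^ n / fact n * rGamma (\<nu> + real n + 1)))
     = complex_of_real (bessel_entire \<nu> (- (t\<^sup>2 / 4)))"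
    unfolding bessel_entire_def by (rule suminf_of_real[symmetric])
  moreover have "(complex_of_real t / 2) powr complex_of_real \<nu> = of_real ((t / 2) powr \<nu>)"
    using powr_of_real[of "t / 2" \<nu>] assms by simp
  ultimately show ?thesis
    unfolding bessel_J_def e by simp
qed

text \<open>On the imaginary axis the sign (-1)^n of the series cancels against that of the even
  power, and the two principal powers cancel because they are taken at the same nonzero
  point.\<close>

lemma bessel_Jt_imaginary:
  assumes "- 1 / 2 \<le> \<nu>" "0 < u"
  shows "bessel_Jt \<nu> (\<i> * of_real u) = of_real (bessel_entire \<nu> (u\<^sup>2 / 4))"
proof -
  define z where "z = \<i> * complex_of_real u / 2"
  have z: "z \<noteq> 0" using assms by (simp add: z_def)
  have e: "(- 1) ^ n / fact n * rGamma (complex_of_real \<nu> + of_nat n + 1) * z ^ (2 * n)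
     = of_real ((u\<^sup>2 / 4) ^ n / fact n * rGamma (\<nu> + real n + 1))" for n
  proof -
    have r: "rGamma (complex_of_real \<nu> + of_nat n + 1) = of_real (rGamma (\<nu> + real n + 1))"
      using rGamma_complex_of_real[of "\<nu> + real n + 1"] by simp
    have z2: "z\<^sup>2 = - of_real (u\<^sup>2 / 4)"
      by (simp add: z_def power_divide power_mult_distrib)
    have "z ^ (2 * n) = (- 1) ^ n * of_real ((u\<^sup>2 / 4) ^ n)"
      unfolding power_mult z2 power_minus[of "complex_of_real (u\<^sup>2 / 4)"] of_real_power ..
    then have p: "(- 1) ^ n * z ^ (2 * n) = of_real ((u\<^sup>2 / 4) ^ n)"
      by (simp flip: mult.assoc power_mult_distrib)
    have "(- 1) ^ n / fact n * of_real (rGamma (\<nu> + real n + 1)) * z ^ (2 * n)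
       = ((- 1) ^ n * z ^ (2 * n)) / fact n * of_real (rGamma (\<nu> + real n + 1))"
      by simp
    then show ?thesis unfolding r p by simp
  qed
  have "summable (\<lambda>n. (u\<^sup>2 / 4) ^ n / fact n * rGamma (\<nu> + real n + 1))"
    by (rule summable_norm_cancel[OF summable_bessel_entire[OF assms(1)]])
  then have s: "(\<Sum>n. of_real ((u\<^sup>2 / 4) ^ n / fact n * rGamma (\<nu> + real n + 1)))
     = complex_of_real (bessel_entire \<nu> (u\<^sup>2 / 4))"
    unfolding bessel_entire_def by (rule suminf_of_real[symmetric])
  have "z powr (- complex_of_real \<nu>) * z powr complex_of_real \<nu> = 1"
    using z by (simp add: powr_minus)
  then show ?thesis
    unfolding bessel_Jt_def bessel_J_def z_def[symmetric] e s
    by (simp flip: mult.assoc)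
qed

text \<open>The coefficients a_k and -i a_(k-1) of the two families under one index. What matters is
  that they are unimodular and independent of the radius.\<close>

definition phase :: "real \<Rightarrow> int \<Rightarrow> complex" where
  "phase c n = (if 0 \<le> n then a_coeff c n else - \<i> * a_coeff c (- n - 1))"

lemma norm_phase: "cmod (phase c n) = 1"
proof -
  have "cmod (a_coeff c k) = 1" if "0 \<le> k" for k
  proof -
    have "- (\<i> * of_real pi * of_int k / (2 * (1 + of_real c))) = \<i> * complex_of_real (- (pi * of_int k / (2 * (1 + c))))"
      by simp
    then show ?thesis using that unfolding a_coeff_def by (simp only: norm_exp_i_times) simp
  qed
  then show ?thesis by (simp add: phase_def norm_mult)
qed

text \<open>For t > 0 this is t^(-\<nu>) times the Bessel function of order \<nu> + \<beta>, with
  the possibly singular powers already cancelled.\<close>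

definition bessel_radial :: "nat \<Rightarrow> real \<Rightarrow> int \<Rightarrow> real \<Rightarrow> real" where
  "bessel_radial m c n t = 2 powr (- bessel_shift m c) *
     ((t / 2) powr radial_exponent c n * bessel_entire (bessel_index m c n) (- (t\<^sup>2 / 4)))"

lemma bessel_radial_eq:
  assumes "2 \<le> m" "- 1 < c" "0 < t"
  shows "of_real (bessel_radial m c n t) = of_real (t powr (- bessel_shift m c)) * bessel_J (bessel_index m c n) (of_real t)"
proof -
  have i: "- 1 / 2 \<le> bessel_index m c n"
    using bessel_shift_ge[OF assms(1,2)] radial_exponent_bounds(1)[OF assms(2), of n]
    unfolding bessel_index_eq[OF assms(2)] by linarith
  have "t powr (- bessel_shift m c) * (t / 2) powr bessel_index m c n
     = 2 powr (- bessel_shift m c) * (t / 2) powr radial_exponent c n"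
  proof -
    have "t powr (- bessel_shift m c) = 2 powr (- bessel_shift m c) * (t / 2) powr (- bessel_shift m c)"
      using assms(3) by (simp flip: powr_mult)
    then show ?thesis
      unfolding bessel_index_eq[OF assms(2)] using assms(3) by (simp add: powr_add powr_minus)
  qed
  then show ?thesis
    unfolding bessel_J_of_real[OF i assms(3)] of_real_mult[symmetric] bessel_radial_def
    by (simp only: mult.assoc[symmetric])
qed

lemma bessel_radial_bound:
  assumes m: "2 \<le> m" and c: "- 1 < c" and q: "0 < q" "q < 1"
  obtains C L where "0 \<le> C" and "\<And>n t. 0 < t \<Longrightarrow> \<bar>bessel_radial m c n t\<bar> \<le> C * exp (L * t) * q ^ nat \<bar>n\<bar>"
proof -
  obtain C L where C: "0 \<le> C" and b: "\<And>n t u. 0 < t \<Longrightarrow> \<bar>u\<bar> = t\<^sup>2 / 4 \<Longrightarrow>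
     \<bar>(t / 2) powr radial_exponent c n * bessel_entire (bessel_index m c n) u\<bar> \<le> C * exp (L * t) * q ^ nat \<bar>n\<bar>"
    using radial_coeff_geometric_bound[OF assms] by metis
  show ?thesis
  proof (rule that[of "2 powr (- bessel_shift m c) * C" L])
    show "0 \<le> 2 powr (- bessel_shift m c) * C" using C by simp
    fix n and t :: real assume t: "0 < t"
    have "\<bar>(t / 2) powr radial_exponent c n * bessel_entire (bessel_index m c n) (- (t\<^sup>2 / 4))\<bar> \<le> C * exp (L * t) * q ^ nat \<bar>n\<bar>"
      by (rule b[OF t]) simp
    then have "2 powr (- bessel_shift m c) * \<bar>(t / 2) powr radial_exponent c n * bessel_entire (bessel_index m c n) (- (t\<^sup>2 / 4))\<bar>
      \<le> 2 powr (- bessel_shift m c) * (C * exp (L * t) * q ^ nat \<bar>n\<bar>)"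
      by (rule mult_left_mono) simp
    then show "\<bar>bessel_radial m c n t\<bar> \<le> 2 powr (- bessel_shift m c) * C * exp (L * t) * q ^ nat \<bar>n\<bar>"
      unfolding bessel_radial_def abs_mult[of "2 powr _"] by (simp add: mult.assoc)
  qed
qed

lemma cl_wedge_scaleR: "cl_wedge (a *\<^sub>R x) (b *\<^sub>R y) = (a * b) *\<^sub>R cl_wedge x y"
  unfolding cl_wedge_def scaleR_sum_right smult_of_real vector_scaleR_component real_scaleR_def
  by (rule sum.cong) (auto simp: algebra_simps)

lemma sgn_decompose:
  fixes x y :: "(real, 'n::{finite,linorder}) vec"
  assumes "x \<noteq> 0" "y \<noteq> 0"
  shows "sgn x \<bullet> sgn y = (x \<bullet> y) / (norm x * norm y)"
    and "cl_wedge x y = (norm x * norm y) *\<^sub>R cl_wedge (sgn x) (sgn y)"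
proof -
  show "sgn x \<bullet> sgn y = (x \<bullet> y) / (norm x * norm y)"
    by (simp add: sgn_div_norm divide_inverse)
  have "x = norm x *\<^sub>R sgn x" "y = norm y *\<^sub>R sgn y"
    using assms by (simp_all add: sgn_div_norm)
  then show "cl_wedge x y = (norm x * norm y) *\<^sub>R cl_wedge (sgn x) (sgn y)"
    using cl_wedge_scaleR[of "norm x" "sgn x" "norm y" "sgn y"] by simp
qed

text \<open>Passes from unit vectors to given ones: the kernels use the unnormalised bivector, so
  their second series differs by the nonzero factor |y||x|. Summability is established before that
  factor is moved across the infinite sum.\<close>

lemma kernel_limit:
  fixes y x :: "(real, 'n::{finite,linorder}) vec" and p :: "int \<Rightarrow> complex" and c :: real
  assumes m: "2 \<le> CARD('n)" and nz: "y \<noteq> 0" "x \<noteq> 0"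
    and p: "\<And>n. cmod (p n) \<le> C * (1 / (2 * (3 + 2 * real CARD('n)))) ^ nat \<bar>n\<bar>"
  defines "w \<equiv> (y \<bullet> x) / (norm y * norm x)" and "lam \<equiv> param_lambda CARD('n)"
  assumes A: "\<And>k. a k = p (int k) * of_real (gegP k lam w) + (if k = 0 then 0 else p (- int k) * of_real (gegQ k lam w / 2))"
    and B: "\<And>l. of_real (norm y * norm x) * b l = (- p (int (Suc l)) + p (- int (Suc l))) * of_real (gegenbauer l (lam + 1) w)"
  shows "(\<lambda>N. zonal_sum N p (sgn y) (sgn x)) \<longlonglongrightarrow> (\<Sum>k. a k) *s cl_one + (\<Sum>l. b l) *s cl_wedge y x"
proof -
  have u: "norm (sgn y) = 1" "norm (sgn x) = 1" using nz by (simp_all add: norm_sgn)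
  have w: "sgn y \<bullet> sgn x = w"
    unfolding w_def by (rule sgn_decompose[OF nz])
  define r where "r = norm y * norm x"
  have r: "complex_of_real r \<noteq> 0" using nz by (simp add: r_def)
  note lim = zonal_sum_tendsto[OF m u p, unfolded w, folded lam_def]
  have "summable (\<lambda>l. of_real r * b l)" using lim(2) unfolding B[folded r_def] .
  then have sb: "summable b" using r by (simp only: summable_cmult_iff) simp
  have "(\<Sum>l. (- p (int (Suc l)) + p (- int (Suc l))) * of_real (gegenbauer l (lam + 1) w)) *s cl_wedge (sgn y) (sgn x)
     = (\<Sum>l. b l) *s cl_wedge y x"
    unfolding B[symmetric, folded r_def] suminf_mult[OF sb] sgn_decompose(2)[OF nz] r_def[symmetric]
    by (simp add: mult.commute flip: smult_of_real)
  with lim(1) show ?thesis unfolding A[symmetric] by simp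
qed

lemma bessel_index_cases:
  "bessel_index m c (int k) = param_gamma m c (int k) / 2 - 1"
  "0 < k \<Longrightarrow> bessel_index m c (- int k) = param_gamma m c (int k - 1) / 2"
  by (simp_all add: bessel_index_def)

lemma radial_exponent_cases:
  "radial_exponent c (int k) = real k / (1 + c)"
  "0 < k \<Longrightarrow> radial_exponent c (- int k) = (real k + c) / (1 + c)"
  by (simp_all add: radial_exponent_def add.commute)

definition plus_coeff :: "nat \<Rightarrow> real \<Rightarrow> real \<Rightarrow> int \<Rightarrow> complex" where
  "plus_coeff m c t n = phase c n * of_real (bessel_radial m c n t)"

lemma K_plus_limit:
  fixes y x :: "(real, 'n::{finite,linorder}) vec"
  assumes m: "2 \<le> CARD('n)" and c: "- 1 < c" and nz: "y \<noteq> 0" "x \<noteq> 0"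
  shows "(\<lambda>N. zonal_sum N (plus_coeff CARD('n) c (norm y * norm x)) (sgn y) (sgn x)) \<longlonglongrightarrow> K_plus c y x"
proof -
  define M where "M = CARD('n)"
  define \<zeta> where "\<zeta> = norm y * norm x"
  define w where "w = (y \<bullet> x) / \<zeta>"
  define q where "q = 1 / (2 * (3 + 2 * real CARD('n)))"
  define lam where "lam = param_lambda M"
  have z: "0 < \<zeta>" using nz by (simp add: \<zeta>_def)
  have q: "0 < q" "q < 1" by (simp_all add: q_def divide_less_eq add_pos_nonneg)
  obtain C L where b: "\<And>n t. 0 < t \<Longrightarrow> \<bar>bessel_radial M c n t\<bar> \<le> C * exp (L * t) * q ^ nat \<bar>n\<bar>"
    using bessel_radial_bound[OF m c q] unfolding M_def by metis
  have p: "cmod (plus_coeff M c \<zeta> n) \<le> C * exp (L * \<zeta>) * q ^ nat \<bar>n\<bar>" for n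
    using b[OF z, of n] by (simp add: plus_coeff_def norm_mult norm_phase)
  have pk: "plus_coeff M c \<zeta> n = phase c n * (of_real (\<zeta> powr (- bessel_shift M c)) * bessel_J (bessel_index M c n) (of_real \<zeta>))" for n
    unfolding plus_coeff_def by (subst bessel_radial_eq) (use m c z in \<open>auto simp: M_def\<close>)
  have e1: "- (param_delta M c - 2) / 2 = - bessel_shift M c" by (simp only: bessel_shift_def minus_divide_left)
  have e2: "\<zeta> * \<zeta> powr (- param_delta M c / 2) = \<zeta> powr (- bessel_shift M c)"
    using z by (simp add: bessel_shift_def powr_mult_base diff_divide_distrib)
  have ph: "phase c (int k) = a_coeff c (int k)" "0 < k \<Longrightarrow> phase c (- int k) = - \<i> * a_coeff c (int k - 1)" for k
    by (simp_all add: phase_def)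
  have "(\<lambda>N. zonal_sum N (plus_coeff M c \<zeta>) (sgn y) (sgn x)) \<longlonglongrightarrow>
     A_ipi2 M c \<zeta> w *s cl_one + B_ipi2 M c \<zeta> w *s cl_wedge y x"
    unfolding A_ipi2_def B_ipi2_def Let_def lam_def[symmetric]
  proof (rule kernel_limit[OF m nz p[unfolded q_def], folded \<zeta>_def, folded w_def M_def, folded lam_def], goal_cases)
    case (1 k)
    show ?case
    proof (cases "k = 0")
      case True
      then show ?thesis
        unfolding pk e1 bessel_index_cases ph by (simp add: a_coeff_def[of c "- 1"] algebra_simps)
    next
      case False
      then have k: "0 < k" by simp
      show ?thesis
        unfolding pk e1 bessel_index_cases(1) ph(1) bessel_index_cases(2)[OF k] ph(2)[OF k] using False
        by (simp add: algebra_simps)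
    qed
  next
    case (2 l)
    have k: "0 < Suc l" by simp
    have alg: "z * (h * (- a * J - \<i> * b * J') * g) = (- (a * (z * h * J)) + - \<i> * b * (z * h * J')) * g"
      for z h a J b J' g :: complex
      by (simp add: algebra_simps)
    have ez: "complex_of_real \<zeta> * complex_of_real (\<zeta> powr (- param_delta M c / 2)) = of_real (\<zeta> powr (- bessel_shift M c))"
      unfolding of_real_mult[symmetric] e2 ..
    show ?case
      unfolding pk bessel_index_cases(1) ph(1) bessel_index_cases(2)[OF k] ph(2)[OF k] ez[symmetric]
        diff_Suc_1
      by (rule alg)
  qed
  then show ?thesis
    unfolding K_plus_def Let_def M_def \<zeta>_def w_def .
qed

text \<open>Covers both coefficients of the kernel without its Gaussian: the exponent is
  -\<gamma>_k/2 for n = k, and for n = -k it is -\<gamma>_(k-1)/2 - 1, whose extra -1 supplies the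
  factor 1/(2 sinh \<omega>).\<close>

definition omega_coeff :: "nat \<Rightarrow> real \<Rightarrow> real \<Rightarrow> real \<Rightarrow> int \<Rightarrow> real" where
  "omega_coeff m c \<omega> t n = 2 * exp (\<omega> * param_delta m c / 2) * (2 * sinh \<omega>) powr (- bessel_index m c n - 1) *
     (t powr radial_exponent c n * bessel_entire (bessel_index m c n) ((t / sinh \<omega>)\<^sup>2 / 4))"

lemma K_omega_limit:
  fixes y x :: "(real, 'n::{finite,linorder}) vec"
  assumes m: "2 \<le> CARD('n)" and c: "- 1 < c" and nz: "y \<noteq> 0" "x \<noteq> 0" and \<omega>: "0 < \<omega>"
  shows "(\<lambda>N. exp (- (cosh \<omega> / sinh \<omega>) / 2 * ((norm y)\<^sup>2 + (norm x)\<^sup>2)) *\<^sub>R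
      zonal_sum N (\<lambda>n. of_real (omega_coeff CARD('n) c \<omega> (norm y * norm x) n)) (sgn y) (sgn x)) \<longlonglongrightarrow> K_omega c \<omega> y x"
proof -
  define M where "M = CARD('n)"
  define S where "S = sinh \<omega>"
  define \<zeta> where "\<zeta> = norm y * norm x"
  define w where "w = (y \<bullet> x) / \<zeta>"
  define q where "q = 1 / (2 * (3 + 2 * real CARD('n)))"
  define lam where "lam = param_lambda M"
  define E where "E = 2 * exp (\<omega> * param_delta M c / 2)"
  define p where "p n = complex_of_real (omega_coeff M c \<omega> \<zeta> n)" for n
  have S: "0 < S" using \<omega> by (simp add: S_def)
  have z: "0 < \<zeta>" using nz by (simp add: \<zeta>_def)
  have q: "0 < q" "q < 1" by (simp_all add: q_def divide_less_eq add_pos_nonneg)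
  have M: "2 \<le> M" using m by (simp add: M_def)
  obtain C L where b: "\<And>n t u. 0 < t \<Longrightarrow> \<bar>u\<bar> = t\<^sup>2 / 4 \<Longrightarrow>
     \<bar>(t / 2) powr radial_exponent c n * bessel_entire (bessel_index M c n) u\<bar> \<le> C * exp (L * t) * q ^ nat \<bar>n\<bar>"
    using radial_coeff_geometric_bound[OF M c q] by metis
  define D where "D = E * (2 * S) powr (- bessel_shift M c - 1)"
  have D: "0 \<le> D" by (simp add: D_def E_def)
  \<comment> \<open>The part of the power of 2 sinh \<omega> that depends on n joins \<zeta>, so the
    geometric bound applies at t = \<zeta> / sinh \<omega>.\<close>
  have "omega_coeff M c \<omega> \<zeta> n = D * (((\<zeta> / S) / 2) powr radial_exponent c n * bessel_entire (bessel_index M c n) ((\<zeta> / S)\<^sup>2 / 4))" for n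
  proof -
    define b B where "b = radial_exponent c n" and "B = bessel_entire (bessel_index M c n) ((\<zeta> / S)\<^sup>2 / 4)"
    have 1: "(2 * S) powr (- bessel_index M c n - 1) = (2 * S) powr (- bessel_shift M c - 1) * (2 * S) powr (- b)"
      unfolding powr_add[symmetric] bessel_index_eq[OF c] b_def by (simp add: algebra_simps)
    have "(\<zeta> / S) / 2 = \<zeta> / (2 * S)" by simp
    moreover have "(\<zeta> / (2 * S)) powr b = \<zeta> powr b / (2 * S) powr b"
      by (rule powr_divide)
    ultimately have 2: "((\<zeta> / S) / 2) powr b = (2 * S) powr (- b) * \<zeta> powr b"
      by (simp only: powr_minus divide_inverse mult.commute)
    have "omega_coeff M c \<omega> \<zeta> n = E * (2 * S) powr (- bessel_index M c n - 1) * (\<zeta> powr b * B)"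
      by (simp only: omega_coeff_def E_def S_def b_def B_def)
    then show ?thesis
      unfolding 1 b_def[symmetric] B_def[symmetric] 2 D_def by (simp only: mult_ac)
  qed
  moreover have "\<bar>((\<zeta> / S) / 2) powr radial_exponent c n * bessel_entire (bessel_index M c n) ((\<zeta> / S)\<^sup>2 / 4)\<bar>
      \<le> C * exp (L * (\<zeta> / S)) * q ^ nat \<bar>n\<bar>" for n
    by (rule b) (use S z in auto)
  ultimately have p: "cmod (p n) \<le> D * (C * exp (L * (\<zeta> / S))) * q ^ nat \<bar>n\<bar>" for n
    using D unfolding p_def norm_of_real by (simp add: abs_mult mult.assoc mult_left_mono)
  have idx: "- 1 / 2 \<le> bessel_index M c n" for n
    using bessel_shift_ge[OF M c] radial_exponent_bounds(1)[OF c, of n]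
    unfolding bessel_index_eq[OF c] by linarith
  have Jt: "bessel_Jt (bessel_index M c n) (\<i> * of_real \<zeta> / of_real S) = of_real (bessel_entire (bessel_index M c n) ((\<zeta> / S)\<^sup>2 / 4))" for n
    using bessel_Jt_imaginary[OF idx[of n], of "\<zeta> / S"] S z by simp
  have al1: "alpha_coeff M c \<omega> (int k) = E * (2 * S) powr (- bessel_index M c (int k) - 1)" for k
    unfolding bessel_index_cases by (simp add: alpha_coeff_def E_def S_def)
  have al2: "alpha_coeff M c \<omega> (int k - 1) / (2 * S) = E * (2 * S) powr (- bessel_index M c (- int k) - 1)" if "0 < k" for k
  proof -
    have "(2 * S) powr (- bessel_index M c (- int k) - 1) = (2 * S) powr (- bessel_index M c (- int k)) / (2 * S)"
      using S by (simp add: powr_diff)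
    then show ?thesis
      using that unfolding bessel_index_cases(2)[OF that] by (simp add: alpha_coeff_def E_def S_def)
  qed
  have pk1: "p (int k) = of_real (alpha_coeff M c \<omega> (int k)) * of_real (\<zeta> powr (real k / (1 + c)))
     * bessel_Jt (param_gamma M c (int k) / 2 - 1) (\<i> * of_real \<zeta> / of_real S)" for k
    unfolding bessel_index_cases(1)[symmetric] Jt al1 p_def omega_coeff_def E_def S_def[symmetric] radial_exponent_cases
    by simp
  have pk2: "p (- int k) = of_real (alpha_coeff M c \<omega> (int k - 1) / (2 * S)) * of_real (\<zeta> powr ((real k + c) / (1 + c)))
     * bessel_Jt (param_gamma M c (int k - 1) / 2) (\<i> * of_real \<zeta> / of_real S)" if "0 < k" for k
    unfolding bessel_index_cases(2)[OF that, symmetric] Jt al2[OF that] p_def omega_coeff_def E_def S_def[symmetric] radial_exponent_cases(2)[OF that]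
    by simp
  have "(\<lambda>N. zonal_sum N p (sgn y) (sgn x)) \<longlonglongrightarrow>
     A_omega M c \<omega> \<zeta> w *s cl_one + B_omega M c \<omega> \<zeta> w *s cl_wedge y x"
    unfolding A_omega_def B_omega_def Let_def S_def[symmetric] lam_def[symmetric]
  proof (rule kernel_limit[OF m nz p[unfolded q_def], folded \<zeta>_def, folded w_def M_def, folded lam_def], goal_cases)
    case (1 k)
    show ?case
    proof (cases "k = 0")
      case True
      then show ?thesis
        unfolding pk1 by (simp add: alpha_coeff_def[of M c \<omega> "- 1"])
    next
      case False
      then have k: "0 < k" by simp
      show ?thesis
        unfolding pk1 pk2[OF k] using False by simp
    qed
  next
    case (2 l)
    have k: "0 < Suc l" by simp
    have alg: "z * ((- a * h * J + b * h' * J') * g) = (- (a * (z * h) * J) + b * (z * h') * J') * g"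
      for z h a J b h' J' g :: complex
      by (simp add: algebra_simps)
    have ez: "complex_of_real \<zeta> * of_real (\<zeta> powr (a - 1)) = of_real (\<zeta> powr a)" for a
      unfolding of_real_mult[symmetric] using z by (simp add: powr_mult_base)
    show ?case
      unfolding pk1 pk2[OF k] ez[of "real (Suc l) / (1 + c)", symmetric]
        ez[of "(real (Suc l) + c) / (1 + c)", symmetric] diff_Suc_1
      by (rule alg)
  qed
  from tendsto_scaleR[OF tendsto_const this] show ?thesis
    unfolding K_omega_def Let_def M_def[symmetric] \<zeta>_def[symmetric] w_def[symmetric] p_def .
qed

section \<open>Conjugation of the complex coefficients\<close>

lemma cnj_cl_sign: "cnj (cl_sign A B) = cl_sign A B"
  unfolding cl_sign_def by (simp add: if_distrib cong: if_cong)

lemma cl_cnj_mult: "cl_cnj (u \<star> v) = cl_cnj u \<star> cl_cnj v"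
  by (simp add: vec_eq_iff cl_cnj_def cl_mult_nth cnj_cl_sign)

lemma cl_cnj_simps:
  "cl_cnj (u + v) = cl_cnj u + cl_cnj v" "cl_cnj (r *\<^sub>R u) = r *\<^sub>R cl_cnj u"
  "cl_cnj (a *s u) = cnj a *s cl_cnj u" "cl_cnj cl_one = cl_one" "cl_cnj (cl_gen i) = cl_gen i" "cl_cnj 0 = 0"
  by (simp_all add: vec_eq_iff cl_cnj_def cl_one_def cl_gen_def axis_def)

lemma cl_cnj_sum: "cl_cnj (\<Sum>i\<in>I. f i) = (\<Sum>i\<in>I. cl_cnj (f i))"
  by (induction I rule: infinite_finite_induct) (simp_all add: cl_cnj_simps)

text \<open>The zonal kernels have real coefficients and conjugation is multiplicative, so
  conjugating a kernel only conjugates the phases.\<close>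

lemma cl_cnj_zonal: "cl_cnj (zonal n \<eta> \<xi>) = zonal n \<eta> \<xi>"
  by (simp add: zonal_def cl_cnj_simps cl_cnj_mult cl_vec_def cl_cnj_sum)

lemma K_minus_limit:
  fixes y x :: "(real, 'n::{finite,linorder}) vec"
  assumes "2 \<le> CARD('n)" "- 1 < c" "y \<noteq> 0" "x \<noteq> 0"
  shows "(\<lambda>N. zonal_sum N (\<lambda>n. cnj (plus_coeff CARD('n) c (norm y * norm x) n)) (sgn y) (sgn x)) \<longlonglongrightarrow> K_minus c y x"
proof -
  have "zonal_sum N (\<lambda>n. cnj (p n)) \<eta> \<xi> = cl_cnj (zonal_sum N p \<eta> \<xi>)" for N p and \<eta> \<xi> :: "(real, 'n) vec"
    by (simp add: zonal_sum_def cl_cnj_sum cl_cnj_simps cl_cnj_zonal)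
  moreover have "(\<lambda>N. cl_cnj (f N)) \<longlonglongrightarrow> cl_cnj u" if "f \<longlonglongrightarrow> u" for f :: "nat \<Rightarrow> 'n cclifford" and u
    unfolding cl_cnj_def by (intro vec_tendstoI) (auto intro!: tendsto_cnj tendsto_vec_nth that)
  ultimately show ?thesis
    using K_plus_limit[OF assms] by (simp add: K_minus_def)
qed

section \<open>Integration of the partial sums\<close>

lemma has_bochner_integral_smult:
  fixes f :: "'a \<Rightarrow> (complex, 'k::finite) vec"
  assumes "has_bochner_integral M f I"
  shows "has_bochner_integral M (\<lambda>x. a *s f x) (a *s I)"
proof (rule has_bochner_integral_bounded_linear[OF _ assms])
  show "bounded_linear (\<lambda>u :: (complex, 'k) vec. a *s u)"
  proof (rule bounded_linear_intro[of _ "cmod a"])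
    show "a *s (r *\<^sub>R u) = r *\<^sub>R (a *s u)" for r and u :: "(complex, 'k) vec"
      by (simp add: vec_eq_iff)
    show "norm (a *s u) \<le> norm u * cmod a" for u :: "(complex, 'k) vec"
      by (simp add: norm_smult_complex mult.commute)
  qed (simp add: vector_add_ldistrib)
qed

text \<open>The origin of the weight: together with the polar Jacobian it is the power for which
  Weber's integral applies simultaneously to all orders \<nu> + \<beta>.\<close>

lemma weight_h_polar:
  assumes "2 \<le> m" "- 1 < c" "0 < r"
  shows "r ^ (m - 1) * weight_h m c r = r powr (2 * bessel_shift m c + 1)"
proof -
  have "r ^ (m - 1) * weight_h m c r = r powr (real (m - 1) + (1 - (1 + real m * c) / (1 + c)))"
    unfolding weight_h_def powr_add powr_realpow[OF assms(3)] ..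
  also have "real (m - 1) + (1 - (1 + real m * c) / (1 + c)) = 2 * bessel_shift m c + 1"
    using assms by (simp add: bessel_shift_def param_delta_def of_nat_diff field_simps)
  finally show ?thesis .
qed

lemma borel_measurable_weight_h [measurable]: "weight_h m c \<in> borel_measurable borel"
  unfolding weight_h_def by measurable

lemma borel_measurable_bessel_radial [measurable]: "bessel_radial m c n \<in> borel_measurable borel"
  unfolding bessel_radial_def by measurable

definition radial_density :: "nat \<Rightarrow> real \<Rightarrow> real \<Rightarrow> real \<Rightarrow> real \<Rightarrow> int \<Rightarrow> int \<Rightarrow> real \<Rightarrow> real" where
  "radial_density m c s X Z n l r =
     exp (- s * r\<^sup>2) * weight_h m c r * (bessel_radial m c n (r * X) * bessel_radial m c l (Z * r))"

lemma borel_measurable_radial_density [measurable]: "radial_density m c s X Z n l \<in> borel_measurable borel"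
  unfolding radial_density_def by measurable

lemma integrable_radial_exp:
  assumes m: "2 \<le> m" and c: "- 1 < c" and s: "0 < s"
  shows "integrable lborel (\<lambda>r. indicator {0<..} r * (r ^ (m - 1) * (exp (- s * r\<^sup>2) * weight_h m c r * exp (L * r))))"
proof -
  have "- 1 < 2 * bessel_shift m c + 1"
    using bessel_shift_ge[OF m c] by linarith
  note int = integrable_powr_gauss_exp[OF this s, of L]
  have "indicator {0<..} r * (r ^ (m - 1) * (exp (- s * r\<^sup>2) * weight_h m c r * exp (L * r)))
     = indicator {0<..} r * (r powr (2 * bessel_shift m c + 1) * exp (- s * r\<^sup>2) * exp (L * r))" for r
  proof (cases "0 < r")
    case True
    show ?thesis unfolding weight_h_polar[OF m c True, symmetric] by (simp only: mult_ac)
  qed simp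
  with int show ?thesis by (simp only:)
qed

text \<open>For different indices the value of the radial integral is irrelevant, as the angular
  integral vanishes; existence alone must be known.\<close>

lemma integrable_radial_density:
  assumes m: "2 \<le> m" and c: "- 1 < c" and s: "0 < s" and X: "0 < X" and Z: "0 < Z"
  shows "integrable lborel (\<lambda>r. indicator {0<..} r * (r ^ (m - 1) * radial_density m c s X Z n l r))"
proof -
  obtain C L where C: "0 \<le> C" and b: "\<And>n t. 0 < t \<Longrightarrow> \<bar>bessel_radial m c n t\<bar> \<le> C * exp (L * t) * (1 / 2) ^ nat \<bar>n\<bar>"
  proof -
    have "(0::real) < 1 / 2" "(1 / 2 :: real) < 1" by simp_all
    from bessel_radial_bound[OF m c this] that show thesis by metis
  qed
  have b': "\<bar>bessel_radial m c n t\<bar> \<le> C * exp (L * t)" if "0 < t" for n t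
  proof -
    have "C * exp (L * t) * (1 / 2) ^ nat \<bar>n\<bar> \<le> C * exp (L * t) * 1"
      using C by (intro mult_left_mono power_le_one) auto
    with b[OF that, of n] show ?thesis by simp
  qed
  let ?f = "\<lambda>r. indicator {0<..} r * (r ^ (m - 1) * radial_density m c s X Z n l r)"
  let ?g = "\<lambda>r. C\<^sup>2 * (indicator {0<..} r * (r ^ (m - 1) * (exp (- s * r\<^sup>2) * weight_h m c r * exp (L * (X + Z) * r))))"
  show ?thesis
  proof (rule Bochner_Integration.integrable_bound)
    show "integrable lborel ?g"
      by (rule integrable_mult_right[OF integrable_radial_exp[OF m c s]])
    show "AE r in lborel. norm (?f r)
       \<le> norm (?g r)"
    proof (rule AE_I2)
      fix r :: real
      show "norm (?f r)
       \<le> norm (?g r)"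
      proof (cases "0 < r")
        case True
        have "\<bar>bessel_radial m c n (r * X) * bessel_radial m c l (Z * r)\<bar> \<le> (C * exp (L * (r * X))) * (C * exp (L * (Z * r)))"
          unfolding abs_mult using True X Z C by (intro mult_mono b') auto
        also have "\<dots> = C\<^sup>2 * exp (L * (X + Z) * r)"
          by (simp add: power2_eq_square exp_add[symmetric] algebra_simps)
        finally have *: "\<bar>bessel_radial m c n (r * X) * bessel_radial m c l (Z * r)\<bar> \<le> C\<^sup>2 * exp (L * (X + Z) * r)" .
        have w: "0 \<le> r ^ (m - 1) * (exp (- s * r\<^sup>2) * weight_h m c r)"
          using True by (simp add: weight_h_def)
        have "norm (?f r)
          = (r ^ (m - 1) * (exp (- s * r\<^sup>2) * weight_h m c r)) * \<bar>bessel_radial m c n (r * X) * bessel_radial m c l (Z * r)\<bar>"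
          using True w by (simp add: radial_density_def abs_mult weight_h_def)
        also have "\<dots> \<le> (r ^ (m - 1) * (exp (- s * r\<^sup>2) * weight_h m c r)) * (C\<^sup>2 * exp (L * (X + Z) * r))"
          by (rule mult_left_mono[OF * w])
        also have "\<dots> = norm (?g r)"
          using True by (simp add: abs_mult weight_h_def)
        finally show ?thesis .
      qed simp
    qed
  qed measurable
qed

text \<open>Weber's integral with a = X^2/4 and b = Z^2/4. The explicit exponential cancels the one
  inside \<open>omega_coeff\<close>; all dependence on n then sits in \<open>omega_coeff\<close>,
  and the diagonal terms again form a zonal series.\<close>

lemma integral_radial_density:
  assumes m: "2 \<le> m" and c: "- 1 < c" and s: "0 < s" and \<omega>: "2 * s = sinh \<omega>" and X: "0 < X" and Z: "0 < Z"
  shows "has_bochner_integral lborel (\<lambda>r. indicator {0<..} r * (r ^ (m - 1) * radial_density m c s X Z n n r))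
     (exp (- \<omega> * param_delta m c / 2) * exp (- (X\<^sup>2 + Z\<^sup>2) / (4 * s)) * omega_coeff m c \<omega> (Z * X) n)"
proof -
  define \<kappa> \<beta> \<nu> where "\<kappa> = bessel_index m c n" and "\<beta> = radial_exponent c n" and "\<nu> = bessel_shift m c"
  have \<kappa>: "\<kappa> = \<nu> + \<beta>" unfolding \<kappa>_def \<beta>_def \<nu>_def by (rule bessel_index_eq[OF c])
  have k: "- 1 / 2 \<le> \<kappa>"
    using bessel_shift_ge[OF m c] radial_exponent_bounds(1)[OF c, of n]
    unfolding \<kappa> \<beta>_def \<nu>_def by linarith
  \<comment> \<open>Collects the constants of both Bessel factors: two normalisations 2^(-\<nu>) and
    the power of X Z / 4. The matching r^(2\<beta>) is merged into the weight.\<close>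
  define D where "D = 2 powr (- \<nu>) * 2 powr (- \<nu>) * (X * Z / 4) powr \<beta>"
  have "has_bochner_integral lborel (\<lambda>r. D * (indicator {0<..} r * (r powr (2 * \<kappa> + 1) * exp (- s * r\<^sup>2)
        * (bessel_entire \<kappa> (- (X\<^sup>2 / 4) * r\<^sup>2) * bessel_entire \<kappa> (- (Z\<^sup>2 / 4) * r\<^sup>2)))))
     (D * (exp (- (X\<^sup>2 / 4 + Z\<^sup>2 / 4) / s) * bessel_entire \<kappa> (X\<^sup>2 / 4 * (Z\<^sup>2 / 4) / s\<^sup>2) / (2 * s powr (\<kappa> + 1))))"
    by (intro has_bochner_integral_mult_right weber_second_exponential_integral k s) simp_all
  moreover have "D * (indicator {0<..} r * (r powr (2 * \<kappa> + 1) * exp (- s * r\<^sup>2)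
        * (bessel_entire \<kappa> (- (X\<^sup>2 / 4) * r\<^sup>2) * bessel_entire \<kappa> (- (Z\<^sup>2 / 4) * r\<^sup>2))))
      = indicator {0<..} r * (r ^ (m - 1) * radial_density m c s X Z n n r)" for r
  proof (cases "0 < r")
    case True
    have 1: "(r * X / 2) powr \<beta> * (Z * r / 2) powr \<beta> = (X * Z / 4) powr \<beta> * r powr (2 * \<beta>)"
    proof -
      have "(r * X / 2) powr \<beta> * (Z * r / 2) powr \<beta> = ((r * X / 2) * (Z * r / 2)) powr \<beta>"
        by (rule powr_mult[symmetric])
      also have "(r * X / 2) * (Z * r / 2) = (X * Z / 4) * (r * r)" by simp
      also have "\<dots> powr \<beta> = (X * Z / 4) powr \<beta> * (r powr \<beta> * r powr \<beta>)"
        by (simp only: powr_mult)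
      also have "r powr \<beta> * r powr \<beta> = r powr (2 * \<beta>)"
        by (simp add: powr_add[symmetric])
      finally show ?thesis .
    qed
    have 2: "r powr (2 * \<kappa> + 1) = r powr (2 * \<nu> + 1) * r powr (2 * \<beta>)"
      unfolding \<kappa> powr_add[symmetric] by (simp add: algebra_simps)
    have 3: "- (X\<^sup>2 / 4) * r\<^sup>2 = - ((r * X)\<^sup>2 / 4)" "- (Z\<^sup>2 / 4) * r\<^sup>2 = - ((Z * r)\<^sup>2 / 4)"
      by (simp_all add: power_mult_distrib)
    define e1 e2 where "e1 = bessel_entire \<kappa> (- ((r * X)\<^sup>2 / 4))" and "e2 = bessel_entire \<kappa> (- ((Z * r)\<^sup>2 / 4))"
    have "r ^ (m - 1) * radial_density m c s X Z n n r
       = (r ^ (m - 1) * weight_h m c r) * exp (- s * r\<^sup>2)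
         * (2 powr (- \<nu>) * 2 powr (- \<nu>) * ((r * X / 2) powr \<beta> * (Z * r / 2) powr \<beta>) * (e1 * e2))"
      unfolding radial_density_def bessel_radial_def \<kappa>_def[symmetric] \<beta>_def[symmetric] \<nu>_def[symmetric] e1_def e2_def
      by (simp only: mult_ac)
    also have "\<dots> = D * (r powr (2 * \<kappa> + 1) * exp (- s * r\<^sup>2) * (e1 * e2))"
      unfolding weight_h_polar[OF m c True] 1 2 D_def \<nu>_def[symmetric] by (simp only: mult_ac)
    finally show ?thesis
      unfolding 3 e1_def[symmetric] e2_def[symmetric] using True by simp
  qed simp
  moreover have "D * (exp (- (X\<^sup>2 / 4 + Z\<^sup>2 / 4) / s) * bessel_entire \<kappa> (X\<^sup>2 / 4 * (Z\<^sup>2 / 4) / s\<^sup>2) / (2 * s powr (\<kappa> + 1)))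
     = exp (- \<omega> * param_delta m c / 2) * exp (- (X\<^sup>2 + Z\<^sup>2) / (4 * s)) * omega_coeff m c \<omega> (Z * X) n"
  proof -
    have 1: "- (X\<^sup>2 / 4 + Z\<^sup>2 / 4) / s = - (X\<^sup>2 + Z\<^sup>2) / (4 * s)"
      by (simp add: add_divide_distrib diff_divide_distrib)
    have 2: "X\<^sup>2 / 4 * (Z\<^sup>2 / 4) / s\<^sup>2 = ((Z * X) / sinh \<omega>)\<^sup>2 / 4"
      unfolding \<omega>[symmetric] by (simp add: power_mult_distrib power_divide)
    have 3: "exp (- \<omega> * param_delta m c / 2) * exp (\<omega> * param_delta m c / 2) = 1"
      by (simp add: exp_add[symmetric])
    \<comment> \<open>Since 4s = 2 sinh \<omega>, the power 4^(-\<kappa>) hidden in \<open>D\<close>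
      and s^(-\<kappa> - 1) from Weber's formula merge into a single power of 2 sinh
      \<omega>.\<close>
    have 4: "D / (2 * s powr (\<kappa> + 1)) = 2 * (2 * sinh \<omega>) powr (- \<kappa> - 1) * (Z * X) powr \<beta>"
    proof -
      have "2 powr (- \<nu>) * 2 powr (- \<nu>) = (2 * 2 :: real) powr (- \<nu>)"
        by (rule powr_mult[symmetric])
      also have "(2 * 2 :: real) = 4" by simp
      finally have f: "2 powr (- \<nu>) * 2 powr (- \<nu>) = (4 :: real) powr (- \<nu>)" .
      have "(X * Z / 4) powr \<beta> = (Z * X) powr \<beta> / 4 powr \<beta>"
        unfolding mult.commute[of Z] by (rule powr_divide)
      then have g: "(X * Z / 4) powr \<beta> = (Z * X) powr \<beta> * 4 powr (- \<beta>)"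
        by (simp only: powr_minus divide_inverse)
      have "4 powr (- \<kappa>) = 4 powr (- \<nu>) * (4 :: real) powr (- \<beta>)"
        unfolding powr_add[symmetric] \<kappa> minus_add_distrib ..
      then have D: "D = (Z * X) powr \<beta> * 4 powr (- \<kappa>)"
        unfolding D_def f g by (simp only: mult_ac)
      have w: "2 * sinh \<omega> = 4 * s" unfolding \<omega>[symmetric] by simp
      have n: "- \<kappa> - 1 = - (\<kappa> + 1)" by simp
      have "(2 * sinh \<omega>) powr (- \<kappa> - 1) = 4 powr (- \<kappa> - 1) * s powr (- (\<kappa> + 1))"
        unfolding w n by (rule powr_mult)
      also have "4 powr (- \<kappa> - 1) = 4 powr (- \<kappa>) / (4::real)"
        by (simp only: powr_diff powr_one)
      finally show ?thesis
        unfolding D by (simp only: powr_minus divide_inverse) simp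
    qed
    have "D * (exp (- (X\<^sup>2 + Z\<^sup>2) / (4 * s)) * bessel_entire \<kappa> (((Z * X) / sinh \<omega>)\<^sup>2 / 4) / (2 * s powr (\<kappa> + 1)))
      = exp (- (X\<^sup>2 + Z\<^sup>2) / (4 * s)) * (D / (2 * s powr (\<kappa> + 1))) * bessel_entire \<kappa> (((Z * X) / sinh \<omega>)\<^sup>2 / 4)"
      by simp
    also have "\<dots> = (exp (- \<omega> * param_delta m c / 2) * exp (\<omega> * param_delta m c / 2)) * exp (- (X\<^sup>2 + Z\<^sup>2) / (4 * s))
       * (2 * (2 * sinh \<omega>) powr (- \<kappa> - 1) * (Z * X) powr \<beta>) * bessel_entire \<kappa> (((Z * X) / sinh \<omega>)\<^sup>2 / 4)"
      unfolding 3 4 by simp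
    also have "\<dots> = exp (- \<omega> * param_delta m c / 2) * exp (- (X\<^sup>2 + Z\<^sup>2) / (4 * s)) * omega_coeff m c \<omega> (Z * X) n"
      unfolding omega_coeff_def \<kappa>_def \<beta>_def by (simp only: mult_ac)
    finally show ?thesis unfolding 1 2 .
  qed
  ultimately show ?thesis by (simp only:)
qed

lemma zonal_sum_mult:
  fixes y x z :: "(real, 'n::{finite,linorder}) vec"
  shows "(exp (- s * (norm y)\<^sup>2) * weight_h CARD('n) c (norm y)) *\<^sub>R
      (zonal_sum N (plus_coeff CARD('n) c (norm y * norm x)) (sgn y) (sgn x)
        \<star> zonal_sum N (\<lambda>n. cnj (plus_coeff CARD('n) c (norm z * norm y) n)) (sgn z) (sgn y))
    = (\<Sum>n\<in>{- int N..int N}. \<Sum>l\<in>{- int N..int N}. (phase c n * cnj (phase c l)) *s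
        (radial_density CARD('n) c s (norm x) (norm z) n l (norm y) *\<^sub>R (zonal n (sgn y) (sgn x) \<star> zonal l (sgn z) (sgn y))))"
proof -
  have e: "k *\<^sub>R (a *s u) = (of_real k * a) *s u" for k a and u :: "'n cclifford"
    by (simp add: vec_eq_iff) (simp add: scaleR_conv_of_real)
  have e': "a *s (k *\<^sub>R u) = (of_real k * a) *s u" for k a and u :: "'n cclifford"
    by (simp add: vec_eq_iff) (simp add: scaleR_conv_of_real)
  show ?thesis
    unfolding zonal_sum_def cl_mult_sum_left cl_mult_smult_left unfolding cl_mult_sum_right cl_mult_smult_right
    unfolding scaleR_sum_right vec.scale_sum_right e e' vector_smult_assoc plus_coeff_def radial_density_def
    by (intro sum.cong refl arg_cong2[of _ _ _ _ "(*s)"]) simp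
qed

lemma has_bochner_integral_zonal_sum_mult:
  fixes x z :: "(real, 'n::{finite,linorder}) vec"
  assumes m: "2 \<le> CARD('n)" and c: "- 1 < c" and s: "0 < s" and \<omega>: "2 * s = sinh \<omega>" and nz: "x \<noteq> 0" "z \<noteq> 0"
  shows "has_bochner_integral lborel (\<lambda>y. (exp (- s * (norm y)\<^sup>2) * weight_h CARD('n) c (norm y)) *\<^sub>R
      (zonal_sum N (plus_coeff CARD('n) c (norm y * norm x)) (sgn y) (sgn x)
        \<star> zonal_sum N (\<lambda>n. cnj (plus_coeff CARD('n) c (norm z * norm y) n)) (sgn z) (sgn y)))
    ((measure (sphere_measure :: (real, 'n) vec measure) UNIV * exp (- \<omega> * param_delta CARD('n) c / 2)
       * exp (- ((norm x)\<^sup>2 + (norm z)\<^sup>2) / (4 * s))) *\<^sub>R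
      zonal_sum N (\<lambda>n. of_real (omega_coeff CARD('n) c \<omega> (norm z * norm x) n)) (sgn z) (sgn x))"
proof -
  define T where "T = measure (sphere_measure :: (real, 'n) vec measure) UNIV"
  define E where "E = exp (- \<omega> * param_delta CARD('n) c / 2) * exp (- ((norm x)\<^sup>2 + (norm z)\<^sup>2) / (4 * s))"
  define \<rho> where "\<rho> = radial_density CARD('n) c s (norm x) (norm z)"
  define W where "W n = omega_coeff CARD('n) c \<omega> (norm z * norm x) n" for n
  let ?t = "\<lambda>n l. if n = l then (E * W n) *\<^sub>R (T *\<^sub>R zonal n (sgn z) (sgn x)) else 0"
  have X: "0 < norm x" "0 < norm z" using nz by simp_all
  have u: "norm (sgn x) = 1" "norm (sgn z) = 1" using nz by (simp_all add: norm_sgn)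
  have "has_bochner_integral lborel (\<lambda>y. \<rho> n l (norm y) *\<^sub>R (zonal n (sgn y) (sgn x) \<star> zonal l (sgn z) (sgn y)))
     (?t n l)" for n l
  proof (cases "n = l")
    case True
    have "has_bochner_integral lborel (\<lambda>r. indicator {0<..} r * (r ^ (DIM((real, 'n) vec) - 1) * \<rho> n n r)) (E * W n)"
      using integral_radial_density[OF m c s \<omega> X, of n] by (simp add: \<rho>_def E_def W_def)
    from has_bochner_integral_polar[OF this _ zonal_orthogonal[OF m u, of n n]] show ?thesis
      using True by (simp add: \<rho>_def T_def)
  next
    case False
    obtain I where "has_bochner_integral lborel (\<lambda>r. indicator {0<..} r * (r ^ (DIM((real, 'n) vec) - 1) * \<rho> n l r)) I"
      using has_bochner_integral_integrable[OF integrable_radial_density[OF m c s X, of n l]] by (simp add: \<rho>_def)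
    from has_bochner_integral_polar[OF this _ zonal_orthogonal[OF m u, of n l]] show ?thesis
      using False by (simp add: \<rho>_def)
  qed
  then have "has_bochner_integral lborel
     (\<lambda>y. \<Sum>n\<in>{- int N..int N}. \<Sum>l\<in>{- int N..int N}. (phase c n * cnj (phase c l)) *s
        (\<rho> n l (norm y) *\<^sub>R (zonal n (sgn y) (sgn x) \<star> zonal l (sgn z) (sgn y))))
     (\<Sum>n\<in>{- int N..int N}. \<Sum>l\<in>{- int N..int N}. (phase c n * cnj (phase c l)) *s
        (?t n l))"
    by (intro has_bochner_integral_sum has_bochner_integral_smult)
  moreover have "(\<Sum>n\<in>{- int N..int N}. \<Sum>l\<in>{- int N..int N}. (phase c n * cnj (phase c l)) *s
        (?t n l))
     = (T * E) *\<^sub>R zonal_sum N (\<lambda>n. of_real (W n)) (sgn z) (sgn x)"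
  proof -
    have "(\<Sum>l\<in>{- int N..int N}. (phase c n * cnj (phase c l)) *s
        (?t n l))
      = (T * E) *\<^sub>R (of_real (W n) *s zonal n (sgn z) (sgn x))" if n: "n \<in> {- int N..int N}" for n
    proof -
      \<comment> \<open>The second kernel carries conjugated coefficients, so on the diagonal the
        phases multiply to one.\<close>
      have ph: "phase c n * cnj (phase c n) = 1"
        using complex_norm_square[of "phase c n"] by (simp add: norm_phase)
      have "(\<Sum>l\<in>{- int N..int N}. (phase c n * cnj (phase c l)) *s
        (?t n l))
        = (\<Sum>l\<in>{- int N..int N}. if n = l then (E * W n) *\<^sub>R (T *\<^sub>R zonal n (sgn z) (sgn x)) else 0)"
        by (rule sum.cong) (auto simp: ph vec_eq_iff)
      also have "\<dots> = (E * W n) *\<^sub>R (T *\<^sub>R zonal n (sgn z) (sgn x))"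
        using n by simp
      also have "\<dots> = (T * E) *\<^sub>R (of_real (W n) *s zonal n (sgn z) (sgn x))"
        unfolding smult_of_real by (simp add: mult_ac)
      finally show ?thesis .
    qed
    then show ?thesis
      unfolding zonal_sum_def scaleR_sum_right by (intro sum.cong) auto
  qed
  ultimately show ?thesis
    unfolding zonal_sum_mult \<rho>_def W_def T_def E_def by (simp only: mult.assoc)
qed

section \<open>Passage to the limit in the symmetric partial sums\<close>

theorem theorem7p3:
  fixes c s \<omega> :: real
    and x z :: "(real, 'n::{finite,linorder}) vec"
  assumes "CARD('n) \<ge> 2"
    and "c > - 1"
    and "s > 0"
    and "\<omega> > 0"
    and "2 * s = sinh \<omega>"
    and "x \<noteq> 0"
    and "z \<noteq> 0"
  shows "integrable lborel (\<lambda>y::(real, 'n) vec.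
           (exp (- s * (norm y)\<^sup>2) * weight_h CARD('n) c (norm y)) *\<^sub>R (K_plus c y x \<star> K_minus c z y))
       \<and> (LINT y::(real, 'n) vec|lborel.
           (exp (- s * (norm y)\<^sup>2) * weight_h CARD('n) c (norm y)) *\<^sub>R (K_plus c y x \<star> K_minus c z y))
         = (sphere_area CARD('n) * exp (- \<omega> * param_delta CARD('n) c / 2)
              * exp (- ((norm x)\<^sup>2 + (norm z)\<^sup>2) / 2 * ((1 - cosh \<omega>) / sinh \<omega>)))
           *\<^sub>R K_omega c \<omega> z x"
proof -
  let ?R = "(sphere_area CARD('n) * exp (- \<omega> * param_delta CARD('n) c / 2)
              * exp (- ((norm x)\<^sup>2 + (norm z)\<^sup>2) / 2 * ((1 - cosh \<omega>) / sinh \<omega>)))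
           *\<^sub>R K_omega c \<omega> z x"
  note m = assms(1) and c = assms(2) and s = assms(3) and \<omega> = assms(5) and nz = assms(6,7)
  define X Z where "X = norm x" and "Z = norm z"
  have XZ: "0 < X" "0 < Z" using nz by (simp_all add: X_def Z_def)
  have u: "norm (sgn x) = 1" "norm (sgn z) = 1" using nz by (simp_all add: norm_sgn)
  define h where "h r = exp (- s * r\<^sup>2) * weight_h CARD('n) c r" for r
  have h0: "0 \<le> h r" for r by (simp add: h_def weight_h_def)
  define P where "P N y = zonal_sum N (plus_coeff CARD('n) c (norm y * norm x)) (sgn y) (sgn x)" for N and y :: "(real, 'n) vec"
  define Q where "Q N y = zonal_sum N (\<lambda>n. cnj (plus_coeff CARD('n) c (norm z * norm y) n)) (sgn z) (sgn y)" for N and y :: "(real, 'n) vec"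
  define F where "F N y = h (norm y) *\<^sub>R (P N y \<star> Q N y)" for N y
  define G where "G y = h (norm y) *\<^sub>R (K_plus c y x \<star> K_minus c z y)" for y
  define E where "E = measure (sphere_measure :: (real, 'n) vec measure) UNIV * exp (- \<omega> * param_delta CARD('n) c / 2)
       * exp (- (X\<^sup>2 + Z\<^sup>2) / (4 * s))"
  define O' where "O' N = zonal_sum N (\<lambda>n. of_real (omega_coeff CARD('n) c \<omega> (Z * X) n)) (sgn z) (sgn x)" for N
  have int: "has_bochner_integral lborel (F N) (E *\<^sub>R O' N)" for N
    using has_bochner_integral_zonal_sum_mult[OF m c s \<omega> nz, of N]
    unfolding F_def P_def Q_def h_def E_def O'_def X_def Z_def .
  have lim: "(\<lambda>N. F N y) \<longlonglongrightarrow> G y" for y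
  proof (cases "y = 0")
    case True
    \<comment> \<open>At the origin the weight takes the default value 0, because
      \<open>0 powr a = 0\<close>, so no statement about the kernels is required there.\<close>
    then show ?thesis by (simp add: F_def G_def h_def weight_h_def)
  next
    case False
    show ?thesis
      unfolding F_def G_def P_def Q_def
      by (intro tendsto_scaleR tendsto_const bounded_bilinear.tendsto[OF bounded_bilinear_cl_mult]
          K_plus_limit[OF m c False nz(1)] K_minus_limit[OF m c nz(2) False])
  qed
  define q where "q = 1 / (2 * (3 + 2 * real CARD('n)))"
  have q: "0 < q" "q < 1" by (simp_all add: q_def divide_less_eq add_pos_nonneg)
  obtain C L where C: "0 \<le> C" and b: "\<And>n t. 0 < t \<Longrightarrow> \<bar>bessel_radial CARD('n) c n t\<bar> \<le> C * exp (L * t) * q ^ nat \<bar>n\<bar>"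
    using bessel_radial_bound[OF m c q] by metis
  obtain K where K: "0 < K" and zb: "\<And>N p C. \<And>\<eta> \<xi> :: (real, 'n) vec. norm \<eta> = 1 \<Longrightarrow> norm \<xi> = 1 \<Longrightarrow> 0 \<le> C \<Longrightarrow>
     (\<And>n. cmod (p n) \<le> C * q ^ nat \<bar>n\<bar>) \<Longrightarrow> norm (zonal_sum N p \<eta> \<xi>) \<le> K * C"
    using zonal_sum_bound[where 'n = 'n] unfolding q_def by metis
  obtain B where B: "0 < B" "\<And>u v :: 'n cclifford. norm (u \<star> v) \<le> norm u * norm v * B"
    using bounded_bilinear.pos_bounded[OF bounded_bilinear_cl_mult] by blast
  have pb: "cmod (plus_coeff CARD('n) c t n) \<le> C * exp (L * t) * q ^ nat \<bar>n\<bar>" if "0 < t" for t n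
    using b[OF that, of n] by (simp add: plus_coeff_def norm_mult norm_phase)
  \<comment> \<open>The majorant is independent of \<open>N\<close>: each kernel contributes a
    factor K C and an exponential linear in |y|, and B is the norm constant of the Clifford
    product.\<close>
  define W where "W y = ((K * C)\<^sup>2 * B) * (h (norm y) * exp (L * (X + Z) * norm y))" for y :: "(real, 'n) vec"
  have dom: "norm (F N y) \<le> W y" for N y
  proof (cases "y = 0")
    case False
    then have y: "0 < norm y" "norm (sgn y) = 1" by (simp_all add: norm_sgn)
    have 1: "norm (P N y) \<le> K * (C * exp (L * (norm y * X)))"
      unfolding P_def X_def[symmetric] using C y XZ by (intro zb u pb) auto
    have 2: "norm (Q N y) \<le> K * (C * exp (L * (Z * norm y)))"
      unfolding Q_def Z_def[symmetric] using C y XZ by (intro zb u) (auto intro!: pb)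
    have "norm (P N y \<star> Q N y) \<le> norm (P N y) * norm (Q N y) * B"
      by (rule B)
    also have "\<dots> \<le> (K * (C * exp (L * (norm y * X)))) * (K * (C * exp (L * (Z * norm y)))) * B"
      using 1 2 K C B(1) by (intro mult_right_mono mult_mono) auto
    also have "\<dots> = ((K * C)\<^sup>2 * B) * exp (L * (X + Z) * norm y)"
    proof -
      have "exp (L * (X + Z) * norm y) = exp (L * (norm y * X)) * exp (L * (Z * norm y))"
        by (simp add: exp_add[symmetric] algebra_simps)
      then show ?thesis by (simp add: power2_eq_square)
    qed
    finally have "h (norm y) * norm (P N y \<star> Q N y) \<le> h (norm y) * (((K * C)\<^sup>2 * B) * exp (L * (X + Z) * norm y))"
      by (rule mult_left_mono) (rule h0)
    then show ?thesis
      using h0[of "norm y"] by (simp add: F_def W_def mult_ac)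
  qed (use K C B in \<open>simp add: F_def W_def h_def weight_h_def\<close>)
  have Wi: "integrable lborel W"
  proof -
    interpret finite_measure "sphere_measure :: (real, 'n) vec measure"
      by (rule finite_measure_sphere_measure)
    have hm: "(\<lambda>r. h r * exp (L * (X + Z) * r)) \<in> borel_measurable borel"
      unfolding h_def by measurable
    have "has_bochner_integral lborel (\<lambda>r. indicator {0<..} r * (r ^ (DIM((real, 'n) vec) - 1) * (h r * exp (L * (X + Z) * r))))
      (LINT r|lborel. indicator {0<..} r * (r ^ (DIM((real, 'n) vec) - 1) * (h r * exp (L * (X + Z) * r))))"
      using integrable_radial_exp[OF m c s, of "L * (X + Z)"]
      by (intro has_bochner_integral_integrable) (simp add: h_def)
    from has_bochner_integral_polar[OF this hm has_bochner_integral_integrable[OF integrable_const[of "1 :: real"]]]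
    have "integrable lborel (\<lambda>y :: (real, 'n) vec. h (norm y) * exp (L * (X + Z) * norm y))"
      by (auto simp: has_bochner_integral_iff)
    then show ?thesis unfolding W_def by (rule integrable_mult_right)
  qed
  have Fm: "F N \<in> borel_measurable lborel" for N
    using int by (rule borel_measurable_has_bochner_integral)
  \<comment> \<open>The kernels are given by infinite series; measurability of the integrand is
    inherited as a pointwise limit.\<close>
  have Gm: "G \<in> borel_measurable lborel"
    by (rule borel_measurable_LIMSEQ_metric[OF Fm]) (rule lim)
  have "integrable lborel G"
    by (rule integrable_dominated_convergence[OF Gm Fm Wi AE_I2[OF lim] AE_I2[OF dom]])
  moreover have "integral\<^sup>L lborel G = ?R"
  proof (rule LIMSEQ_unique)
    show "(\<lambda>N. integral\<^sup>L lborel (F N)) \<longlonglongrightarrow> integral\<^sup>L lborel G"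
      by (rule integral_dominated_convergence[OF Gm Fm Wi AE_I2[OF lim] AE_I2[OF dom]])
    define e1 e2 where "e1 = exp (- ((norm x)\<^sup>2 + (norm z)\<^sup>2) / 2 * ((1 - cosh \<omega>) / sinh \<omega>))"
      and "e2 = exp (- (cosh \<omega> / sinh \<omega>) / 2 * ((norm z)\<^sup>2 + (norm x)\<^sup>2))"
    have area: "measure (sphere_measure :: (real, 'n) vec measure) UNIV = sphere_area CARD('n)"
      unfolding measure_sphere_measure sphere_area_def by simp
    \<comment> \<open>Writing 1/sinh \<omega> as (1 - cosh \<omega>)/sinh \<omega> + coth \<omega>
      splits the exponent into the factor of the claim and the Gaussian prefactor of the kernel at
      \<omega>.\<close>
    have "exp (- (X\<^sup>2 + Z\<^sup>2) / (4 * s)) = e1 * e2"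
    proof -
      have S: "sinh \<omega> \<noteq> 0" "4 * s = 2 * sinh \<omega>" using s \<omega> by auto
      have "- (X\<^sup>2 + Z\<^sup>2) / (4 * s) = - ((norm x)\<^sup>2 + (norm z)\<^sup>2) / 2 * ((1 - cosh \<omega>) / sinh \<omega>)
          + - (cosh \<omega> / sinh \<omega>) / 2 * ((norm z)\<^sup>2 + (norm x)\<^sup>2)"
        unfolding S(2) X_def Z_def using S(1) by (simp add: field_simps)
      then show ?thesis unfolding e1_def e2_def by (simp only: exp_add)
    qed
    then have "E = (sphere_area CARD('n) * exp (- \<omega> * param_delta CARD('n) c / 2) * e1) * e2"
      by (simp add: E_def area)
    then have "integral\<^sup>L lborel (F N) = (sphere_area CARD('n) * exp (- \<omega> * param_delta CARD('n) c / 2) * e1) *\<^sub>R (e2 *\<^sub>R O' N)" for N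
      using int[of N] by (simp add: has_bochner_integral_iff)
    moreover have "(\<lambda>N. e2 *\<^sub>R O' N) \<longlonglongrightarrow> K_omega c \<omega> z x"
      using K_omega_limit[OF m c nz(2,1) assms(4)] unfolding O'_def e2_def X_def Z_def .
    ultimately show "(\<lambda>N. integral\<^sup>L lborel (F N)) \<longlonglongrightarrow> ?R"
      unfolding e1_def[symmetric] by (simp only:) (intro tendsto_scaleR tendsto_const)
  qed
  ultimately show ?thesis
    unfolding G_def h_def by blast
qed

end
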